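(* For every $c\in(0,1)$, \[ \lim_{n\to\infty}\frac{\log_2|\mathcal{C}(n,c)|}{\binom n2} =\lim_{n\to\infty}\frac{\log_2|\mathcal{P}(n,c)|}{\binom n2} =\lim_{n\to\infty}\frac{\log_2|\mathcal{S}(n,c)|}{\binom n2} =h(c). \]
   Context: For $c\in[0,1]$ let $\mathcal{G}_n(c)$ be the set of all graphs on vertex set $[n]=\{1,\dots,n\}$ with $c\binom n2$ edges (the paper ignores rounding of $c\binom n2$ to an integer). Let $\mathcal{C}(n,c)$ be the set of graphs in $\mathcal{G}_n(c)$ containing no induced copy of the $5$-cycle $C_5$; $\mathcal{P}(n,c)$ the set of perfect graphs in $\mathcal{G}_n(c)$ (a graph is perfect if every induced subgraph has chromatic number equal to its clique number); and $\mathcal{S}(n,c)$ the set of generalised split graphs in $\mathcal{G}_n(c)$. A graph $G=(V,E)$ admits a generalised clique partition if there is a partition $V=V_1\cup\dots\cup V_k$ such that each $G[V_i]$ is a clique and for all $i>j>1$ there are no edges between $V_i$ and $V_j$; $G$ is a generalised split graph if $G$ or its complement admits a generalised clique partition. Let $H(x)=-x\log_2x-(1-x)\log_2(1-x)$ be the binary entropy function and \[h(c)=\begin{cases}H(2c)/2 & 0<c<\tfrac14,\\ 1/2 & \tfrac14\le c\le\tfrac34,\\ H(2c-1)/2 & \tfrac34<c<1.\end{cases}\] *)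

theory Defs
  imports "HOL-Analysis.Analysis" "HOL-Library.Ramsey"
begin

text \<open>
  A finite simple graph is given by its vertex set \<open>V\<close> and its edge set \<open>E \<subseteq> [V]\<^bsup>2\<^esup>\<close>,
  the latter being the set of two-element subsets of \<open>V\<close> from \<open>HOL-Library.Ramsey\<close>.
  The predicate \<open>clique K E\<close> is also the one from that theory.
\<close>

definition induced_edges :: "'a set \<Rightarrow> 'a set set \<Rightarrow> 'a set set" where
  "induced_edges W E = {e \<in> E. e \<subseteq> W}"

definition complement_edges :: "'a set \<Rightarrow> 'a set set \<Rightarrow> 'a set set" where
  "complement_edges V E = [V]\<^bsup>2\<^esup> - E"

definition contains_induced ::
    "'b set \<Rightarrow> 'b set set \<Rightarrow> 'a set \<Rightarrow> 'a set set \<Rightarrow> bool" where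
  "contains_induced W F V E \<longleftrightarrow>
     (\<exists>f. inj_on f W \<and> f ` W \<subseteq> V \<and> (\<forall>x\<in>W. \<forall>y\<in>W. {x, y} \<in> F \<longleftrightarrow> {f x, f y} \<in> E))"

definition C5_vertices :: "nat set" where
  "C5_vertices = {..<5}"

definition C5_edges :: "nat set set" where
  "C5_edges = {{i, (i + 1) mod 5} | i. i < 5}"

definition proper_colouring :: "'a set \<Rightarrow> 'a set set \<Rightarrow> nat \<Rightarrow> ('a \<Rightarrow> nat) \<Rightarrow> bool" where
  "proper_colouring V E k f \<longleftrightarrow>
     f ` V \<subseteq> {..<k} \<and> (\<forall>x\<in>V. \<forall>y\<in>V. {x, y} \<in> E \<longrightarrow> f x \<noteq> f y)"

definition chromatic_number :: "'a set \<Rightarrow> 'a set set \<Rightarrow> nat" where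
  "chromatic_number V E = (LEAST k. \<exists>f. proper_colouring V E k f)"

definition clique_number :: "'a set \<Rightarrow> 'a set set \<Rightarrow> nat" where
  "clique_number V E = Max {card K | K. K \<subseteq> V \<and> clique K E}"

definition perfect_graph :: "'a set \<Rightarrow> 'a set set \<Rightarrow> bool" where
  "perfect_graph V E \<longleftrightarrow>
     (\<forall>W\<subseteq>V. chromatic_number W (induced_edges W E) = clique_number W (induced_edges W E))"

text \<open>The part \<open>P 1\<close> is special: edges between it and the other parts are unrestricted.\<close>

definition generalised_clique_partition :: "'a set \<Rightarrow> 'a set set \<Rightarrow> nat \<Rightarrow> (nat \<Rightarrow> 'a set) \<Rightarrow> bool" where
  "generalised_clique_partition V E k P \<longleftrightarrow>
     (\<Union>i\<in>{1..k}. P i) = V \<and> disjoint_family_on P {1..k} \<and> (\<forall>i\<in>{1..k}. P i \<noteq> {}) \<and>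
     (\<forall>i\<in>{1..k}. clique (P i) E) \<and>
     (\<forall>i\<in>{1..k}. \<forall>j\<in>{1..k}. i > j \<and> j > 1 \<longrightarrow> (\<forall>x\<in>P i. \<forall>y\<in>P j. {x, y} \<notin> E))"

definition admits_generalised_clique_partition :: "'a set \<Rightarrow> 'a set set \<Rightarrow> bool" where
  "admits_generalised_clique_partition V E \<longleftrightarrow> (\<exists>k P. generalised_clique_partition V E k P)"

definition generalised_split_graph :: "'a set \<Rightarrow> 'a set set \<Rightarrow> bool" where
  "generalised_split_graph V E \<longleftrightarrow>
     admits_generalised_clique_partition V E \<or>
     admits_generalised_clique_partition V (complement_edges V E)"

text \<open>
  The labelled graphs on \<open>{1..n}\<close> with exactly \<open>m\<close> edges, identified with their edge sets.
  A density \<open>c\<close> is turned into an edge count by \<open>edge_count_rounding\<close>: the number of edges for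
  each \<open>n\<close> is either of the two roundings of \<open>c * (n choose 2)\<close> to an adjacent integer (the
  number itself if it is an integer), and the choice may vary with \<open>n\<close>.
\<close>

definition graphs_with_edges :: "nat \<Rightarrow> nat \<Rightarrow> nat set set set" where
  "graphs_with_edges n m = {E. E \<subseteq> [{1..n}]\<^bsup>2\<^esup> \<and> card E = m}"

definition edge_count_rounding :: "real \<Rightarrow> (nat \<Rightarrow> nat) \<Rightarrow> bool" where
  "edge_count_rounding c m \<longleftrightarrow>
     (\<forall>n. int (m n) = \<lfloor>c * real (n choose 2)\<rfloor> \<or> int (m n) = \<lceil>c * real (n choose 2)\<rceil>)"

definition induced_C5_free_graphs :: "nat \<Rightarrow> nat \<Rightarrow> nat set set set" where
  "induced_C5_free_graphs n m =
     {E \<in> graphs_with_edges n m. \<not> contains_induced C5_vertices C5_edges {1..n} E}"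

definition perfect_graphs :: "nat \<Rightarrow> nat \<Rightarrow> nat set set set" where
  "perfect_graphs n m = {E \<in> graphs_with_edges n m. perfect_graph {1..n} E}"

definition generalised_split_graphs :: "nat \<Rightarrow> nat \<Rightarrow> nat set set set" where
  "generalised_split_graphs n m = {E \<in> graphs_with_edges n m. generalised_split_graph {1..n} E}"

definition binary_entropy :: "real \<Rightarrow> real" where
  "binary_entropy x = - x * log 2 x - (1 - x) * log 2 (1 - x)"

text \<open>Only the values for \<open>0 < c < 1\<close> are meaningful.\<close>

definition entropy_density :: "real \<Rightarrow> real" where
  "entropy_density c =
     (if c < 1/4 then binary_entropy (2 * c) / 2
      else if c \<le> 3/4 then 1/2
      else binary_entropy (2 * c - 1) / 2)"

end

theory Submission
  imports Defs "HOL-Real_Asymp.Real_Asymp"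
begin

text \<open>
  Generalised split graphs are perfect and perfect graphs contain no induced \<open>C\<^sub>5\<close>, so it suffices
  to bound the generalised split graphs from below and the \<open>C\<^sub>5\<close>-free graphs from above.

  For the upper bound put \<open>q = max p (1 - p)\<close> and consider the probability \<open>w\<^sub>n\<close> that the random
  graph \<open>G(n, p)\<close> has no induced \<open>C\<^sub>5\<close>. Every large \<open>C\<^sub>5\<close>-free graph has a vertex set \<open>T\<close> of bounded
  size such that the possible neighbourhoods in \<open>T\<close> of the other vertices have total weight about
  \<open>q\<close> to the power \<open>|T|/2\<close>. If few traces occur on some fixed set, take that set. Otherwise a large
  set is shattered, and Ramsey's theorem yields two homogeneous sets of the same size joined by a
  prescribed quasirandom bipartite graph; a vertex splitting both of them substantially would
  complete an induced \<open>C\<^sub>5\<close>, so it attaches freely to at most one. Peeling off such sets one after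
  another gives \<open>w\<^sub>n \<le> q\<close> to the power \<open>n\<^sup>2/4 - o(n\<^sup>2)\<close>, and the best choice of \<open>p\<close>
  (\<open>2c\<close>, \<open>1/2\<close> or \<open>2c - 1\<close>) turns this into the count.

  For the lower bound take a bipartition into two halves with arbitrary edges across, one half
  independent and the other the complement of a clique plus isolated vertices, the clique size
  being tuned to the density; densities above \<open>1/2\<close> follow by complementation.
\<close>

subsection \<open>Hall's theorem\<close>

text \<open>Graphs with a prescribed number of edges do not peel well, because deleting
  \<open>T\<close> leaves an unknown number of edges. Under the product measure the pairs inside
  \<open>T\<close>, between \<open>T\<close> and the rest, and inside the rest are independent, so
  weights multiply. The count is recovered at the end, since all graphs with \<open>m\<close> edges
  have the same weight. The choice of \<open>p\<close> minimises the resulting exponent; the breaks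
  at 1/4 and 3/4 are where the minimiser reaches 1/2 and \<open>q\<close> switches between
  \<open>1 - p\<close> and \<open>p\<close>.

  The half in the exponent arises as follows. A homogeneous pair has \<open>2 * t\<close> vertices,
  and every outside vertex has a nearly constant trace on one of the two sets. That trace has weight
  about \<open>q ^ t\<close>, while the trace on the other set is free and contributes only a factor
  1.

  Each round of peeling selects a set \<open>T\<close> and a family of traces. As \<open>T\<close>
  is bounded in terms of \<open>p\<close> and the permitted loss, there are polynomially many
  choices, hence a total factor \<open>n\<close> to the power \<open>O(n)\<close>. A slightly larger
  base absorbs it, which is why every bound below carries a strict inequality between two
  bases.\<close>

text \<open>The induction splits on whether some non-empty proper \<open>J\<close> is tight. If so,
  \<open>J\<close> is matched into its neighbourhood and the rest outside it; if not, fixing one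
  edge costs every remaining set at most one neighbour, which the slack allows.\<close>

theorem hall_marriage:
  fixes N :: "'a \<Rightarrow> 'b set"
  assumes "finite I" and "\<And>i. i \<in> I \<Longrightarrow> finite (N i)"
    and "\<And>J. J \<subseteq> I \<Longrightarrow> card J \<le> card (\<Union>i\<in>J. N i)"
  shows "\<exists>f. inj_on f I \<and> (\<forall>i\<in>I. f i \<in> N i)"
  using assms
proof (induction "card I" arbitrary: I N rule: less_induct)
  case less
  note fin = less.prems(1) and finN = less.prems(2) and hall = less.prems(3)
  show ?case
  proof (cases "I = {}")
    case True
    then show ?thesis by auto
  next
    case nonempty: False
    show ?thesis
    proof (cases "\<exists>J. J \<subset> I \<and> J \<noteq> {} \<and> card (\<Union>i\<in>J. N i) \<le> card J")
      case True
      then obtain J where J: "J \<subset> I" "J \<noteq> {}" and tight: "card (\<Union>i\<in>J. N i) \<le> card J" by blast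
      define M where "M = (\<Union>i\<in>J. N i)"
      have finJ: "finite J" using J fin finite_subset by blast
      have finM: "finite M" unfolding M_def using finJ finN J by auto
      have cM: "card M = card J"
        using tight hall[of J] J unfolding M_def by auto
      have "card J < card I" using J fin psubset_card_mono by blast
      then have "\<exists>f. inj_on f J \<and> (\<forall>i\<in>J. f i \<in> N i)"
        by (rule less.hyps) (use J finJ finN hall in auto)
      then obtain f where f: "inj_on f J" "\<And>i. i \<in> J \<Longrightarrow> f i \<in> N i" by blast
      have "card (I - J) < card I" using J fin
        by (metis Diff_subset card_mono finJ inf.absorb_iff2 less_le nonempty psubsetE card_Diff_subset card_gt_0_iff diff_less)
      then have "\<exists>g. inj_on g (I - J) \<and> (\<forall>i\<in>I - J. g i \<in> N i - M)"
      proof (rule less.hyps)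
        show "finite (I - J)" using fin by simp
        show "finite (N i - M)" if "i \<in> I - J" for i using finN that by simp
        show "card L \<le> card (\<Union>i\<in>L. N i - M)" if L: "L \<subseteq> I - J" for L
        proof -
          have finL: "finite L" using L fin finite_subset by blast
          \<comment> \<open>Hall's condition for \<open>L \<union> J\<close> survives the removal of
            \<open>M\<close>, since \<open>M\<close> has exactly \<open>card J\<close>
            elements.\<close>
          have "card L + card J = card (L \<union> J)"
            using L finL finJ by (subst card_Un_disjoint) auto
          also have "\<dots> \<le> card (\<Union>i\<in>L \<union> J. N i)"
            using hall[of "L \<union> J"] L J by auto
          also have "(\<Union>i\<in>L \<union> J. N i) = (\<Union>i\<in>L. N i - M) \<union> M"
            unfolding M_def by auto
          also have "card \<dots> \<le> card (\<Union>i\<in>L. N i - M) + card M"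
            by (rule card_Un_le)
          finally show ?thesis using cM by simp
        qed
      qed
      then obtain g where g: "inj_on g (I - J)" "\<And>i. i \<in> I - J \<Longrightarrow> g i \<in> N i - M" by blast
      define h where "h i = (if i \<in> J then f i else g i)" for i
      have "inj_on h I"
        using f g unfolding h_def inj_on_def M_def by (smt (verit) Diff_iff UN_I)
      moreover have "\<forall>i\<in>I. h i \<in> N i" using f g unfolding h_def by auto
      ultimately show ?thesis by blast
    next
      case False
      then have slack: "card J < card (\<Union>i\<in>J. N i)" if "J \<subset> I" "J \<noteq> {}" for J
        using that by (meson not_le)
      obtain i where i: "i \<in> I" using nonempty by blast
      have "N i \<noteq> {}" using hall[of "{i}"] i by auto
      then obtain x where x: "x \<in> N i" by blast
      have "card (I - {i}) < card I" using i fin by (simp add: card_gt_0_iff nonempty)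
      then have "\<exists>g. inj_on g (I - {i}) \<and> (\<forall>j\<in>I - {i}. g j \<in> N j - {x})"
      proof (rule less.hyps)
        show "finite (I - {i})" using fin by simp
        show "finite (N j - {x})" if "j \<in> I - {i}" for j using finN that by simp
        show "card J \<le> card (\<Union>j\<in>J. N j - {x})" if J: "J \<subseteq> I - {i}" for J
        proof (cases "J = {}")
          case False
          have "J \<subset> I" using J i by auto
          then have "card J < card (\<Union>j\<in>J. N j)" using slack False by blast
          moreover have "(\<Union>j\<in>J. N j - {x}) = (\<Union>j\<in>J. N j) - {x}" by auto
          ultimately show ?thesis
            by (simp add: card_Diff_singleton_if) linarith
        qed simp
      qed
      then obtain g where g: "inj_on g (I - {i})" "\<And>j. j \<in> I - {i} \<Longrightarrow> g j \<in> N j - {x}" by blast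
      have "inj_on (g(i := x)) I"
        using g unfolding inj_on_def by (auto split: if_splits)
      moreover have "\<forall>j\<in>I. (g(i := x)) j \<in> N j" using g x by auto
      ultimately show ?thesis by blast
    qed
  qed
qed

subsection \<open>Shattered sets\<close>

definition shatters :: "'a set set \<Rightarrow> 'a set \<Rightarrow> bool" where
  "shatters F X \<longleftrightarrow> (\<forall>Y\<subseteq>X. \<exists>S\<in>F. S \<inter> X = Y)"

text \<open>Pajor's form of the Sauer-Shelah lemma. Splitting off \<open>x\<close> gives two
  families on \<open>U\<close>, the members avoiding \<open>x\<close> and those containing it with
  \<open>x\<close> deleted. A set shattered by the union is shattered by \<open>F\<close>; one
  shattered by the intersection stays shattered after adding \<open>x\<close>. Counting the union
  and the intersection of the families loses nothing.\<close>

lemma card_le_card_shattered: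
  assumes "finite U" and "F \<subseteq> Pow U"
  shows "card F \<le> card {X. X \<subseteq> U \<and> shatters F X}"
  using assms
proof (induction U arbitrary: F rule: finite_induct)
  case empty
  then have "F = {} \<or> F = {{}}" by auto
  then show ?case
  proof
    assume F: "F = {{}}"
    have "shatters {{}} {}" by (simp add: shatters_def)
    then have "{X. X \<subseteq> {} \<and> shatters F X} = {{}}" using F by blast
    then show ?thesis using F by simp
  qed simp
next
  case (insert x U)
  define B0 where "B0 = {S \<in> F. x \<notin> S}"
  define C1 where "C1 = {S \<in> F. x \<in> S}"
  define B1 where "B1 = (\<lambda>S. S - {x}) ` C1"
  define sh where "sh G = {X. X \<subseteq> U \<and> shatters G X}" for G
  have finF: "finite F" using insert by (meson finite_Pow_iff finite_insert finite_subset)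
  have "F = B0 \<union> C1" "B0 \<inter> C1 = {}" unfolding B0_def C1_def by auto
  then have "card F = card B0 + card C1"
    using finF by (metis card_Un_disjoint finite_Un)
  also have "card C1 = card B1"
    unfolding B1_def by (subst card_image) (auto simp: inj_on_def C1_def)
  also have "card B0 + card B1 = card (B0 \<union> B1) + card (B0 \<inter> B1)"
    using finF by (intro card_Un_Int) (auto simp: B0_def B1_def C1_def)
  also have "\<dots> \<le> card (sh (B0 \<union> B1)) + card (sh (B0 \<inter> B1))"
    unfolding sh_def using insert
    by (intro add_mono insert.IH) (auto simp: B0_def B1_def C1_def)
  also have "card (sh (B0 \<inter> B1)) = card (Set.insert x ` sh (B0 \<inter> B1))"
    using insert(2) by (subst card_image) (auto simp: inj_on_def sh_def)
  also have "card (sh (B0 \<union> B1)) + card (Set.insert x ` sh (B0 \<inter> B1))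
      = card (sh (B0 \<union> B1) \<union> Set.insert x ` sh (B0 \<inter> B1))"
    using insert(1,2) by (subst card_Un_disjoint) (auto simp: sh_def)
  also have "\<dots> \<le> card {X. X \<subseteq> insert x U \<and> shatters F X}"
  proof (intro card_mono subsetI)
    show "finite {X. X \<subseteq> insert x U \<and> shatters F X}" using insert(1) by auto
    fix X assume X: "X \<in> sh (B0 \<union> B1) \<union> Set.insert x ` sh (B0 \<inter> B1)"
    show "X \<in> {X. X \<subseteq> insert x U \<and> shatters F X}"
    proof (cases "X \<in> sh (B0 \<union> B1)")
      case True
      have "\<exists>S\<in>F. S \<inter> X = Y" if Y: "Y \<subseteq> X" for Y
      proof -
        have "shatters (B0 \<union> B1) X" using True unfolding sh_def by simp
        then obtain S where S: "S \<in> B0 \<union> B1" "S \<inter> X = Y"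
          using Y unfolding shatters_def by metis
        have "x \<notin> X" using True insert(2) unfolding sh_def by auto
        then have drop: "(S' - {x}) \<inter> X = S' \<inter> X" for S' by auto
        from S(1) obtain S' where "S' \<in> F" "S = S' \<or> S = S' - {x}"
          unfolding B0_def B1_def C1_def by blast
        then show ?thesis using S(2) drop by metis
      qed
      then show ?thesis using True unfolding sh_def shatters_def by auto
    next
      case False
      then obtain Z where Z: "X = insert x Z" "Z \<in> sh (B0 \<inter> B1)" using X by auto
      have xZ: "x \<notin> Z" using Z insert(2) unfolding sh_def by auto
      have "\<exists>S\<in>F. S \<inter> X = Y" if Y: "Y \<subseteq> X" for Y
      proof -
        have "Y - {x} \<subseteq> Z" using that Z by auto
        moreover have "shatters (B0 \<inter> B1) Z" using Z unfolding sh_def by simp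
        ultimately obtain S where S: "S \<in> B0 \<inter> B1" "S \<inter> Z = Y - {x}"
          unfolding shatters_def by metis
        have S0: "S \<in> F" "x \<notin> S" using S unfolding B0_def by auto
        obtain S' where "S' \<in> F" "x \<in> S'" "S = S' - {x}"
          using S(1) unfolding B1_def C1_def by blast
        then have S1: "insert x S \<in> F" by (simp add: insert_absorb)
        show ?thesis
        proof (cases "x \<in> Y")
          case True
          then show ?thesis using S S1 Z by (intro bexI[of _ "insert x S"]) auto
        next
          case False
          then show ?thesis using S S0 Z by (intro bexI[of _ S]) auto
        qed
      qed
      then show ?thesis using Z unfolding sh_def shatters_def by auto
    qed
  qed
  finally show ?case .
qed

text \<open>A crude count that keeps the later algebra simple: a set with at most \<open>d\<close>
  elements either has fewer than \<open>d\<close> or is a smaller set plus one element, so each step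
  multiplies the count by at most \<open>card U + 1\<close>. The step from \<open>d = 0\<close> is
  separate because the empty set has no element to remove.\<close>

lemma card_small_subsets_le:
  assumes "finite U"
  shows "card {X. X \<subseteq> U \<and> card X < d} \<le> (card U + 1) ^ d"
proof (induction d)
  case 0
  then show ?case by simp
next
  case (Suc d)
  show ?case
  proof (cases "d = 0")
    case True
    have "{X. X \<subseteq> U \<and> card X < Suc 0} = {{}}"
      using assms finite_subset by fastforce
    then show ?thesis using True by simp
  next
    case False
    define g where "g = (\<lambda>(z, Y). case z of None \<Rightarrow> Y | Some x \<Rightarrow> insert (x::'a) Y)"
    define Z where "Z = (insert None (Some ` U)) \<times> {X. X \<subseteq> U \<and> card X < d}"
    have finZ: "finite Z" unfolding Z_def using assms by auto
    have "{X. X \<subseteq> U \<and> card X < Suc d} \<subseteq> g ` Z"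
    proof
      fix X assume X: "X \<in> {X. X \<subseteq> U \<and> card X < Suc d}"
      show "X \<in> g ` Z"
      proof (cases "card X < d")
        case True
        then have "(None, X) \<in> Z" "g (None, X) = X" using X unfolding Z_def g_def by auto
        then show ?thesis by (metis imageI)
      next
        case nlt: False
        then have cX: "card X = d" using X by auto
        then obtain x where x: "x \<in> X" using \<open>d \<noteq> 0\<close> by fastforce
        have "card (X - {x}) < d" using x cX \<open>d \<noteq> 0\<close> by (simp add: card_Diff_singleton)
        then have "(Some x, X - {x}) \<in> Z" "g (Some x, X - {x}) = X"
          using X x unfolding Z_def g_def by auto
        then show ?thesis by (metis imageI)
      qed
    qed
    then have "card {X. X \<subseteq> U \<and> card X < Suc d} \<le> card Z"
      using finZ by (rule surj_card_le[rotated])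
    also have "\<dots> = (card U + 1) * card {X. X \<subseteq> U \<and> card X < d}"
      unfolding Z_def using assms by (simp add: card_cartesian_product card_insert_if card_image)
    also have "\<dots> \<le> (card U + 1) * (card U + 1) ^ d"
      using Suc.IH by (intro mult_le_mono2)
    finally show ?thesis by simp
  qed
qed

text \<open>By the two counts above, too many members force a shattered set that is not among the
  small ones.\<close>

lemma exists_shattered_set:
  assumes "finite U" and "F \<subseteq> Pow U" and "card F > (card U + 1) ^ d"
  obtains X where "X \<subseteq> U" "card X \<ge> d" "shatters F X"
proof -
  have "\<not> {X. X \<subseteq> U \<and> shatters F X} \<subseteq> {X. X \<subseteq> U \<and> card X < d}"
  proof
    assume "{X. X \<subseteq> U \<and> shatters F X} \<subseteq> {X. X \<subseteq> U \<and> card X < d}"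
    then have "card {X. X \<subseteq> U \<and> shatters F X} \<le> card {X. X \<subseteq> U \<and> card X < d}"
      using assms(1) by (intro card_mono) auto
    then show False
      using card_le_card_shattered[OF assms(1,2)] card_small_subsets_le[OF assms(1), of d] assms(3)
      by linarith
  qed
  then obtain X where "X \<subseteq> U" "shatters F X" "\<not> card X < d" by blast
  then show thesis using that by simp
qed

lemma shatters_subset:
  assumes "shatters F X" and "Z \<subseteq> X"
  shows "shatters F Z"
  unfolding shatters_def
proof (intro allI impI)
  fix Y assume "Y \<subseteq> Z"
  then obtain S where "S \<in> F" "S \<inter> X = Y" using assms unfolding shatters_def by (meson order_trans)
  then show "\<exists>S\<in>F. S \<inter> Z = Y" using assms(2) \<open>Y \<subseteq> Z\<close> by (intro bexI[of _ S]) auto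
qed

subsection \<open>Bernoulli weights of set families\<close>

text \<open>The probability that a random subset of \<open>D\<close>, each element being kept
  independently with probability \<open>p\<close>, equals \<open>F \<inter> D\<close>. As only this
  intersection matters, weights on disjoint ground sets multiply without cutting \<open>F\<close>
  down.\<close>

definition bernoulli_weight :: "real \<Rightarrow> 'a set \<Rightarrow> 'a set \<Rightarrow> real" where
  "bernoulli_weight p D F = (\<Prod>e\<in>D. if e \<in> F then p else 1 - p)"

definition bernoulli_mass :: "real \<Rightarrow> 'a set \<Rightarrow> 'a set set \<Rightarrow> real" where
  "bernoulli_mass p D \<F> = (\<Sum>F\<in>\<F>. bernoulli_weight p D F)"

lemma bernoulli_weight_nonneg: "0 \<le> p \<Longrightarrow> p \<le> 1 \<Longrightarrow> 0 \<le> bernoulli_weight p D F"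
  unfolding bernoulli_weight_def by (intro prod_nonneg) auto

lemma bernoulli_weight_card:
  assumes "finite D" and "F \<subseteq> D"
  shows "bernoulli_weight p D F = p ^ card F * (1 - p) ^ (card D - card F)"
proof -
  have "bernoulli_weight p D F = (\<Prod>e\<in>F. p) * (\<Prod>e\<in>D - F. 1 - p)"
    unfolding bernoulli_weight_def
    by (subst prod.subset_diff[OF assms(2,1)], subst mult.commute, intro arg_cong2[of _ _ _ _ "(*)"] prod.cong)
       (use assms in auto)
  also have "\<dots> = p ^ card F * (1 - p) ^ (card D - card F)"
    using assms by (simp add: card_Diff_subset finite_subset)
  finally show ?thesis .
qed

lemma bernoulli_weight_le:
  assumes "0 \<le> p" "p \<le> 1"
  shows "bernoulli_weight p D F \<le> max p (1 - p) ^ card D"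
proof -
  have "bernoulli_weight p D F \<le> (\<Prod>e\<in>D. max p (1 - p))"
    unfolding bernoulli_weight_def using assms by (intro prod_mono) auto
  then show ?thesis by simp
qed

lemma bernoulli_mass_nonneg: "0 \<le> p \<Longrightarrow> p \<le> 1 \<Longrightarrow> 0 \<le> bernoulli_mass p D \<F>"
  unfolding bernoulli_mass_def by (intro sum_nonneg bernoulli_weight_nonneg)

lemma bernoulli_mass_mono:
  "0 \<le> p \<Longrightarrow> p \<le> 1 \<Longrightarrow> finite \<G> \<Longrightarrow> \<F> \<subseteq> \<G> \<Longrightarrow> bernoulli_mass p D \<F> \<le> bernoulli_mass p D \<G>"
  unfolding bernoulli_mass_def by (intro sum_mono2 bernoulli_weight_nonneg) auto

lemma bernoulli_mass_Un_le:
  assumes "0 \<le> p" "p \<le> 1" "finite \<F>" "finite \<G>"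
  shows "bernoulli_mass p D (\<F> \<union> \<G>) \<le> bernoulli_mass p D \<F> + bernoulli_mass p D \<G>"
  unfolding bernoulli_mass_def using assms
  by (subst sum.union_inter[symmetric])
     (auto intro!: sum_nonneg bernoulli_weight_nonneg)

lemma bernoulli_mass_UN_le:
  assumes "0 \<le> p" "p \<le> 1" "finite I" "\<And>i. i \<in> I \<Longrightarrow> finite (\<F> i)"
  shows "bernoulli_mass p D (\<Union>i\<in>I. \<F> i) \<le> (\<Sum>i\<in>I. bernoulli_mass p D (\<F> i))"
  using assms(3,4)
proof (induction I rule: finite_induct)
  case empty
  then show ?case by (simp add: bernoulli_mass_def)
next
  case (insert i I)
  then have "bernoulli_mass p D (\<F> i \<union> (\<Union>i\<in>I. \<F> i))
      \<le> bernoulli_mass p D (\<F> i) + bernoulli_mass p D (\<Union>i\<in>I. \<F> i)"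
    using assms by (intro bernoulli_mass_Un_le) auto
  then show ?case using insert by simp
qed

lemma bernoulli_mass_le:
  assumes "0 \<le> p" "p \<le> 1"
  shows "bernoulli_mass p D \<F> \<le> real (card \<F>) * max p (1 - p) ^ card D"
  unfolding bernoulli_mass_def
  by (rule sum_bounded_above) (use assms in \<open>intro bernoulli_weight_le\<close>)

text \<open>Independence of events that depend on disjoint sets of coordinates; this is what makes
  peeling multiplicative.\<close>

lemma bernoulli_mass_prod:
  assumes "finite D" "finite E" "D \<inter> E = {}" "\<A> \<subseteq> Pow D" "\<B> \<subseteq> Pow E"
  shows "bernoulli_mass p (D \<union> E) {F. F \<subseteq> D \<union> E \<and> F \<inter> D \<in> \<A> \<and> F \<inter> E \<in> \<B>}
    = bernoulli_mass p D \<A> * bernoulli_mass p E \<B>"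
proof -
  have "bernoulli_mass p (D \<union> E) {F. F \<subseteq> D \<union> E \<and> F \<inter> D \<in> \<A> \<and> F \<inter> E \<in> \<B>}
      = (\<Sum>(A, B)\<in>\<A> \<times> \<B>. bernoulli_weight p D A * bernoulli_weight p E B)"
    unfolding bernoulli_mass_def
  proof (rule sum.reindex_bij_witness[where i = "\<lambda>(A, B). A \<union> B" and j = "\<lambda>F. (F \<inter> D, F \<inter> E)"])
    fix F assume "F \<in> {F. F \<subseteq> D \<union> E \<and> F \<inter> D \<in> \<A> \<and> F \<inter> E \<in> \<B>}"
    have "bernoulli_weight p (D \<union> E) F = bernoulli_weight p D F * bernoulli_weight p E F"
      unfolding bernoulli_weight_def using assms by (intro prod.union_disjoint)
    also have "bernoulli_weight p D F = bernoulli_weight p D (F \<inter> D)"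
      unfolding bernoulli_weight_def by (intro prod.cong) auto
    also have "bernoulli_weight p E F = bernoulli_weight p E (F \<inter> E)"
      unfolding bernoulli_weight_def by (intro prod.cong) auto
    finally show "(case (F \<inter> D, F \<inter> E) of (A, B) \<Rightarrow> bernoulli_weight p D A * bernoulli_weight p E B)
        = bernoulli_weight p (D \<union> E) F" by simp
  next
    fix AB assume "AB \<in> \<A> \<times> \<B>"
    then obtain A B where AB: "AB = (A, B)" "A \<in> \<A>" "B \<in> \<B>" by auto
    have "A \<subseteq> D" "B \<subseteq> E" using AB assms by auto
    then have "(A \<union> B) \<inter> D = A" "(A \<union> B) \<inter> E = B" using assms(3) by blast+
    then show "((case AB of (A, B) \<Rightarrow> A \<union> B) \<inter> D, (case AB of (A, B) \<Rightarrow> A \<union> B) \<inter> E) = AB"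
      and "(case AB of (A, B) \<Rightarrow> A \<union> B) \<in> {F. F \<subseteq> D \<union> E \<and> F \<inter> D \<in> \<A> \<and> F \<inter> E \<in> \<B>}"
      using AB \<open>A \<subseteq> D\<close> \<open>B \<subseteq> E\<close> by auto
  qed auto
  then show ?thesis
    unfolding bernoulli_mass_def by (simp add: sum_product sum.cartesian_product)
qed

lemma bernoulli_mass_Pow: "finite D \<Longrightarrow> bernoulli_mass p D (Pow D) = 1"
proof (induction D rule: finite_induct)
  case empty
  then show ?case by (simp add: bernoulli_mass_def bernoulli_weight_def)
next
  case (insert x D)
  have "{F. F \<subseteq> {x} \<union> D \<and> F \<inter> {x} \<in> Pow {x} \<and> F \<inter> D \<in> Pow D} = Pow (insert x D)" by auto
  moreover have "bernoulli_mass p {x} (Pow {x}) = 1"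
    by (simp add: bernoulli_mass_def bernoulli_weight_def Pow_insert)
  ultimately show ?case
    using bernoulli_mass_prod[of "{x}" D "Pow {x}" "Pow D" p] insert by simp
qed

lemma bernoulli_mass_Prod:
  assumes "finite U" "\<And>v. v \<in> U \<Longrightarrow> finite (D v)" "disjoint_family_on D U"
    "\<And>v. v \<in> U \<Longrightarrow> \<F> v \<subseteq> Pow (D v)"
  shows "bernoulli_mass p (\<Union>v\<in>U. D v) {F. F \<subseteq> (\<Union>v\<in>U. D v) \<and> (\<forall>v\<in>U. F \<inter> D v \<in> \<F> v)}
    = (\<Prod>v\<in>U. bernoulli_mass p (D v) (\<F> v))"
  using assms
proof (induction U rule: finite_induct)
  case empty
  then show ?case by (simp add: bernoulli_mass_def bernoulli_weight_def)
next
  case (insert u U)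
  let ?E = "\<Union>v\<in>U. D v"
  let ?\<B> = "{F. F \<subseteq> ?E \<and> (\<forall>v\<in>U. F \<inter> D v \<in> \<F> v)}"
  have disj: "D u \<inter> ?E = {}"
  proof -
    have "D u \<inter> D v = {}" if "v \<in> U" for v
      using insert.prems(2) insert.hyps(2) that unfolding disjoint_family_on_def
      by (metis insertCI)
    then show ?thesis by blast
  qed
  have "F \<inter> ?E \<inter> D v = F \<inter> D v" if "v \<in> U" for F v using that by auto
  then have eq: "{F. F \<subseteq> (\<Union>v\<in>insert u U. D v) \<and> (\<forall>v\<in>insert u U. F \<inter> D v \<in> \<F> v)}
      = {F. F \<subseteq> D u \<union> ?E \<and> F \<inter> D u \<in> \<F> u \<and> F \<inter> ?E \<in> ?\<B>}" by auto
  have "bernoulli_mass p (D u \<union> ?E) {F. F \<subseteq> D u \<union> ?E \<and> F \<inter> D u \<in> \<F> u \<and> F \<inter> ?E \<in> ?\<B>}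
      = bernoulli_mass p (D u) (\<F> u) * bernoulli_mass p ?E ?\<B>"
    using insert disj by (intro bernoulli_mass_prod) auto
  also have "bernoulli_mass p ?E ?\<B> = (\<Prod>v\<in>U. bernoulli_mass p (D v) (\<F> v))"
    using insert by (intro insert.IH) (auto simp: disjoint_family_on_def)
  finally show ?case
    unfolding eq by (simp only: UN_insert prod.insert[OF insert(1,2)])
qed

text \<open>Used to identify the pairs from a vertex \<open>v\<close> to a set \<open>T\<close> with
  the elements of \<open>T\<close>, so that the adjacencies of \<open>v\<close> become a random
  subset of \<open>T\<close>.\<close>

lemma bernoulli_mass_image:
  assumes "inj_on f D" "\<F> \<subseteq> Pow D"
  shows "bernoulli_mass p (f ` D) ((`) f ` \<F>) = bernoulli_mass p D \<F>"
proof -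
  have inj: "inj_on ((`) f) \<F>"
    using inj_on_image_Pow[OF assms(1)] assms(2) inj_on_subset by blast
  have "bernoulli_weight p (f ` D) (f ` F) = bernoulli_weight p D F" if "F \<in> \<F>" for F
  proof -
    have "f e \<in> f ` F \<longleftrightarrow> e \<in> F" if "e \<in> D" for e
      using assms that \<open>F \<in> \<F>\<close> by (metis PowD inj_on_image_mem_iff subsetD)
    then show ?thesis
      unfolding bernoulli_weight_def by (subst prod.reindex[OF assms(1)]) (simp cong: prod.cong)
  qed
  then show ?thesis unfolding bernoulli_mass_def by (subst sum.reindex[OF inj]) simp
qed

subsection \<open>Bipartite patterns\<close>

text \<open>At \<open>p = 1/2\<close> a block of four elements takes its prescribed value with
  probability 1/16, and disjoint blocks are independent.\<close>

lemma bernoulli_mass_avoid_blocks: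
  assumes "finite D" "finite I" "disjoint_family_on Bl I"
    and "\<And>i. i \<in> I \<Longrightarrow> Bl i \<subseteq> D \<and> card (Bl i) = 4 \<and> Q i \<subseteq> Bl i"
  shows "bernoulli_mass (1/2) D {F. F \<subseteq> D \<and> (\<forall>i\<in>I. F \<inter> Bl i \<noteq> Q i)} = (15/16) ^ card I"
proof -
  let ?U = "\<Union>i\<in>I. Bl i"
  let ?\<F> = "{F. F \<subseteq> ?U \<and> (\<forall>i\<in>I. F \<inter> Bl i \<in> Pow (Bl i) - {Q i})}"
  have fin: "finite (Bl i)" if "i \<in> I" for i using assms that finite_subset by blast
  have UD: "?U \<subseteq> D" using assms by blast
  have single: "bernoulli_mass (1/2) (Bl i) (Pow (Bl i) - {Q i}) = 15/16" if i: "i \<in> I" for i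
  proof -
    have "bernoulli_weight (1/2) (Bl i) (Q i) = 1/16"
    proof -
      have "bernoulli_weight (1/2) (Bl i) (Q i) = (\<Prod>e\<in>Bl i. 1/2)"
        unfolding bernoulli_weight_def by (intro prod.cong) auto
      then show ?thesis using assms(4)[OF i] by (simp add: power_divide)
    qed
    moreover have "bernoulli_mass (1/2) (Bl i) (Pow (Bl i) - {Q i})
        = bernoulli_mass (1/2) (Bl i) (Pow (Bl i)) - bernoulli_weight (1/2) (Bl i) (Q i)"
      unfolding bernoulli_mass_def using assms(4)[OF i] fin[OF i] by (subst sum_diff1) auto
    ultimately show ?thesis using bernoulli_mass_Pow[OF fin[OF i]] by simp
  qed
  have "bernoulli_mass (1/2) ?U ?\<F> = (\<Prod>i\<in>I. bernoulli_mass (1/2) (Bl i) (Pow (Bl i) - {Q i}))"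
    using assms fin by (intro bernoulli_mass_Prod) auto
  also have "\<dots> = (\<Prod>i\<in>I. 15/16)" by (intro prod.cong single) auto
  also have "\<dots> = (15/16) ^ card I" by simp
  finally have 1: "bernoulli_mass (1/2) ?U ?\<F> = (15/16) ^ card I" .
  have "F \<inter> ?U \<inter> Bl i = F \<inter> Bl i" if "i \<in> I" for F i using that by blast
  \<comment> \<open>The elements of \<open>D\<close> outside all blocks are unconstrained and
    contribute total mass 1.\<close>
  then have "{F. F \<subseteq> D \<and> (\<forall>i\<in>I. F \<inter> Bl i \<noteq> Q i)}
      = {F. F \<subseteq> D \<and> F \<inter> ?U \<in> ?\<F> \<and> F \<inter> (D - ?U) \<in> Pow (D - ?U)}"
    by auto
  moreover have "bernoulli_mass (1/2) (?U \<union> (D - ?U))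
      {F. F \<subseteq> ?U \<union> (D - ?U) \<and> F \<inter> ?U \<in> ?\<F> \<and> F \<inter> (D - ?U) \<in> Pow (D - ?U)}
      = bernoulli_mass (1/2) ?U ?\<F> * bernoulli_mass (1/2) (D - ?U) (Pow (D - ?U))"
    using assms(1) UD finite_subset by (intro bernoulli_mass_prod) auto
  moreover have "?U \<union> (D - ?U) = D" using UD by blast
  ultimately show ?thesis
    using 1 bernoulli_mass_Pow[of "D - ?U" "1/2"] assms(1) by simp
qed

text \<open>A one-pattern form of quasirandomness: the two-by-two adjacency table \<open>q\<close>
  occurs in every choice of \<open>k\<close>-sets. The arguments of \<open>q\<close> say whether the
  unprimed vertex is meant on each side. Two separate sets per side are quantified because a further
  vertex will dictate from which piece each of the four vertices comes.\<close>

definition rich_pattern :: "(bool \<Rightarrow> bool \<Rightarrow> bool) \<Rightarrow> nat \<Rightarrow> 'a set \<Rightarrow> 'b set \<Rightarrow> ('a \<Rightarrow> 'b \<Rightarrow> bool) \<Rightarrow> bool" where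
  "rich_pattern q k A B H \<longleftrightarrow>
    (\<forall>X X' Y Y'. X \<subseteq> A \<longrightarrow> X' \<subseteq> A \<longrightarrow> X \<inter> X' = {} \<longrightarrow> card X = k \<longrightarrow> card X' = k \<longrightarrow>
       Y \<subseteq> B \<longrightarrow> Y' \<subseteq> B \<longrightarrow> Y \<inter> Y' = {} \<longrightarrow> card Y = k \<longrightarrow> card Y' = k \<longrightarrow>
       (\<exists>x\<in>X. \<exists>x'\<in>X'. \<exists>y\<in>Y. \<exists>y'\<in>Y'.
          H x y = q True True \<and> H x y' = q True False \<and> H x' y = q False True \<and> H x' y' = q False False))"

lemma rich_patternE:
  assumes "rich_pattern q k A B H"
    and "X \<subseteq> A" "X' \<subseteq> A" "X \<inter> X' = {}" "card X = k" "card X' = k"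
    and "Y \<subseteq> B" "Y' \<subseteq> B" "Y \<inter> Y' = {}" "card Y = k" "card Y' = k"
  obtains x x' y y' where "x \<in> X" "x' \<in> X'" "y \<in> Y" "y' \<in> Y'"
    "H x y = q True True" "H x y' = q True False" "H x' y = q False True" "H x' y' = q False False"
proof -
  have "\<exists>x\<in>X. \<exists>x'\<in>X'. \<exists>y\<in>Y. \<exists>y'\<in>Y'.
      H x y = q True True \<and> H x y' = q True False \<and> H x' y = q False True \<and> H x' y' = q False False"
    using assms(1)[unfolded rich_pattern_def, rule_format, OF assms(2-11)] .
  then show thesis using that by blast
qed

text \<open>
  The union bound over at most \<open>16 ^ t\<close> quadruples of subsets, where \<open>t = r\<^sup>2\<close>, works because
  \<open>16 * (15/16) ^ 49 < 1\<close>; this is the origin of the factor 7.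
\<close>

lemma exists_rich_pattern:
  fixes r :: nat
  assumes "r > 0"
  shows "\<exists>H. rich_pattern q (7 * r) {..<r ^ 2} {..<r ^ 2} H"
proof -
  define t where "t = r ^ 2"
  define k where "k = 7 * r"
  define D where "D = {..<t} \<times> {..<t}"
  define quads where "quads = Pow {..<t} \<times> Pow {..<t} \<times> Pow {..<t} \<times> Pow {..<t}"
  define good where "good F X X' Y Y' \<longleftrightarrow> (\<exists>x\<in>X. \<exists>x'\<in>X'. \<exists>y\<in>Y. \<exists>y'\<in>Y'.
      ((x, y) \<in> F) = q True True \<and> ((x, y') \<in> F) = q True False \<and>
      ((x', y) \<in> F) = q False True \<and> ((x', y') \<in> F) = q False False)"
    for F :: "(nat \<times> nat) set" and X X' Y Y'
  define bad where "bad = (\<lambda>(X, X', Y, Y'). {F. F \<subseteq> D \<and> card X = k \<and> card X' = k \<and>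
      card Y = k \<and> card Y' = k \<and> X \<inter> X' = {} \<and> Y \<inter> Y' = {} \<and> \<not> good F X X' Y Y'})"
  have finD: "finite D" unfolding D_def by simp
  have finbad: "finite (bad z)" for z
    by (rule finite_subset[of _ "Pow D"]) (use finD in \<open>auto simp: bad_def split: prod.splits\<close>)
  have bad_le: "bernoulli_mass (1/2) D (bad z) \<le> (15/16) ^ (k * k)" if z: "z \<in> quads" for z
  proof -
    obtain X X' Y Y' where zeq: "z = (X, X', Y, Y')" by (metis prod_cases4)
    show ?thesis
    proof (cases "card X = k \<and> card X' = k \<and> card Y = k \<and> card Y' = k \<and> X \<inter> X' = {} \<and> Y \<inter> Y' = {}")
      case False
      then have "bad z = {}" unfolding bad_def zeq by auto
      then show ?thesis by (simp add: bernoulli_mass_def)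
    next
      case True
      have sub: "X \<subseteq> {..<t}" "X' \<subseteq> {..<t}" "Y \<subseteq> {..<t}" "Y' \<subseteq> {..<t}"
        using z unfolding zeq quads_def by auto
      then have fin: "finite X" "finite X'" "finite Y" "finite Y'" using finite_subset by blast+
      obtain f f' g g' where bij: "bij_betw f {..<k} X" "bij_betw f' {..<k} X'"
        "bij_betw g {..<k} Y" "bij_betw g' {..<k} Y'"
        using True fin by (metis atLeast0LessThan ex_bij_betw_nat_finite)
      have inX: "f i \<in> X" "f' i \<in> X'" "g i \<in> Y" "g' i \<in> Y'" if "i < k" for i
        using bij that by (auto simp: bij_betw_def)
      have inj: "f i = f j \<longleftrightarrow> i = j" "f' i = f' j \<longleftrightarrow> i = j" "g i = g j \<longleftrightarrow> i = j" "g' i = g' j \<longleftrightarrow> i = j"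
        if "i < k" "j < k" for i j
        using bij that by (auto simp: bij_betw_def inj_on_def)
      have neq: "f i \<noteq> f' j" "g i \<noteq> g' j" if "i < k" "j < k" for i j
        using inX(1)[OF that(1)] inX(2)[OF that(2)] inX(3)[OF that(1)] inX(4)[OF that(2)] True by auto
      \<comment> \<open>Pairing \<open>f i\<close> with \<open>f' i\<close> and \<open>g j\<close>
        with \<open>g' j\<close> yields \<open>k * k\<close> disjoint two-by-two blocks; the pattern
        is missed altogether only if every block misses it.\<close>
      define Bl where "Bl = (\<lambda>(i, j). {f i, f' i} \<times> {g j, g' j})"
      define Q where "Q = (\<lambda>(i, j). {e \<in> Bl (i, j). q (fst e = f i) (snd e = g j)})"
      have "bernoulli_mass (1/2) D {F. F \<subseteq> D \<and> (\<forall>i\<in>{..<k} \<times> {..<k}. F \<inter> Bl i \<noteq> Q i)}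
          = (15/16) ^ card ({..<k} \<times> {..<k})"
      proof (rule bernoulli_mass_avoid_blocks)
        show "disjoint_family_on Bl ({..<k} \<times> {..<k})"
          unfolding disjoint_family_on_def
        proof (intro ballI impI)
          fix z z' assume z: "z \<in> {..<k} \<times> {..<k}" "z' \<in> {..<k} \<times> {..<k}" "z \<noteq> z'"
          obtain i j i' j' where e: "z = (i, j)" "z' = (i', j')" by fastforce
          then have lt: "i < k" "j < k" "i' < k" "j' < k" and ne: "i \<noteq> i' \<or> j \<noteq> j'" using z by auto
          have "i \<noteq> i' \<Longrightarrow> {f i, f' i} \<inter> {f i', f' i'} = {}"
            using inj(1,2)[OF lt(1,3)] neq(1)[OF lt(1,3)] neq(1)[OF lt(3,1)] by auto
          moreover have "j \<noteq> j' \<Longrightarrow> {g j, g' j} \<inter> {g j', g' j'} = {}"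
            using inj(3,4)[OF lt(2,4)] neq(2)[OF lt(2,4)] neq(2)[OF lt(4,2)] by auto
          ultimately show "Bl z \<inter> Bl z' = {}" unfolding Bl_def e using ne by auto
        qed
        fix ij assume ij: "ij \<in> {..<k} \<times> {..<k}"
        then obtain i j where e: "ij = (i, j)" "i < k" "j < k" by auto
        have "Bl ij \<subseteq> D" unfolding Bl_def D_def e using inX[OF e(2)] inX[OF e(3)] sub by auto
        moreover have "card (Bl ij) = 4"
          unfolding Bl_def e using neq e by (simp add: card_cartesian_product)
        moreover have "Q ij \<subseteq> Bl ij" unfolding Q_def e by auto
        ultimately show "Bl ij \<subseteq> D \<and> card (Bl ij) = 4 \<and> Q ij \<subseteq> Bl ij" by blast
      qed (use finD in auto)
      moreover have "bad z \<subseteq> {F. F \<subseteq> D \<and> (\<forall>i\<in>{..<k} \<times> {..<k}. F \<inter> Bl i \<noteq> Q i)}"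
      proof
        fix F assume F: "F \<in> bad z"
        have "F \<inter> Bl (i, j) \<noteq> Q (i, j)" if ij: "i < k" "j < k" for i j
        proof
          assume eq: "F \<inter> Bl (i, j) = Q (i, j)"
          have mem: "e \<in> F \<longleftrightarrow> q (fst e = f i) (snd e = g j)" if "e \<in> Bl (i, j)" for e
            using eq that unfolding Q_def by auto
          have "good F X X' Y Y'"
            unfolding good_def
          proof (intro bexI conjI)
            show "((f i, g j) \<in> F) = q True True" by (subst mem) (auto simp: Bl_def)
            show "((f i, g' j) \<in> F) = q True False"
              using neq(2)[OF ij(2) ij(2)] by (subst mem) (auto simp: Bl_def)
            show "((f' i, g j) \<in> F) = q False True"
              using neq(1)[OF ij(1) ij(1)] by (subst mem) (auto simp: Bl_def)
            show "((f' i, g' j) \<in> F) = q False False"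
              using neq(1)[OF ij(1) ij(1)] neq(2)[OF ij(2) ij(2)] by (subst mem) (auto simp: Bl_def)
          qed (use inX ij in auto)
          then show False using F unfolding bad_def zeq by auto
        qed
        then show "F \<in> {F. F \<subseteq> D \<and> (\<forall>i\<in>{..<k} \<times> {..<k}. F \<inter> Bl i \<noteq> Q i)}"
          using F unfolding bad_def zeq by auto
      qed
      ultimately show ?thesis
        using bernoulli_mass_mono[of "1/2" "{F. F \<subseteq> D \<and> (\<forall>i\<in>{..<k} \<times> {..<k}. F \<inter> Bl i \<noteq> Q i)}" "bad z" D] finD
        by (simp add: card_cartesian_product)
    qed
  qed
  \<comment> \<open>The union bound leaves total mass less than 1, so some relation lies in no bad
    event.\<close>
  have "bernoulli_mass (1/2) D (\<Union>z\<in>quads. bad z) \<le> (\<Sum>z\<in>quads. bernoulli_mass (1/2) D (bad z))"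
    by (intro bernoulli_mass_UN_le finbad) (auto simp: quads_def)
  also have "\<dots> \<le> real (card quads) * (15/16) ^ (k * k)"
    by (intro sum_bounded_above bad_le)
  also have "card quads = 16 ^ t"
    unfolding quads_def by (simp add: card_cartesian_product card_Pow power_mult_distrib[symmetric])
  also have "k * k = 49 * t" unfolding k_def t_def by (simp add: power2_eq_square)
  also have "real (16 ^ t) * (15/16) ^ (49 * t) = (16 * (15/16) ^ 49) ^ t"
    by (simp add: power_mult power_mult_distrib)
  also have "\<dots> < 1 ^ t"
    using assms by (intro power_strict_mono) (auto simp: t_def power_divide)
  finally have "bernoulli_mass (1/2) D (\<Union>z\<in>quads. bad z) < bernoulli_mass (1/2) D (Pow D)"
    using bernoulli_mass_Pow[OF finD] by simp
  then have "\<not> Pow D \<subseteq> (\<Union>z\<in>quads. bad z)"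
    using bernoulli_mass_mono[of "1/2" "\<Union>z\<in>quads. bad z" "Pow D" D] finbad
    by (auto simp: quads_def)
  then obtain F where F: "F \<subseteq> D" "\<And>z. z \<in> quads \<Longrightarrow> F \<notin> bad z" by blast
  have "rich_pattern q k {..<t} {..<t} (\<lambda>x y. (x, y) \<in> F)"
    unfolding rich_pattern_def
  proof (intro allI impI)
    fix X X' Y Y' :: "nat set"
    assume "X \<subseteq> {..<t}" "X' \<subseteq> {..<t}" "X \<inter> X' = {}" "card X = k" "card X' = k"
      "Y \<subseteq> {..<t}" "Y' \<subseteq> {..<t}" "Y \<inter> Y' = {}" "card Y = k" "card Y' = k"
    then have "good F X X' Y Y'"
      using F(1) F(2)[of "(X, X', Y, Y')"] unfolding quads_def bad_def by auto
    then show "\<exists>x\<in>X. \<exists>x'\<in>X'. \<exists>y\<in>Y. \<exists>y'\<in>Y'. ((x, y) \<in> F) = q True True \<and>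
        ((x, y') \<in> F) = q True False \<and> ((x', y) \<in> F) = q False True \<and> ((x', y') \<in> F) = q False False"
      unfolding good_def .
  qed
  then show ?thesis unfolding t_def k_def by blast
qed

lemma rich_pattern_image:
  assumes H: "rich_pattern q k I J H" and inj: "inj_on a I" "inj_on b J"
    and K: "\<And>i j. i \<in> I \<Longrightarrow> j \<in> J \<Longrightarrow> K (a i) (b j) = H i j"
  shows "rich_pattern q k (a ` I) (b ` J) K"
  unfolding rich_pattern_def
proof (intro allI impI)
  fix X X' Y Y'
  assume asm: "X \<subseteq> a ` I" "X' \<subseteq> a ` I" "X \<inter> X' = {}" "card X = k" "card X' = k"
    "Y \<subseteq> b ` J" "Y' \<subseteq> b ` J" "Y \<inter> Y' = {}" "card Y = k" "card Y' = k"
  obtain P P' where P: "P \<subseteq> I" "P' \<subseteq> I" "X = a ` P" "X' = a ` P'"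
    using asm(1,2) by (meson subset_imageE)
  obtain R R' where R: "R \<subseteq> J" "R' \<subseteq> J" "Y = b ` R" "Y' = b ` R'"
    using asm(6,7) by (meson subset_imageE)
  have cP: "card P = k" "card P' = k" "card R = k" "card R' = k"
    using asm P R inj by (metis card_image inj_on_subset)+
  have dP: "P \<inter> P' = {}" "R \<inter> R' = {}" using asm P R by auto
  obtain x x' y y' where xy: "x \<in> P" "x' \<in> P'" "y \<in> R" "y' \<in> R'"
    "H x y = q True True" "H x y' = q True False" "H x' y = q False True" "H x' y' = q False False"
    by (rule rich_patternE[OF H P(1,2) dP(1) cP(1,2) R(1,2) dP(2) cP(3,4)])
  then have "K (a x) (b y) = q True True" "K (a x) (b y') = q True False"
    "K (a x') (b y) = q False True" "K (a x') (b y') = q False False"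
    using K P R by (auto simp: subset_iff)
  then show "\<exists>x\<in>X. \<exists>x'\<in>X'. \<exists>y\<in>Y. \<exists>y'\<in>Y'. K x y = q True True \<and> K x y' = q True False \<and>
      K x' y = q False True \<and> K x' y' = q False False"
    using xy P R by blast
qed

subsection \<open>Vertices attached to a homogeneous pair\<close>

lemma C5_edges_eq: "C5_edges = {{0, 1}, {1, 2}, {2, 3}, {3, 4}, {4, 0}}"
proof -
  have "{i::nat. i < 5} = {0, 1, 2, 3, 4}" by auto
  moreover have "C5_edges = (\<lambda>i. {i, (i + 1) mod 5}) ` {i::nat. i < 5}"
    unfolding C5_edges_def by auto
  ultimately show ?thesis by (simp add: numeral_2_eq_2)
qed

lemma C5_vertices_eq: "C5_vertices = {0, 1, 2, 3, 4}"
  unfolding C5_vertices_def by auto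

lemma contains_induced_C5I:
  assumes "E \<subseteq> [V]\<^bsup>2\<^esup>" "{u, v, w, x, y} \<subseteq> V" "distinct [u, v, w, x, y]"
    "{u, v} \<in> E" "{v, w} \<in> E" "{w, x} \<in> E" "{x, y} \<in> E" "{y, u} \<in> E"
    "{u, w} \<notin> E" "{v, x} \<notin> E" "{w, y} \<notin> E" "{x, u} \<notin> E" "{y, v} \<notin> E"
  shows "contains_induced C5_vertices C5_edges V E"
proof -
  \<comment> \<open>The definition of an induced copy also compares the degenerate pairs with equal
    entries, which must be non-edges on both sides.\<close>
  have irrefl: "{z} \<notin> E" for z using assms(1) by (auto simp: nsets_def)
  define f where "f i = [u, v, w, x, y] ! i" for i
  have f: "f 0 = u" "f (Suc 0) = v" "f 2 = w" "f 3 = x" "f 4 = y"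
    unfolding f_def by (auto simp: numeral_eq_Suc)
  show ?thesis
    unfolding contains_induced_def
  proof (intro exI[of _ f] conjI)
    show "inj_on f C5_vertices" "f ` C5_vertices \<subseteq> V"
      using assms(2,3) by (auto simp: C5_vertices_eq f inj_on_def)
    show "\<forall>i\<in>C5_vertices. \<forall>j\<in>C5_vertices. ({i, j} \<in> C5_edges) = ({f i, f j} \<in> E)"
      using assms(4-) irrefl
      by (simp add: C5_vertices_eq C5_edges_eq f doubleton_eq_iff insert_commute)
  qed
qed

text \<open>
  A five-cycle splits into a vertex and two pairs in such a way that the pairs are any
  prescribed combination of edges and non-edges; the pattern records the four
  adjacencies between the two pairs.
\<close>

definition C5_pattern :: "bool \<Rightarrow> bool \<Rightarrow> bool \<Rightarrow> bool \<Rightarrow> bool" where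
  "C5_pattern cA cB i j \<longleftrightarrow> (if i \<noteq> j then \<not> cA \<and> \<not> cB else i \<longrightarrow> cA \<noteq> cB)"

lemma two_disjoint_subsets:
  assumes "card X \<ge> 2 * k"
  obtains Y Y' where "Y \<subseteq> X" "Y' \<subseteq> X" "Y \<inter> Y' = {}" "card Y = k" "card Y' = k"
proof (cases "k = 0")
  case True
  then show thesis using that[of "{}" "{}"] by simp
next
  case False
  obtain Z where Z: "Z \<subseteq> X" "card Z = 2 * k" using assms by (meson obtain_subset_with_card_n)
  then obtain Y where Y: "Y \<subseteq> Z" "card Y = k"
    by (metis mult_2 obtain_subset_with_card_n trans_le_add1 order_refl)
  have "finite Z" using Z False by (metis card.infinite mult_is_0 zero_neq_numeral)
  then have "card (Z - Y) = k" using Z Y by (simp add: card_Diff_subset finite_subset)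
  then show thesis using that[of Y "Z - Y"] Z Y by blast
qed

text \<open>If \<open>v\<close> splits both sets into large pieces, two vertices can be taken from
  each set so that they complete a five-cycle with \<open>v\<close>. When both sets are cliques or
  both independent, \<open>v\<close> is joined to one vertex of each pair. When the types differ,
  \<open>v\<close> is joined to both vertices of the independent pair and to neither of the clique
  pair; both vertices of a pair then come from the same piece, which explains the threshold
  \<open>2 * k\<close> instead of \<open>k\<close>.\<close>

lemma homogeneous_pair_traces:
  assumes E: "E \<subseteq> [V]\<^bsup>2\<^esup>" and C5: "\<not> contains_induced C5_vertices C5_edges V E"
    and AB: "A \<subseteq> V" "B \<subseteq> V" "A \<inter> B = {}"
    and hA: "if cA then clique A E else indep A E" and hB: "if cB then clique B E else indep B E"
    and rich: "rich_pattern (C5_pattern cA cB) k A B (\<lambda>x y. {x, y} \<in> E)"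
    and v: "v \<in> V - (A \<union> B)"
  defines "X \<equiv> {x \<in> A. {v, x} \<in> E}" and "Y \<equiv> {x \<in> B. {v, x} \<in> E}"
  shows "card X < 2 * k \<or> card (A - X) < 2 * k \<or> card Y < 2 * k \<or> card (B - Y) < 2 * k"
proof (rule ccontr)
  assume "\<not> ?thesis"
  then have large: "2 * k \<le> card X" "2 * k \<le> card (A - X)" "2 * k \<le> card Y" "2 * k \<le> card (B - Y)"
    by auto
  obtain X1 X2 where X12: "X1 \<subseteq> X" "X2 \<subseteq> X" "X1 \<inter> X2 = {}" "card X1 = k" "card X2 = k"
    using two_disjoint_subsets[OF large(1)] by blast
  obtain X3 X4 where X34: "X3 \<subseteq> A - X" "X4 \<subseteq> A - X" "X3 \<inter> X4 = {}" "card X3 = k" "card X4 = k"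
    using two_disjoint_subsets[OF large(2)] by blast
  obtain Y1 Y2 where Y12: "Y1 \<subseteq> Y" "Y2 \<subseteq> Y" "Y1 \<inter> Y2 = {}" "card Y1 = k" "card Y2 = k"
    using two_disjoint_subsets[OF large(3)] by blast
  obtain Y3 Y4 where Y34: "Y3 \<subseteq> B - Y" "Y4 \<subseteq> B - Y" "Y3 \<inter> Y4 = {}" "card Y3 = k" "card Y4 = k"
    using two_disjoint_subsets[OF large(4)] by blast
  have sub: "X \<subseteq> A" "Y \<subseteq> B" unfolding X_def Y_def by auto
  \<comment> \<open>All adjacencies among the four vertices are determined here: homogeneity gives
    those inside the pairs, richness those across. Only the adjacencies with \<open>v\<close> depend
    on the case.\<close>
  have get: "\<exists>x x' y y'. x \<in> P \<and> x' \<in> P' \<and> y \<in> R \<and> y' \<in> R' \<and>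
      {v, x, x', y, y'} \<subseteq> V \<and> distinct [v, x, x', y, y'] \<and>
      ({x, x'} \<in> E) = cA \<and> ({y, y'} \<in> E) = cB \<and>
      ({x, y} \<in> E) = C5_pattern cA cB True True \<and> ({x, y'} \<in> E) = C5_pattern cA cB True False \<and>
      ({x', y} \<in> E) = C5_pattern cA cB False True \<and> ({x', y'} \<in> E) = C5_pattern cA cB False False"
    if P: "P \<subseteq> A" "P' \<subseteq> A" "P \<inter> P' = {}" "card P = k" "card P' = k"
      "R \<subseteq> B" "R' \<subseteq> B" "R \<inter> R' = {}" "card R = k" "card R' = k" for P P' R R'
  proof -
    obtain x x' y y' where xy: "x \<in> P" "x' \<in> P'" "y \<in> R" "y' \<in> R'"
      "({x, y} \<in> E) = C5_pattern cA cB True True" "({x, y'} \<in> E) = C5_pattern cA cB True False"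
      "({x', y} \<in> E) = C5_pattern cA cB False True" "({x', y'} \<in> E) = C5_pattern cA cB False False"
      by (rule rich_patternE[OF rich P])
    have "x \<noteq> x'" "y \<noteq> y'" using P xy by auto
    moreover have mem: "x \<in> A" "x' \<in> A" "y \<in> B" "y' \<in> B" using P xy by auto
    ultimately have "({x, x'} \<in> E) = cA" "({y, y'} \<in> E) = cB"
      using hA hB by (auto simp: clique_def indep_def split: if_splits)
    moreover have "{v, x, x', y, y'} \<subseteq> V" "distinct [v, x, x', y, y']"
      using mem AB v \<open>x \<noteq> x'\<close> \<open>y \<noteq> y'\<close> by auto
    ultimately show ?thesis using xy by blast
  qed
  have vX: "{v, x} \<in> E" if "x \<in> X \<union> Y" for x using that unfolding X_def Y_def by auto
  have vX': "{v, x} \<notin> E" if "x \<in> (A - X) \<union> (B - Y)" for x using that unfolding X_def Y_def by auto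
  have disj: "X1 \<inter> X3 = {}" "Y1 \<inter> Y3 = {}" using X12 X34 Y12 Y34 by auto
  have subA: "X1 \<subseteq> A" "X2 \<subseteq> A" "X3 \<subseteq> A" "X4 \<subseteq> A" using X12 X34 sub by auto
  have subB: "Y1 \<subseteq> B" "Y2 \<subseteq> B" "Y3 \<subseteq> B" "Y4 \<subseteq> B" using Y12 Y34 sub by auto
  consider "cA" "cB" | "\<not> cA" "\<not> cB" | "cA" "\<not> cB" | "\<not> cA" "cB" by blast
  then show False
  proof cases
    case 1
    obtain x x' y y' where xy: "x \<in> X1" "x' \<in> X3" "y \<in> Y1" "y' \<in> Y3"
      "{v, x, x', y, y'} \<subseteq> V" "distinct [v, x, x', y, y']"
      "({x, x'} \<in> E) = cA" "({y, y'} \<in> E) = cB"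
      "({x, y} \<in> E) = C5_pattern cA cB True True" "({x, y'} \<in> E) = C5_pattern cA cB True False"
      "({x', y} \<in> E) = C5_pattern cA cB False True" "({x', y'} \<in> E) = C5_pattern cA cB False False"
      using get[OF subA(1) subA(3) disj(1) X12(4) X34(4) subB(1) subB(3) disj(2) Y12(4) Y34(4)] by blast
    have vs: "{v, x} \<in> E" "{v, y} \<in> E" "{v, x'} \<notin> E" "{v, y'} \<notin> E"
      using xy(1-4) X12(1,2) X34(1,2) Y12(1,2) Y34(1,2)
      by (intro vX vX'; blast)+
    moreover have "{v, x, x', y', y} \<subseteq> V" "distinct [v, x, x', y', y]" using xy(5,6) by auto
    ultimately have "contains_induced C5_vertices C5_edges V E"
      by (intro contains_induced_C5I[of E V v x x' y' y])
         (use E xy(7-) 1 in \<open>simp_all only: insert_commute C5_pattern_def\<close>, simp_all)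
    then show False using C5 by blast
  next
    case 2
    obtain x x' y y' where xy: "x \<in> X1" "x' \<in> X3" "y \<in> Y1" "y' \<in> Y3"
      "{v, x, x', y, y'} \<subseteq> V" "distinct [v, x, x', y, y']"
      "({x, x'} \<in> E) = cA" "({y, y'} \<in> E) = cB"
      "({x, y} \<in> E) = C5_pattern cA cB True True" "({x, y'} \<in> E) = C5_pattern cA cB True False"
      "({x', y} \<in> E) = C5_pattern cA cB False True" "({x', y'} \<in> E) = C5_pattern cA cB False False"
      using get[OF subA(1) subA(3) disj(1) X12(4) X34(4) subB(1) subB(3) disj(2) Y12(4) Y34(4)] by blast
    have vs: "{v, x} \<in> E" "{v, y} \<in> E" "{v, x'} \<notin> E" "{v, y'} \<notin> E"
      using xy(1-4) X12(1,2) X34(1,2) Y12(1,2) Y34(1,2)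
      by (intro vX vX'; blast)+
    moreover have "{v, x, y', x', y} \<subseteq> V" "distinct [v, x, y', x', y]" using xy(5,6) by auto
    ultimately have "contains_induced C5_vertices C5_edges V E"
      by (intro contains_induced_C5I[of E V v x y' x' y])
         (use E xy(7-) 2 in \<open>simp_all only: insert_commute C5_pattern_def\<close>, simp_all)
    then show False using C5 by blast
  next
    case 3
    obtain x x' y y' where xy: "x \<in> X3" "x' \<in> X4" "y \<in> Y1" "y' \<in> Y2"
      "{v, x, x', y, y'} \<subseteq> V" "distinct [v, x, x', y, y']"
      "({x, x'} \<in> E) = cA" "({y, y'} \<in> E) = cB"
      "({x, y} \<in> E) = C5_pattern cA cB True True" "({x, y'} \<in> E) = C5_pattern cA cB True False"
      "({x', y} \<in> E) = C5_pattern cA cB False True" "({x', y'} \<in> E) = C5_pattern cA cB False False"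
      using get[OF subA(3) subA(4) X34(3) X34(4) X34(5) subB(1) subB(2) Y12(3) Y12(4) Y12(5)] by blast
    have vs: "{v, y} \<in> E" "{v, y'} \<in> E" "{v, x} \<notin> E" "{v, x'} \<notin> E"
      using xy(1-4) X12(1,2) X34(1,2) Y12(1,2) Y34(1,2)
      by (intro vX vX'; blast)+
    moreover have "{v, y, x, x', y'} \<subseteq> V" "distinct [v, y, x, x', y']" using xy(5,6) by auto
    ultimately have "contains_induced C5_vertices C5_edges V E"
      by (intro contains_induced_C5I[of E V v y x x' y'])
         (use E xy(7-) 3 in \<open>simp_all only: insert_commute C5_pattern_def\<close>, simp_all)
    then show False using C5 by blast
  next
    case 4
    obtain x x' y y' where xy: "x \<in> X1" "x' \<in> X2" "y \<in> Y3" "y' \<in> Y4"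
      "{v, x, x', y, y'} \<subseteq> V" "distinct [v, x, x', y, y']"
      "({x, x'} \<in> E) = cA" "({y, y'} \<in> E) = cB"
      "({x, y} \<in> E) = C5_pattern cA cB True True" "({x, y'} \<in> E) = C5_pattern cA cB True False"
      "({x', y} \<in> E) = C5_pattern cA cB False True" "({x', y'} \<in> E) = C5_pattern cA cB False False"
      using get[OF subA(1) subA(2) X12(3) X12(4) X12(5) subB(3) subB(4) Y34(3) Y34(4) Y34(5)] by blast
    have vs: "{v, x} \<in> E" "{v, x'} \<in> E" "{v, y} \<notin> E" "{v, y'} \<notin> E"
      using xy(1-4) X12(1,2) X34(1,2) Y12(1,2) Y34(1,2)
      by (intro vX vX'; blast)+
    moreover have "{v, x, y, y', x'} \<subseteq> V" "distinct [v, x, y, y', x']" using xy(5,6) by auto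
    ultimately have "contains_induced C5_vertices C5_edges V E"
      by (intro contains_induced_C5I[of E V v x y y' x'])
         (use E xy(7-) 4 in \<open>simp_all only: insert_commute C5_pattern_def\<close>, simp_all)
    then show False using C5 by blast
  qed
qed

subsection \<open>Sets of vertices with few attachments\<close>

lemma card_near_constant_le:
  assumes "finite A"
  shows "card {X. X \<subseteq> A \<and> (card X < d \<or> card (A - X) < d)} \<le> 2 * (card A + 1) ^ d"
proof -
  let ?S = "{X. X \<subseteq> A \<and> card X < d}"
  have "{X. X \<subseteq> A \<and> (card X < d \<or> card (A - X) < d)} \<subseteq> ?S \<union> (\<lambda>X. A - X) ` ?S"
  proof
    fix X assume X: "X \<in> {X. X \<subseteq> A \<and> (card X < d \<or> card (A - X) < d)}"
    then have "X = A - (A - X)" by auto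
    then show "X \<in> ?S \<union> (\<lambda>X. A - X) ` ?S" using X by blast
  qed
  then have "card {X. X \<subseteq> A \<and> (card X < d \<or> card (A - X) < d)} \<le> card (?S \<union> (\<lambda>X. A - X) ` ?S)"
    using assms by (intro card_mono) auto
  also have "\<dots> \<le> card ?S + card ?S"
    using assms by (intro order.trans[OF card_Un_le] add_mono card_image_le) auto
  finally show ?thesis using card_small_subsets_le[OF assms, of d] by linarith
qed

text \<open>The source of the square root in the attachment weight. Being nearly constant on one set
  costs about \<open>q ^ t\<close> with \<open>q = max p (1 - p)\<close>, the other set is free, and
  the ground set has \<open>2 * t\<close> elements. The factor 4 is 2 for the choice of the set
  times 2 for \<open>nearly empty\<close> or \<open>nearly full\<close>.\<close>

lemma mass_near_constant_on_either_le:
  fixes A B :: "'a set" and p :: real and t d :: nat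
  assumes p: "0 \<le> p" "p \<le> 1" and fin: "finite A" "finite B" and disj: "A \<inter> B = {}"
    and card: "card A = t" "card B = t"
  defines "nc \<equiv> \<lambda>C. {X. X \<subseteq> C \<and> (card X < d \<or> card (C - X) < d)}"
  shows "bernoulli_mass p (A \<union> B) {S. S \<subseteq> A \<union> B \<and> (S \<inter> A \<in> nc A \<or> S \<inter> B \<in> nc B)}
    \<le> 4 * (real t + 1) ^ d * max p (1 - p) ^ t"
proof -
  let ?M = "bernoulli_mass p"
  have nc: "nc C \<subseteq> Pow C" for C unfolding nc_def by auto
  have nc_le: "?M C (nc C) \<le> 2 * (real t + 1) ^ d * max p (1 - p) ^ t" if "finite C" "card C = t" for C
  proof -
    have "real (card (nc C)) \<le> real (2 * (card C + 1) ^ d)"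
      unfolding nc_def using card_near_constant_le[OF that(1), of d] by (intro of_nat_mono)
    then have "real (card (nc C)) \<le> 2 * (real t + 1) ^ d" using that by (simp add: add.commute)
    moreover have "?M C (nc C) \<le> real (card (nc C)) * max p (1 - p) ^ t"
      using bernoulli_mass_le[OF p, of C "nc C"] that by simp
    ultimately show ?thesis
      using p by (meson mult_right_mono order.trans zero_le_power le_max_iff_disj)
  qed
  have "{S. S \<subseteq> A \<union> B \<and> (S \<inter> A \<in> nc A \<or> S \<inter> B \<in> nc B)}
      = {S. S \<subseteq> A \<union> B \<and> S \<inter> A \<in> nc A \<and> S \<inter> B \<in> Pow B} \<union>
        {S. S \<subseteq> A \<union> B \<and> S \<inter> A \<in> Pow A \<and> S \<inter> B \<in> nc B}" by auto
  then have "?M (A \<union> B) {S. S \<subseteq> A \<union> B \<and> (S \<inter> A \<in> nc A \<or> S \<inter> B \<in> nc B)}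
      \<le> ?M (A \<union> B) {S. S \<subseteq> A \<union> B \<and> S \<inter> A \<in> nc A \<and> S \<inter> B \<in> Pow B} +
        ?M (A \<union> B) {S. S \<subseteq> A \<union> B \<and> S \<inter> A \<in> Pow A \<and> S \<inter> B \<in> nc B}"
    using p fin by (simp only:) (intro bernoulli_mass_Un_le, auto)
  also have "\<dots> = ?M A (nc A) * ?M B (Pow B) + ?M A (Pow A) * ?M B (nc B)"
    by (subst (1 2) bernoulli_mass_prod) (use fin disj nc in auto)
  also have "\<dots> = ?M A (nc A) + ?M B (nc B)" using fin by (simp add: bernoulli_mass_Pow)
  also have "\<dots> \<le> 4 * (real t + 1) ^ d * max p (1 - p) ^ t"
    using nc_le[OF fin(1) card(1)] nc_le[OF fin(2) card(2)] by simp
  finally show ?thesis .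
qed

section \<open>Realising a prescribed pattern between two homogeneous sets\<close>

text \<open>Labellings by indices allow the pattern \<open>H\<close> to be fixed before the graph is
  known. \<open>H\<close> depends on \<open>cA\<close> and \<open>cB\<close> because the types of
  the two homogeneous sets emerge only from Ramsey's theorem, and each combination of types requires
  its own pattern.\<close>

definition patterned_pair ::
    "(bool \<Rightarrow> bool \<Rightarrow> nat \<Rightarrow> nat \<Rightarrow> bool) \<Rightarrow> nat \<Rightarrow> 'a set \<Rightarrow> 'a set set \<Rightarrow>
     bool \<Rightarrow> bool \<Rightarrow> (nat \<Rightarrow> 'a) \<Rightarrow> (nat \<Rightarrow> 'a) \<Rightarrow> bool" where
  "patterned_pair H t V E cA cB a b \<longleftrightarrow>
     inj_on a {..<t} \<and> inj_on b {..<t} \<and> a ` {..<t} \<subseteq> V \<and> b ` {..<t} \<subseteq> V \<and>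
     a ` {..<t} \<inter> b ` {..<t} = {} \<and>
     (if cA then clique (a ` {..<t}) E else indep (a ` {..<t}) E) \<and>
     (if cB then clique (b ` {..<t}) E else indep (b ` {..<t}) E) \<and>
     (\<forall>i<t. \<forall>j<t. {a i, b j} \<in> E \<longleftrightarrow> H cA cB i j)"

text \<open>
  The shattered set supplies, for a Ramsey-large number of new vertices, arbitrary traces on
  a homogeneous set; a homogeneous selection of those vertices then realises any pattern.
\<close>

lemma exists_homogeneous_patterned_pair:
  fixes H :: "bool \<Rightarrow> bool \<Rightarrow> nat \<Rightarrow> nat \<Rightarrow> bool" and t :: nat
  assumes "t > 0"
  shows "\<exists>d. \<forall>(V::'a set) E U. finite V \<longrightarrow> U \<subseteq> V \<longrightarrow>
    (\<exists>X\<subseteq>U. card X \<ge> d \<and> shatters ((\<lambda>v. {x \<in> U. {v, x} \<in> E}) ` (V - U)) X) \<longrightarrow>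
    (\<exists>cA cB a b. patterned_pair H t V E cA cB a b)"
proof -
  obtain R where R: "\<And>(V::'a set) E. finite V \<Longrightarrow> card V \<ge> R \<Longrightarrow>
      \<exists>W\<subseteq>V. card W = t \<and> clique W E \<or> card W = t \<and> indep W E"
    using ramsey2[where 'a = 'a, of t t] by metis
  \<comment> \<open>Labels for the homogeneous part of the shattered set: the second component
    prescribes which of the \<open>R\<close> outside vertices are neighbours, so every neighbourhood
    among them occurs \<open>t\<close> times.\<close>
  define L where "L = {..<t} \<times> Pow {..<R}"
  have finL: "finite L" unfolding L_def by simp
  obtain d where d: "\<And>(V::'a set) E. finite V \<Longrightarrow> card V \<ge> d \<Longrightarrow>
      \<exists>W\<subseteq>V. card W = card L \<and> clique W E \<or> card W = card L \<and> indep W E"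
    using ramsey2[where 'a = 'a, of "card L" "card L"] by metis
  show ?thesis
  proof (intro exI[of _ d] allI impI)
    fix V :: "'a set" and E :: "'a set set" and U :: "'a set"
    assume finV: "finite V" and UV: "U \<subseteq> V"
      and "\<exists>X\<subseteq>U. card X \<ge> d \<and> shatters ((\<lambda>v. {x \<in> U. {v, x} \<in> E}) ` (V - U)) X"
    then obtain X where X: "X \<subseteq> U" "card X \<ge> d"
      "shatters ((\<lambda>v. {x \<in> U. {v, x} \<in> E}) ` (V - U)) X" by blast
    have "finite X" using X UV finV by (meson finite_subset)
    then obtain W where W: "W \<subseteq> X" "card W = card L" and homW: "clique W E \<or> indep W E"
      using d[of X E] X by blast
    define cA where "cA \<longleftrightarrow> clique W E"
    have shW: "shatters ((\<lambda>v. {x \<in> U. {v, x} \<in> E}) ` (V - U)) W"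
      using shatters_subset[OF X(3) W(1)] .
    have finW: "finite W" using W \<open>finite X\<close> finite_subset by blast
    obtain \<phi> where \<phi>: "bij_betw \<phi> L W"
      using finite_same_card_bij[OF finL finW] W by auto
    have \<phi>W: "\<phi> z \<in> W" if "z \<in> L" for z using \<phi> that by (auto simp: bij_betw_def)
    have \<phi>inj: "\<phi> z = \<phi> z' \<longleftrightarrow> z = z'" if "z \<in> L" "z' \<in> L" for z z'
      using \<phi> that by (auto simp: bij_betw_def inj_on_def)
    have "\<forall>j. \<exists>v. v \<in> V - U \<and> {x \<in> W. {v, x} \<in> E} = \<phi> ` {z \<in> L. j \<in> snd z}"
    proof
      fix j
      have "\<phi> ` {z \<in> L. j \<in> snd z} \<subseteq> W" using \<phi>W by auto
      then have "\<exists>S\<in>(\<lambda>v. {x \<in> U. {v, x} \<in> E}) ` (V - U). S \<inter> W = \<phi> ` {z \<in> L. j \<in> snd z}"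
        using shW[unfolded shatters_def, rule_format] by simp
      then obtain v where "v \<in> V - U" "{x \<in> U. {v, x} \<in> E} \<inter> W = \<phi> ` {z \<in> L. j \<in> snd z}" by blast
      moreover have "{x \<in> U. {v, x} \<in> E} \<inter> W = {x \<in> W. {v, x} \<in> E}" using W X by auto
      ultimately show "\<exists>v. v \<in> V - U \<and> {x \<in> W. {v, x} \<in> E} = \<phi> ` {z \<in> L. j \<in> snd z}"
        by auto
    qed
    from choice[OF this] obtain w where w0:
      "\<forall>j. w j \<in> V - U \<and> {x \<in> W. {w j, x} \<in> E} = \<phi> ` {z \<in> L. j \<in> snd z}" ..
    have w: "w j \<in> V - U" "{x \<in> W. {w j, x} \<in> E} = \<phi> ` {z \<in> L. j \<in> snd z}" for j
      using w0 by simp_all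
    have wE: "{w j, \<phi> z} \<in> E \<longleftrightarrow> j \<in> snd z" if "z \<in> L" for j z
    proof -
      have "{w j, \<phi> z} \<in> E \<longleftrightarrow> \<phi> z \<in> {x \<in> W. {w j, x} \<in> E}" using \<phi>W[OF that] by simp
      also have "\<dots> \<longleftrightarrow> (\<exists>z'\<in>L. j \<in> snd z' \<and> \<phi> z = \<phi> z')" unfolding w(2) by blast
      also have "\<dots> \<longleftrightarrow> j \<in> snd z" using \<phi>inj[OF that] that by blast
      finally show ?thesis .
    qed
    \<comment> \<open>The label \<open>(0, {j})\<close> is adjacent to \<open>w j\<close> and to no
      other \<open>w j'\<close>, so the outside vertices are distinct.\<close>
    have winj: "inj_on w {..<R}"
    proof (rule inj_onI)
      fix j j' assume j: "j \<in> {..<R}" "j' \<in> {..<R}" "w j = w j'"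
      have z: "(0, {j}) \<in> L" using j assms unfolding L_def by auto
      have "{w j, \<phi> (0, {j})} \<in> E" using wE[OF z] by simp
      then have "{w j', \<phi> (0, {j})} \<in> E" unfolding j(3) .
      then show "j = j'" using wE[OF z, of j'] by simp
    qed
    obtain Z where Z: "Z \<subseteq> w ` {..<R}" "card Z = t" and homZ: "clique Z E \<or> indep Z E"
      using R[of "w ` {..<R}" E] winj by (auto simp: card_image)
    define cB where "cB \<longleftrightarrow> clique Z E"
    have "finite Z" using Z finite_subset by blast
    then obtain b where b: "bij_betw b {..<t} Z"
      using Z by (metis atLeast0LessThan ex_bij_betw_nat_finite)
    have "\<exists>l<R. b j = w l" if "j < t" for j
      using b Z that by (auto simp: bij_betw_def)
    then obtain l where l: "\<And>j. j < t \<Longrightarrow> l j < R \<and> b j = w (l j)" by metis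
    have linj: "l j = l j' \<longleftrightarrow> j = j'" if "j < t" "j' < t" for j j'
      using l[OF that(1)] l[OF that(2)] b that by (auto simp: bij_betw_def inj_on_def)
    define h where "h i j = H cA cB i j" for i j
    \<comment> \<open>The first component keeps the chosen vertices distinct even where rows of the
      pattern coincide; the second translates row \<open>i\<close> into indices of outside
      vertices.\<close>
    define code where "code i = (i, l ` {j. j < t \<and> h i j})" for i
    define a where "a i = \<phi> (code i)" for i
    have codeL: "code i \<in> L" if "i < t" for i using that l unfolding code_def L_def by auto
    have "inj_on a {..<t}"
      using codeL \<phi>inj unfolding inj_on_def a_def by (auto simp: code_def)
    moreover have aW: "a ` {..<t} \<subseteq> W" using \<phi>W[OF codeL] unfolding a_def by auto
    moreover have bZ: "b ` {..<t} = Z" "inj_on b {..<t}" using b by (auto simp: bij_betw_def)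
    moreover have "a ` {..<t} \<subseteq> U" using aW W X by blast
    moreover have "Z \<subseteq> V - U" using Z w by blast
    ultimately have inj: "inj_on a {..<t}" "inj_on b {..<t}" "a ` {..<t} \<subseteq> V" "b ` {..<t} \<subseteq> V"
      "a ` {..<t} \<inter> b ` {..<t} = {}"
      using UV by blast+
    have "if cA then clique (a ` {..<t}) E else indep (a ` {..<t}) E"
      using homW aW unfolding cA_def by (auto intro: smaller_clique smaller_indep)
    moreover have "if cB then clique (b ` {..<t}) E else indep (b ` {..<t}) E"
      using homZ unfolding cB_def bZ by auto
    moreover have "{a i, b j} \<in> E \<longleftrightarrow> h i j" if "i < t" "j < t" for i j
    proof -
      have "{a i, b j} \<in> E \<longleftrightarrow> l j \<in> snd (code i)"
        using wE[OF codeL[OF that(1)], of "l j"] l[OF that(2)] unfolding a_def by (simp add: insert_commute)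
      also have "\<dots> \<longleftrightarrow> h i j" unfolding code_def using linj that by auto
      finally show ?thesis .
    qed
    ultimately have "patterned_pair H t V E cA cB a b"
      using inj unfolding h_def patterned_pair_def by simp
    then show "\<exists>cA cB a b. patterned_pair H t V E cA cB a b" by blast
  qed
qed

section \<open>Growth comparisons\<close>

lemma eventually_polynomial_le_power:
  fixes \<rho> :: real
  assumes "\<rho> > 1"
  shows "\<forall>\<^sub>F u in sequentially. (real u + 1) ^ d \<le> \<rho> ^ u"
proof -
  have "ln \<rho> > 0" using assms by simp
  have "((\<lambda>u::nat. real d * ln (real u + 1) / real u) \<longlongrightarrow> 0) sequentially" by real_asymp
  then have "\<forall>\<^sub>F u in sequentially. real d * ln (real u + 1) / real u < ln \<rho>"
    using \<open>ln \<rho> > 0\<close> by (rule order_tendstoD)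
  then show ?thesis
    using eventually_gt_at_top[of 0]
  proof eventually_elim
    case (elim u)
    then have "ln ((real u + 1) ^ d) \<le> ln (\<rho> ^ u)"
      using assms by (simp add: ln_realpow field_simps)
    then show ?case using assms by (subst (asm) ln_le_cancel_iff) auto
  qed
qed

text \<open>With sets of size \<open>t = r\<^sup>2\<close> and pattern parameter
  \<open>7 * r\<close>, the threshold for near-constancy is \<open>14 * r\<close>, of order the
  square root of \<open>t\<close>. The number of near-constant traces is therefore subexponential in
  \<open>t\<close>.\<close>

lemma eventually_near_constant_le_power:
  fixes \<rho> :: real
  assumes "\<rho> > 1"
  shows "\<forall>\<^sub>F r in sequentially. 4 * (real (r\<^sup>2) + 1) ^ (14 * r) \<le> \<rho> ^ (r\<^sup>2)"
proof -
  have "ln \<rho> > 0" using assms by simp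
  have "((\<lambda>r::nat. (ln 4 + 14 * real r * ln (real r ^ 2 + 1)) / real r ^ 2) \<longlongrightarrow> 0) sequentially"
    by real_asymp
  then have "\<forall>\<^sub>F r::nat in sequentially. (ln 4 + 14 * real r * ln (real r ^ 2 + 1)) / real r ^ 2 < ln \<rho>"
    using \<open>ln \<rho> > 0\<close> by (rule order_tendstoD)
  then show ?thesis
    using eventually_gt_at_top[of 0]
  proof eventually_elim
    case (elim r)
    have "real r ^ 2 + 1 > 0" by (simp add: add_nonneg_pos)
    then have "ln (4 * (real (r\<^sup>2) + 1) ^ (14 * r)) = ln 4 + 14 * real r * ln (real r ^ 2 + 1)"
      by (simp add: ln_mult ln_realpow)
    also have "\<dots> \<le> real r ^ 2 * ln \<rho>" using elim by (simp add: field_simps)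
    also have "\<dots> = ln (\<rho> ^ (r\<^sup>2))" using assms by (simp add: ln_realpow)
    finally have "ln (4 * (real (r\<^sup>2) + 1) ^ (14 * r)) \<le> ln (\<rho> ^ (r\<^sup>2))" .
    then show ?case using assms \<open>real r ^ 2 + 1 > 0\<close> by (subst (asm) ln_le_cancel_iff) auto
  qed
qed

section \<open>The dichotomy between few traces and a homogeneous pair\<close>

text \<open>The bound \<open>s\<close> depends on \<open>p\<close> and \<open>\<theta>\<close> only,
  so the peeling can repeat it on every remaining graph. When traces are few, their weight is a
  polynomial times \<open>q ^ u\<close>, far below what is required; the homogeneous pair is the
  case that forces \<open>\<theta>\<^sup>2\<close> to exceed \<open>q\<close>.\<close>

lemma exists_few_attachments:
  fixes p \<theta> :: real
  assumes p: "0 < p" "p < 1" and \<theta>: "max p (1 - p) < \<theta>\<^sup>2" "0 < \<theta>"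
  shows "\<exists>s. \<forall>(V::'a set) E. finite V \<longrightarrow> s \<le> card V \<longrightarrow> E \<subseteq> [V]\<^bsup>2\<^esup> \<longrightarrow>
    \<not> contains_induced C5_vertices C5_edges V E \<longrightarrow>
    (\<exists>T \<A>. T \<subseteq> V \<and> T \<noteq> {} \<and> card T \<le> s \<and> \<A> \<subseteq> Pow T \<and>
      (\<forall>v\<in>V - T. {x \<in> T. {v, x} \<in> E} \<in> \<A>) \<and> bernoulli_mass p T \<A> \<le> \<theta> ^ card T)"
proof -
  define q where "q = max p (1 - p)"
  have q: "0 < q" "q < 1" using p unfolding q_def by auto
  have "\<theta>\<^sup>2 / q > 1" using \<theta> q unfolding q_def[symmetric] by simp
  have "q\<^sup>2 < q" using q by (simp add: power2_eq_square)
  then have "q < \<theta>" using \<theta> unfolding q_def[symmetric]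
    by (meson less_imp_le order_less_trans power_less_imp_less_base)
  then have "\<theta> / q > 1" using q by simp
  obtain r where r: "r > 0" "4 * (real (r\<^sup>2) + 1) ^ (14 * r) \<le> (\<theta>\<^sup>2 / q) ^ (r\<^sup>2)"
    using eventually_conj[OF eventually_gt_at_top[of 0] eventually_near_constant_le_power[OF \<open>\<theta>\<^sup>2 / q > 1\<close>]]
    by (metis (mono_tags, lifting) eventually_sequentially order_refl)
  define t where "t = r\<^sup>2"
  define k where "k = 7 * r"
  have t: "t > 0" unfolding t_def using r by simp
  have "\<exists>h. \<forall>cA cB. rich_pattern (C5_pattern cA cB) k {..<t} {..<t} (h cA cB)"
  proof -
    have "\<forall>cA cB. \<exists>H. rich_pattern (C5_pattern cA cB) k {..<t} {..<t} H"
      using exists_rich_pattern[OF r(1)] unfolding t_def k_def by blast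
    then show ?thesis by metis
  qed
  then obtain h where h: "\<And>cA cB. rich_pattern (C5_pattern cA cB) k {..<t} {..<t} (h cA cB)" by blast
  obtain d where d: "\<forall>(V::'a set) E U. finite V \<longrightarrow> U \<subseteq> V \<longrightarrow>
    (\<exists>X\<subseteq>U. card X \<ge> d \<and> shatters ((\<lambda>v. {x \<in> U. {v, x} \<in> E}) ` (V - U)) X) \<longrightarrow>
    (\<exists>cA cB a b. patterned_pair h t V E cA cB a b)"
    using exists_homogeneous_patterned_pair[OF t, where 'a = 'a, of h] by (elim exE)
  \<comment> \<open>The exponent \<open>d\<close> is fixed by the patterns alone, so
    \<open>u\<close> can be taken large afterwards.\<close>
  obtain u where u: "u > 0" "(real u + 1) ^ d \<le> (\<theta> / q) ^ u"
    using eventually_conj[OF eventually_gt_at_top[of 0] eventually_polynomial_le_power[OF \<open>\<theta> / q > 1\<close>, of d]]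
    by (metis (mono_tags, lifting) eventually_sequentially order_refl)
  show ?thesis
  proof (intro exI[of _ "max u (2 * t)"] allI impI)
    fix V :: "'a set" and E
    assume finV: "finite V" and cV: "max u (2 * t) \<le> card V" and E: "E \<subseteq> [V]\<^bsup>2\<^esup>"
      and C5: "\<not> contains_induced C5_vertices C5_edges V E"
    obtain U where U: "U \<subseteq> V" "card U = u" using cV by (metis max.boundedE obtain_subset_with_card_n)
    have finU: "finite U" using U finV finite_subset by blast
    define \<T> where "\<T> = (\<lambda>v. {x \<in> U. {v, x} \<in> E}) ` (V - U)"
    have TU: "\<T> \<subseteq> Pow U" unfolding \<T>_def by auto
    show "\<exists>T \<A>. T \<subseteq> V \<and> T \<noteq> {} \<and> card T \<le> max u (2 * t) \<and> \<A> \<subseteq> Pow T \<and>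
      (\<forall>v\<in>V - T. {x \<in> T. {v, x} \<in> E} \<in> \<A>) \<and> bernoulli_mass p T \<A> \<le> \<theta> ^ card T"
    proof (cases "card \<T> > (card U + 1) ^ d")
      case False
      then have "real (card \<T>) \<le> real ((card U + 1) ^ d)" by (intro of_nat_mono) simp
      then have "real (card \<T>) \<le> (\<theta> / q) ^ u" using u U by (simp add: add.commute)
      then have "real (card \<T>) * q ^ u \<le> (\<theta> / q) ^ u * q ^ u"
        using q by (intro mult_right_mono) auto
      also have "\<dots> = \<theta> ^ u" using q by (simp add: power_divide)
      finally have "bernoulli_mass p U \<T> \<le> \<theta> ^ card U"
        using bernoulli_mass_le[of p U \<T>] p U unfolding q_def by simp
      then show ?thesis
        using U u TU by (intro exI[of _ U] exI[of _ \<T>]) (auto simp: \<T>_def)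
    next
      case True
      have "\<exists>X\<subseteq>U. card X \<ge> d \<and> shatters \<T> X"
        by (rule exists_shattered_set[OF finU TU True]) blast
      note d[rule_format, OF finV U(1) this[unfolded \<T>_def]]
      then obtain cA cB a b where "patterned_pair h t V E cA cB a b" by blast
      note ab = this[unfolded patterned_pair_def]
      define A where "A = a ` {..<t}"
      define B where "B = b ` {..<t}"
      have ab: "inj_on a {..<t}" "inj_on b {..<t}" "A \<subseteq> V" "B \<subseteq> V" "A \<inter> B = {}"
        "if cA then clique A E else indep A E" "if cB then clique B E else indep B E"
        "\<forall>i<t. \<forall>j<t. {a i, b j} \<in> E \<longleftrightarrow> h cA cB i j"
        using ab unfolding A_def B_def by simp_all
      have cAB: "card A = t" "card B = t" "finite A" "finite B"
        using ab unfolding A_def B_def by (auto simp: card_image)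
      have rich: "rich_pattern (C5_pattern cA cB) k A B (\<lambda>x y. {x, y} \<in> E)"
        unfolding A_def B_def
        by (rule rich_pattern_image[OF h[of cA cB] ab(1,2)]) (use ab(8) in simp)
      \<comment> \<open>Here \<open>14 * r\<close> is \<open>2 * k\<close>, the threshold at which a
        split vertex would create a five-cycle.\<close>
      define nc where "nc C = {X. X \<subseteq> C \<and> (card X < 14 * r \<or> card (C - X) < 14 * r)}" for C :: "'a set"
      define \<A> where "\<A> = {S. S \<subseteq> A \<union> B \<and> (S \<inter> A \<in> nc A \<or> S \<inter> B \<in> nc B)}"
      have "bernoulli_mass p (A \<union> B) \<A> \<le> 4 * (real t + 1) ^ (14 * r) * q ^ t"
        unfolding \<A>_def nc_def q_def using p cAB ab(5) by (intro mass_near_constant_on_either_le) auto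
      also have "\<dots> \<le> (\<theta>\<^sup>2 / q) ^ t * q ^ t"
        using r q unfolding t_def[symmetric] by (intro mult_right_mono) auto
      also have "\<dots> = \<theta> ^ (2 * t)" using q by (simp add: power_divide power_mult)
      also have "2 * t = card (A \<union> B)" using cAB ab(5) by (simp add: card_Un_disjoint)
      finally have "bernoulli_mass p (A \<union> B) \<A> \<le> \<theta> ^ card (A \<union> B)" .
      moreover have "{x \<in> A \<union> B. {v, x} \<in> E} \<in> \<A>" if v: "v \<in> V - (A \<union> B)" for v
      proof -
        have "{x \<in> A \<union> B. {v, x} \<in> E} \<inter> A = {x \<in> A. {v, x} \<in> E}"
          "{x \<in> A \<union> B. {v, x} \<in> E} \<inter> B = {x \<in> B. {v, x} \<in> E}" by auto
        then show ?thesis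
          using homogeneous_pair_traces[OF E C5 ab(3-7) rich v]
          unfolding \<A>_def nc_def k_def by auto
      qed
      moreover have "card (A \<union> B) \<le> max u (2 * t)" "A \<union> B \<noteq> {}"
        using cAB ab(5) t by (auto simp: card_Un_disjoint)
      ultimately show ?thesis
        using ab(3,4) by (intro exI[of _ "A \<union> B"] exI[of _ \<A>]) (auto simp: \<A>_def)
    qed
  qed
qed

subsection \<open>Peeling off vertices with few attachments\<close>

lemma contains_induced_mono:
  assumes "contains_induced W F U (E \<inter> [U]\<^bsup>2\<^esup>)" "U \<subseteq> V" "E \<subseteq> [V]\<^bsup>2\<^esup>"
  shows "contains_induced W F V E"
proof -
  obtain f where f: "inj_on f W" "f ` W \<subseteq> U"
    "\<forall>x\<in>W. \<forall>y\<in>W. {x, y} \<in> F \<longleftrightarrow> {f x, f y} \<in> E \<inter> [U]\<^bsup>2\<^esup>"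
    using assms(1) unfolding contains_induced_def by blast
  have "{f x, f y} \<in> E \<inter> [U]\<^bsup>2\<^esup> \<longleftrightarrow> {f x, f y} \<in> E" if "x \<in> W" "y \<in> W" for x y
  proof -
    have "f x \<in> U" "f y \<in> U" using f(2) that by auto
    then show ?thesis using assms(3) by fastforce
  qed
  then show ?thesis
    using f assms(2) unfolding contains_induced_def by (intro exI[of _ f]) auto
qed

definition C5_free_graphs :: "'a set \<Rightarrow> 'a set set set" where
  "C5_free_graphs V = {E. E \<subseteq> [V]\<^bsup>2\<^esup> \<and> \<not> contains_induced C5_vertices C5_edges V E}"

lemma finite_C5_free_graphs: "finite V \<Longrightarrow> finite (C5_free_graphs V)"
  by (rule finite_subset[of _ "Pow ([V]\<^bsup>2\<^esup>)"]) (auto simp: C5_free_graphs_def finite_imp_finite_nsets)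

text \<open>The pairs of \<open>V\<close> divide into those inside \<open>T\<close>, those inside
  \<open>V - T\<close>, and one star into \<open>T\<close> for each outside vertex. These are
  independent: the first contribute at most 1, the second inherit the absence of an induced
  five-cycle, and each star contributes the mass of \<open>\<A>\<close>.\<close>

lemma C5_free_mass_attached_le:
  fixes V :: "'a set"
  assumes p: "0 \<le> p" "p \<le> 1" and fin: "finite V" and T: "T \<subseteq> V" and A: "\<A> \<subseteq> Pow T"
  shows "bernoulli_mass p ([V]\<^bsup>2\<^esup>)
      {E \<in> C5_free_graphs V. \<forall>v\<in>V - T. {x \<in> T. {v, x} \<in> E} \<in> \<A>}
    \<le> bernoulli_mass p T \<A> ^ card (V - T) * bernoulli_mass p ([V - T]\<^bsup>2\<^esup>) (C5_free_graphs (V - T))"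
proof -
  define D3 where "D3 v = (\<lambda>x. {v, x}) ` T" for v
  define X where "X = (\<Union>v\<in>V - T. D3 v)"
  define Y where "Y = [T]\<^bsup>2\<^esup> \<union> [V - T]\<^bsup>2\<^esup>"
  define \<B> where "\<B> = {F. F \<subseteq> Y \<and> F \<inter> [T]\<^bsup>2\<^esup> \<in> Pow ([T]\<^bsup>2\<^esup>) \<and> F \<inter> [V - T]\<^bsup>2\<^esup> \<in> C5_free_graphs (V - T)}"
  define \<C> where "\<C> = {F. F \<subseteq> X \<and> (\<forall>v\<in>V - T. F \<inter> D3 v \<in> (`) (\<lambda>x. {v, x}) ` \<A>)}"
  have finT: "finite T" using T fin finite_subset by blast
  have fin2: "finite ([U]\<^bsup>2\<^esup>)" if "finite U" for U :: "'a set"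
    using that by (rule finite_imp_finite_nsets)
  have inj: "inj_on (\<lambda>x. {v, x}) T" if "v \<in> V - T" for v
    using that by (auto simp: inj_on_def doubleton_eq_iff)
  have YX: "Y \<inter> X = {}"
    unfolding Y_def X_def D3_def by auto
  have TT: "[T]\<^bsup>2\<^esup> \<inter> [V - T]\<^bsup>2\<^esup> = {}"
  proof (rule ccontr)
    assume "[T]\<^bsup>2\<^esup> \<inter> [V - T]\<^bsup>2\<^esup> \<noteq> {}"
    then obtain e where "e \<in> [T]\<^bsup>2\<^esup>" "e \<in> [V - T]\<^bsup>2\<^esup>" by blast
    then show False by (elim nsets2_E) (auto simp: doubleton_eq_iff)
  qed
  have VYX: "[V]\<^bsup>2\<^esup> = Y \<union> X"
  proof
    show "[V]\<^bsup>2\<^esup> \<subseteq> Y \<union> X"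
    proof
      fix e assume "e \<in> [V]\<^bsup>2\<^esup>"
      then obtain x y where "e = {x, y}" "x \<noteq> y" "x \<in> V" "y \<in> V"
        by (elim nsets2_E) auto
      then show "e \<in> Y \<union> X" unfolding Y_def X_def D3_def
        by (cases "x \<in> T"; cases "y \<in> T") (auto simp: insert_commute)
    qed
    show "Y \<union> X \<subseteq> [V]\<^bsup>2\<^esup>"
      using T nsets_mono[of T V 2] nsets_mono[of "V - T" V 2] unfolding Y_def X_def D3_def by auto
  qed
  have "bernoulli_mass p ([V]\<^bsup>2\<^esup>) {E \<in> C5_free_graphs V. \<forall>v\<in>V - T. {x \<in> T. {v, x} \<in> E} \<in> \<A>}
      \<le> bernoulli_mass p ([V]\<^bsup>2\<^esup>) {E. E \<subseteq> Y \<union> X \<and> E \<inter> Y \<in> \<B> \<and> E \<inter> X \<in> \<C>}"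
  proof (rule bernoulli_mass_mono[OF p])
    show "finite {E. E \<subseteq> Y \<union> X \<and> E \<inter> Y \<in> \<B> \<and> E \<inter> X \<in> \<C>}"
      by (rule finite_subset[of _ "Pow ([V]\<^bsup>2\<^esup>)"]) (use fin2[OF fin] VYX in auto)
    show "{E \<in> C5_free_graphs V. \<forall>v\<in>V - T. {x \<in> T. {v, x} \<in> E} \<in> \<A>}
        \<subseteq> {E. E \<subseteq> Y \<union> X \<and> E \<inter> Y \<in> \<B> \<and> E \<inter> X \<in> \<C>}"
    proof
      fix E assume "E \<in> {E \<in> C5_free_graphs V. \<forall>v\<in>V - T. {x \<in> T. {v, x} \<in> E} \<in> \<A>}"
      then have E: "E \<subseteq> [V]\<^bsup>2\<^esup>" "\<not> contains_induced C5_vertices C5_edges V E"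
        and tr: "\<And>v. v \<in> V - T \<Longrightarrow> {x \<in> T. {v, x} \<in> E} \<in> \<A>"
        unfolding C5_free_graphs_def by auto
      have "E \<inter> [V - T]\<^bsup>2\<^esup> \<in> C5_free_graphs (V - T)"
        using contains_induced_mono[of C5_vertices C5_edges "V - T" E V] E
        unfolding C5_free_graphs_def by auto
      moreover have "E \<inter> Y \<inter> [V - T]\<^bsup>2\<^esup> = E \<inter> [V - T]\<^bsup>2\<^esup>" unfolding Y_def by auto
      ultimately have "E \<inter> Y \<in> \<B>" unfolding \<B>_def by auto
      moreover have "E \<inter> X \<in> \<C>"
      proof -
        have "E \<inter> X \<inter> D3 v \<in> (`) (\<lambda>x. {v, x}) ` \<A>" if v: "v \<in> V - T" for v
        proof -
          have "E \<inter> X \<inter> D3 v = (\<lambda>x. {v, x}) ` {x \<in> T. {v, x} \<in> E}"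
            using v unfolding X_def D3_def by auto
          then show ?thesis using tr[OF v] by blast
        qed
        then show ?thesis unfolding \<C>_def by auto
      qed
      ultimately show "E \<in> {E. E \<subseteq> Y \<union> X \<and> E \<inter> Y \<in> \<B> \<and> E \<inter> X \<in> \<C>}"
        using E VYX by auto
    qed
  qed
  also have "\<dots> = bernoulli_mass p Y \<B> * bernoulli_mass p X \<C>"
    unfolding VYX
    by (rule bernoulli_mass_prod) (use VYX YX fin2[OF fin] in \<open>auto simp: \<B>_def \<C>_def\<close>)
  also have "bernoulli_mass p Y \<B>
      = bernoulli_mass p ([T]\<^bsup>2\<^esup>) (Pow ([T]\<^bsup>2\<^esup>)) * bernoulli_mass p ([V - T]\<^bsup>2\<^esup>) (C5_free_graphs (V - T))"
    unfolding \<B>_def Y_def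
    by (rule bernoulli_mass_prod)
       (use fin2 finT fin TT in \<open>auto simp: C5_free_graphs_def\<close>)
  also have "bernoulli_mass p ([T]\<^bsup>2\<^esup>) (Pow ([T]\<^bsup>2\<^esup>)) = 1"
    using fin2[OF finT] by (rule bernoulli_mass_Pow)
  also have "bernoulli_mass p X \<C> = (\<Prod>v\<in>V - T. bernoulli_mass p (D3 v) ((`) (\<lambda>x. {v, x}) ` \<A>))"
    unfolding X_def \<C>_def
  proof (rule bernoulli_mass_Prod)
    show "disjoint_family_on D3 (V - T)"
      unfolding disjoint_family_on_def D3_def by (auto simp: doubleton_eq_iff)
  qed (use fin finT A in \<open>auto simp: D3_def\<close>)
  also have "\<dots> = (\<Prod>v\<in>V - T. bernoulli_mass p T \<A>)"
    unfolding D3_def by (intro prod.cong bernoulli_mass_image inj A) auto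
  finally show ?thesis by (simp add: mult.commute)
qed

section \<open>Solving the recurrence\<close>

text \<open>Write \<open>n = a + b\<close> and expand the square. The cross term
  \<open>2 * a * b\<close> carries the base \<open>\<mu>\<close> instead of \<open>\<eta>\<close>, a
  gain of \<open>(\<eta> / \<mu>) ^ (2 * a * b)\<close>; up to the constant power \<open>s\<close>
  this is at least \<open>(\<eta> / \<mu>) ^ n\<close>, because \<open>b \<le> 2 * a * b\<close> and
  \<open>a \<le> s\<close>. The factor \<open>M\<close> pays for the missing
  \<open>\<eta> ^ (a\<^sup>2)\<close>.\<close>

lemma peeling_term_le:
  fixes \<eta> \<mu> M :: real
  assumes "0 < \<mu>" "\<mu> < \<eta>" "1 \<le> a" "a \<le> s" "s \<le> n" "1 \<le> M * \<eta> ^ (a\<^sup>2)" "0 \<le> M"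
  shows "(\<mu> ^ (2 * a)) ^ (n - a) * \<eta> ^ ((n - a)\<^sup>2) * (\<eta> / \<mu>) ^ n \<le> M * (\<eta> / \<mu>) ^ s * \<eta> ^ (n\<^sup>2)"
proof -
  define \<beta> where "\<beta> = \<eta> / \<mu>"
  define b where "b = n - a"
  have \<beta>: "\<beta> > 1" "\<eta> = \<beta> * \<mu>" using assms unfolding \<beta>_def by auto
  have n: "n = a + b" using assms unfolding b_def by simp
  have "b \<le> 2 * a * b" using assms(3) by (cases a) auto
  then have "a + b \<le> s + 2 * a * b" using assms by linarith
  then have "\<beta> ^ n \<le> \<beta> ^ (s + 2 * a * b)" unfolding n using \<beta> by (intro power_increasing) auto
  also have "\<dots> = \<beta> ^ (s + 2 * a * b) * 1" by simp
  also have "\<dots> \<le> \<beta> ^ (s + 2 * a * b) * (M * \<eta> ^ (a\<^sup>2))"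
    using assms \<beta> by (intro mult_left_mono) auto
  finally have "\<mu> ^ (2 * a * b) * \<eta> ^ (b\<^sup>2) * \<beta> ^ n
      \<le> \<mu> ^ (2 * a * b) * \<eta> ^ (b\<^sup>2) * (\<beta> ^ (s + 2 * a * b) * (M * \<eta> ^ (a\<^sup>2)))"
    using assms by (intro mult_left_mono) auto
  also have "\<dots> = M * \<beta> ^ s * ((\<beta> * \<mu>) ^ (2 * a * b) * \<eta> ^ (b\<^sup>2) * \<eta> ^ (a\<^sup>2))"
    by (simp add: power_add power_mult_distrib)
  also have "(\<beta> * \<mu>) ^ (2 * a * b) * \<eta> ^ (b\<^sup>2) * \<eta> ^ (a\<^sup>2) = \<eta> ^ (n\<^sup>2)"
  proof -
    have "2 * a * b + b\<^sup>2 + a\<^sup>2 = n\<^sup>2" unfolding n by (simp add: power2_eq_square algebra_simps)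
    then show ?thesis unfolding \<beta>(2)[symmetric] by (simp only: power_add[symmetric])
  qed
  finally show ?thesis unfolding b_def[symmetric] \<beta>_def[symmetric] by (simp add: power_mult)
qed

text \<open>A union bound over the peeled set and its family of traces. The inner sum runs over all
  families with a constant summand, so it merely counts them.\<close>

lemma C5_free_mass_recurrence:
  fixes p \<theta> :: real
  assumes p: "0 < p" "p < 1" and \<theta>: "max p (1 - p) < \<theta>\<^sup>2" "0 < \<theta>"
  shows "\<exists>s. \<forall>V::'a set. finite V \<longrightarrow> s \<le> card V \<longrightarrow>
    bernoulli_mass p ([V]\<^bsup>2\<^esup>) (C5_free_graphs V)
    \<le> (\<Sum>T\<in>{T. T \<subseteq> V \<and> T \<noteq> {} \<and> card T \<le> s}. \<Sum>\<A>\<in>Pow (Pow T).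
        (\<theta> ^ card T) ^ card (V - T) * bernoulli_mass p ([V - T]\<^bsup>2\<^esup>) (C5_free_graphs (V - T)))"
proof -
  obtain s where s: "\<forall>(V::'a set) E. finite V \<longrightarrow> s \<le> card V \<longrightarrow> E \<subseteq> [V]\<^bsup>2\<^esup> \<longrightarrow>
    \<not> contains_induced C5_vertices C5_edges V E \<longrightarrow>
    (\<exists>T \<A>. T \<subseteq> V \<and> T \<noteq> {} \<and> card T \<le> s \<and> \<A> \<subseteq> Pow T \<and>
      (\<forall>v\<in>V - T. {x \<in> T. {v, x} \<in> E} \<in> \<A>) \<and> bernoulli_mass p T \<A> \<le> \<theta> ^ card T)"
    using exists_few_attachments[OF assms, where 'a = 'a] by (elim exE)
  show ?thesis
  proof (intro exI[of _ s] allI impI)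
    fix V :: "'a set" assume V: "finite V" "s \<le> card V"
    define \<S> where "\<S> = {T. T \<subseteq> V \<and> T \<noteq> {} \<and> card T \<le> s}"
    \<comment> \<open>Families of too large a mass are assigned no graphs, so the same bound holds
      for every index of the sum.\<close>
    define G where "G T \<A> = (if bernoulli_mass p T \<A> \<le> \<theta> ^ card T
      then {E \<in> C5_free_graphs V. \<forall>v\<in>V - T. {x \<in> T. {v, x} \<in> E} \<in> \<A>} else {})" for T \<A>
    have finS: "finite \<S>" unfolding \<S>_def using V by simp
    have finT: "finite T" if "T \<in> \<S>" for T using that V finite_subset unfolding \<S>_def by blast
    have finG: "finite (G T \<A>)" for T \<A> unfolding G_def using finite_C5_free_graphs[OF V(1)] by simp
    have "C5_free_graphs V \<subseteq> (\<Union>T\<in>\<S>. \<Union>\<A>\<in>Pow (Pow T). G T \<A>)"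
    proof
      fix E assume E: "E \<in> C5_free_graphs V"
      then obtain T \<A> where "T \<subseteq> V" "T \<noteq> {}" "card T \<le> s" "\<A> \<subseteq> Pow T"
        "\<forall>v\<in>V - T. {x \<in> T. {v, x} \<in> E} \<in> \<A>" "bernoulli_mass p T \<A> \<le> \<theta> ^ card T"
        using s[rule_format, OF V, of E] unfolding C5_free_graphs_def by blast
      then have "T \<in> \<S>" "\<A> \<in> Pow (Pow T)" "E \<in> G T \<A>" using E unfolding \<S>_def G_def by auto
      then show "E \<in> (\<Union>T\<in>\<S>. \<Union>\<A>\<in>Pow (Pow T). G T \<A>)" by blast
    qed
    then have "bernoulli_mass p ([V]\<^bsup>2\<^esup>) (C5_free_graphs V)
        \<le> bernoulli_mass p ([V]\<^bsup>2\<^esup>) (\<Union>T\<in>\<S>. \<Union>\<A>\<in>Pow (Pow T). G T \<A>)"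
      using p finS finT finG by (intro bernoulli_mass_mono) auto
    also have "\<dots> \<le> (\<Sum>T\<in>\<S>. bernoulli_mass p ([V]\<^bsup>2\<^esup>) (\<Union>\<A>\<in>Pow (Pow T). G T \<A>))"
      using p finS finT finG by (intro bernoulli_mass_UN_le) auto
    also have "\<dots> \<le> (\<Sum>T\<in>\<S>. \<Sum>\<A>\<in>Pow (Pow T). bernoulli_mass p ([V]\<^bsup>2\<^esup>) (G T \<A>))"
      using p finT finG by (intro sum_mono bernoulli_mass_UN_le) auto
    also have "\<dots> \<le> (\<Sum>T\<in>\<S>. \<Sum>\<A>\<in>Pow (Pow T).
        (\<theta> ^ card T) ^ card (V - T) * bernoulli_mass p ([V - T]\<^bsup>2\<^esup>) (C5_free_graphs (V - T)))"
    proof (intro sum_mono)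
      fix T \<A> assume T: "T \<in> \<S>" and A: "\<A> \<in> Pow (Pow T)"
      show "bernoulli_mass p ([V]\<^bsup>2\<^esup>) (G T \<A>)
        \<le> (\<theta> ^ card T) ^ card (V - T) * bernoulli_mass p ([V - T]\<^bsup>2\<^esup>) (C5_free_graphs (V - T))"
      proof (cases "bernoulli_mass p T \<A> \<le> \<theta> ^ card T")
        case True
        then have "bernoulli_mass p ([V]\<^bsup>2\<^esup>) (G T \<A>)
          \<le> bernoulli_mass p T \<A> ^ card (V - T) * bernoulli_mass p ([V - T]\<^bsup>2\<^esup>) (C5_free_graphs (V - T))"
          unfolding G_def using C5_free_mass_attached_le[of p V T \<A>] p V T A \<S>_def by auto
        also have "\<dots> \<le> (\<theta> ^ card T) ^ card (V - T) * bernoulli_mass p ([V - T]\<^bsup>2\<^esup>) (C5_free_graphs (V - T))"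
          using p True by (intro mult_right_mono power_mono bernoulli_mass_nonneg) auto
        finally show ?thesis .
      next
        case False
        then have "bernoulli_mass p ([V]\<^bsup>2\<^esup>) (G T \<A>) = 0" unfolding G_def by (simp add: bernoulli_mass_def)
        also have "0 \<le> (\<theta> ^ card T) ^ card (V - T) * bernoulli_mass p ([V - T]\<^bsup>2\<^esup>) (C5_free_graphs (V - T))"
          using \<theta> p by (intro mult_nonneg_nonneg bernoulli_mass_nonneg) auto
        finally show ?thesis .
      qed
    qed
    finally show "bernoulli_mass p ([V]\<^bsup>2\<^esup>) (C5_free_graphs V)
      \<le> (\<Sum>T\<in>{T. T \<subseteq> V \<and> T \<noteq> {} \<and> card T \<le> s}. \<Sum>\<A>\<in>Pow (Pow T).
        (\<theta> ^ card T) ^ card (V - T) * bernoulli_mass p ([V - T]\<^bsup>2\<^esup>) (C5_free_graphs (V - T)))"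
      unfolding \<S>_def .
  qed
qed

text \<open>The recurrence is run with a base \<open>\<mu>\<close> strictly between the fourth root
  of \<open>max p (1 - p)\<close> and \<open>\<eta>\<close>. Each term then gains
  \<open>(\<eta> / \<mu>) ^ n\<close> against the target, which outweighs the polynomial number of
  terms. The exponent 4 combines the square root from the pair with the number of pairs being about
  half of \<open>n\<^sup>2\<close>.\<close>

lemma C5_free_mass_le:
  fixes p \<eta> :: real
  assumes p: "0 < p" "p < 1" and \<eta>: "max p (1 - p) < \<eta> ^ 4" "0 < \<eta>"
  shows "\<exists>C>0. \<forall>V::'a set. finite V \<longrightarrow>
    bernoulli_mass p ([V]\<^bsup>2\<^esup>) (C5_free_graphs V) \<le> C * \<eta> ^ ((card V)\<^sup>2)"
proof -
  define w where "w V = bernoulli_mass p ([V]\<^bsup>2\<^esup>) (C5_free_graphs V)" for V :: "'a set"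
  define q where "q = max p (1 - p)"
  have q: "0 < q" using p unfolding q_def by auto
  have "root 4 q < root 4 (\<eta> ^ 4)" using \<eta> unfolding q_def by simp
  then obtain \<mu> where \<mu>: "root 4 q < \<mu>" "\<mu> < \<eta>" using \<eta> dense by (metis real_root_power_cancel less_imp_le zero_less_numeral)
  have \<mu>0: "0 < \<mu>" using \<mu> q by (meson less_trans real_root_gt_zero zero_less_numeral)
  have "root 4 q ^ 4 < \<mu> ^ 4" using \<mu> q by (intro power_strict_mono) auto
  then have "max p (1 - p) < (\<mu>\<^sup>2)\<^sup>2" using q unfolding q_def by simp
  from C5_free_mass_recurrence[OF p this, where 'a = 'a] \<mu>0 obtain s where
    s: "\<And>V::'a set. finite V \<Longrightarrow> s \<le> card V \<Longrightarrow>
      w V \<le> (\<Sum>T\<in>{T. T \<subseteq> V \<and> T \<noteq> {} \<and> card T \<le> s}. \<Sum>\<A>\<in>Pow (Pow T).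
        ((\<mu>\<^sup>2) ^ card T) ^ card (V - T) * w (V - T))"
    unfolding w_def by auto
  define \<beta> where "\<beta> = \<eta> / \<mu>"
  have \<beta>: "\<beta> > 1" using \<mu> \<mu>0 unfolding \<beta>_def by simp
  define M where "M = (\<Sum>a\<le>s. 1 / \<eta> ^ (a\<^sup>2))"
  have M: "1 \<le> M * \<eta> ^ (a\<^sup>2)" if "a \<le> s" for a
  proof -
    have "1 / \<eta> ^ (a\<^sup>2) \<le> M" unfolding M_def using that \<eta> by (intro member_le_sum) auto
    then show ?thesis using \<eta> by (simp add: field_simps)
  qed
  have M0: "M \<ge> 0" unfolding M_def using \<eta> by (intro sum_nonneg) auto
  \<comment> \<open>All constants of one peeling round: the number of trace families, and the loss
    allowed for a peeled set of at most \<open>s\<close> vertices.\<close>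
  define K where "K = 2 ^ (2 ^ s) * M * \<beta> ^ s"
  have K0: "K \<ge> 0" unfolding K_def using M0 \<beta> by auto
  have "\<forall>\<^sub>F n in sequentially. K \<le> real n"
    using filterlim_real_sequentially unfolding filterlim_at_top by blast
  then have "\<forall>\<^sub>F n in sequentially. (real n + 1) ^ (s + 1) * K \<le> \<beta> ^ n"
    using eventually_polynomial_le_power[OF \<beta>, of "s + 2"]
  proof eventually_elim
    case (elim n)
    then have "(real n + 1) ^ (s + 1) * K \<le> (real n + 1) ^ (s + 1) * (real n + 1)"
      by (intro mult_left_mono) auto
    also have "\<dots> = (real n + 1) ^ (s + 2)" by simp
    finally show ?case using elim(2) by linarith
  qed
  then obtain n0 where n0: "\<And>n. n \<ge> n0 \<Longrightarrow> (real n + 1) ^ (s + 1) * K \<le> \<beta> ^ n"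
    by (auto simp: eventually_sequentially)
  \<comment> \<open>Chosen so that the claimed bound is at least 1, hence trivial, for all graphs
    too small for the recurrence or for the growth estimate.\<close>
  define C where "C = (\<Sum>a\<le>max n0 s. 1 / \<eta> ^ (a\<^sup>2))"
  have C0: "C > 0" unfolding C_def using \<eta> by (intro sum_pos) auto
  have "w V \<le> C * \<eta> ^ ((card V)\<^sup>2)" if "finite V" for V
    using that
  proof (induction "card V" arbitrary: V rule: less_induct)
    case less
    define n where "n = card V"
    show ?case
    proof (cases "n \<le> max n0 s")
      case True
      have "w V \<le> bernoulli_mass p ([V]\<^bsup>2\<^esup>) (Pow ([V]\<^bsup>2\<^esup>))"
        unfolding w_def using p less.prems
        by (intro bernoulli_mass_mono) (auto simp: C5_free_graphs_def finite_imp_finite_nsets)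
      also have "\<dots> = 1" using less.prems by (intro bernoulli_mass_Pow finite_imp_finite_nsets)
      also have "1 / \<eta> ^ (n\<^sup>2) \<le> C" unfolding C_def using True \<eta> by (intro member_le_sum) auto
      then have "1 \<le> C * \<eta> ^ (n\<^sup>2)" using \<eta> by (simp add: field_simps)
      finally show ?thesis unfolding n_def .
    next
      case False
      then have n: "n0 \<le> n" "s \<le> n" by auto
      \<comment> \<open>A common bound for all terms of the recurrence; the division by
        \<open>\<beta> ^ n\<close> is the gain from the cross term.\<close>
      define B where "B = C * M * \<beta> ^ s * \<eta> ^ (n\<^sup>2) / \<beta> ^ n"
      have B0: "B \<ge> 0" unfolding B_def using C0 M0 \<beta> \<eta> by auto
      define \<S> where "\<S> = {T. T \<subseteq> V \<and> T \<noteq> {} \<and> card T \<le> s}"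
      have term_le: "((\<mu>\<^sup>2) ^ card T) ^ card (V - T) * w (V - T) \<le> B" if T: "T \<in> \<S>" for T
      proof -
        have T': "T \<subseteq> V" "T \<noteq> {}" "card T \<le> s" "finite T"
          using T less.prems finite_subset unfolding \<S>_def by auto
        have cVT: "card (V - T) = n - card T" using T' by (simp add: card_Diff_subset n_def)
        have cT: "1 \<le> card T" using T' by (simp add: Suc_le_eq card_gt_0_iff)
        have "card (V - T) < card V" using cVT cT T' n less.prems card_mono[of V T] unfolding n_def by linarith
        then have "w (V - T) \<le> C * \<eta> ^ ((n - card T)\<^sup>2)"
          using less.hyps[of "V - T"] less.prems cVT by simp
        then have "((\<mu>\<^sup>2) ^ card T) ^ card (V - T) * w (V - T)
            \<le> ((\<mu>\<^sup>2) ^ card T) ^ card (V - T) * (C * \<eta> ^ ((n - card T)\<^sup>2))"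
          using \<mu>0 by (intro mult_left_mono) auto
        also have "\<dots> = C * ((\<mu> ^ (2 * card T)) ^ (n - card T) * \<eta> ^ ((n - card T)\<^sup>2) * \<beta> ^ n) / \<beta> ^ n"
          using \<beta> cVT by (simp add: power_mult)
        also have "\<dots> \<le> C * (M * \<beta> ^ s * \<eta> ^ (n\<^sup>2)) / \<beta> ^ n"
          using peeling_term_le[OF \<mu>0 \<mu>(2) cT T'(3) n(2) M[OF T'(3)] M0] C0 \<beta>
          unfolding \<beta>_def[symmetric] by (intro divide_right_mono mult_left_mono) auto
        finally show ?thesis unfolding B_def by (simp add: mult.assoc)
      qed
      have "w V \<le> (\<Sum>T\<in>\<S>. \<Sum>\<A>\<in>Pow (Pow T). ((\<mu>\<^sup>2) ^ card T) ^ card (V - T) * w (V - T))"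
        using s[OF less.prems] n unfolding n_def \<S>_def by blast
      also have "\<dots> \<le> (\<Sum>T\<in>\<S>. 2 ^ (2 ^ s) * B)"
      proof (rule sum_mono)
        fix T assume T: "T \<in> \<S>"
        then have T': "finite T" "card T \<le> s" using less.prems finite_subset unfolding \<S>_def by auto
        have "(\<Sum>\<A>\<in>Pow (Pow T). ((\<mu>\<^sup>2) ^ card T) ^ card (V - T) * w (V - T))
            = 2 ^ (2 ^ card T) * (((\<mu>\<^sup>2) ^ card T) ^ card (V - T) * w (V - T))"
          using T' by (simp add: card_Pow)
        also have "\<dots> \<le> 2 ^ (2 ^ card T) * B" using term_le[OF T] by (intro mult_left_mono) auto
        also have "\<dots> \<le> 2 ^ (2 ^ s) * B"
          using T' B0 by (intro mult_right_mono power_increasing) auto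
        finally show "(\<Sum>\<A>\<in>Pow (Pow T). ((\<mu>\<^sup>2) ^ card T) ^ card (V - T) * w (V - T)) \<le> 2 ^ (2 ^ s) * B" .
      qed
      also have "\<dots> = real (card \<S>) * (2 ^ (2 ^ s) * B)" by simp
      also have "\<dots> \<le> (real n + 1) ^ (s + 1) * (2 ^ (2 ^ s) * B)"
      proof (rule mult_right_mono)
        have "card \<S> \<le> card {T. T \<subseteq> V \<and> card T < s + 1}"
          unfolding \<S>_def using less.prems by (intro card_mono) auto
        also have "\<dots> \<le> (n + 1) ^ (s + 1)"
          unfolding n_def by (rule card_small_subsets_le[OF less.prems])
        finally have "real (card \<S>) \<le> real ((n + 1) ^ (s + 1))" by (rule of_nat_mono)
        then show "real (card \<S>) \<le> (real n + 1) ^ (s + 1)"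
          by (simp only: of_nat_power of_nat_add of_nat_1)
      qed (use B0 in auto)
      also have "\<dots> = (real n + 1) ^ (s + 1) * K / \<beta> ^ n * (C * \<eta> ^ (n\<^sup>2))"
        unfolding B_def K_def by simp
      also have "\<dots> \<le> 1 * (C * \<eta> ^ (n\<^sup>2))"
        using n0[OF n(1)] \<beta> C0 \<eta> by (intro mult_right_mono) (auto simp: divide_le_eq_1)
      finally show ?thesis unfolding n_def by simp
    qed
  qed
  then show ?thesis using C0 unfolding w_def by blast
qed

subsection \<open>Generalised split graphs are perfect\<close>

lemma clique_number_attained:
  assumes "finite W"
  obtains K where "K \<subseteq> W" "clique K E" "card K = clique_number W E"
proof -
  have "finite {card K | K. K \<subseteq> W \<and> clique K E}" using assms by simp
  moreover have "{card K | K. K \<subseteq> W \<and> clique K E} \<noteq> {}"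
    by (auto intro!: exI[of _ "{}"])
  ultimately have "clique_number W E \<in> {card K | K. K \<subseteq> W \<and> clique K E}"
    unfolding clique_number_def by (rule Max_in)
  then show thesis using that by auto
qed

lemma card_clique_le:
  assumes "finite W" "K \<subseteq> W" "clique K E"
  shows "card K \<le> clique_number W E"
  unfolding clique_number_def using assms by (intro Max_ge) auto

lemma clique_number_le_colours:
  assumes "finite W" "proper_colouring W E k f"
  shows "clique_number W E \<le> k"
proof -
  obtain K where K: "K \<subseteq> W" "clique K E" "card K = clique_number W E"
    using clique_number_attained[OF assms(1)] .
  have "inj_on f K"
    using K assms(2) unfolding inj_on_def clique_def proper_colouring_def by blast
  then have "card K = card (f ` K)" by (simp add: card_image)
  also have "\<dots> \<le> card {..<k}"
    using K assms(2) unfolding proper_colouring_def by (intro card_mono) auto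
  finally show ?thesis using K by simp
qed

lemma chromatic_eq_clique_numberI:
  assumes "finite W" "proper_colouring W E (clique_number W E) f"
  shows "chromatic_number W E = clique_number W E"
  unfolding chromatic_number_def
  using assms clique_number_le_colours by (intro Least_equality) blast+

text \<open>
  After colouring \<open>A\<close> injectively, each part is coloured by Hall's theorem with the colours as
  right-hand side; Hall's condition for \<open>S\<close> says that \<open>S\<close> and its common neighbours in \<open>A\<close> form
  a clique.
\<close>

lemma chromatic_eq_clique_number_clique_partition:
  fixes g :: "'a \<Rightarrow> 'b"
  assumes fin: "finite W" and A: "A \<subseteq> W" "clique A E"
    and g: "\<And>x y. x \<in> W - A \<Longrightarrow> y \<in> W - A \<Longrightarrow> x \<noteq> y \<Longrightarrow> {x, y} \<in> E \<longleftrightarrow> g x = g y"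
    and irrefl: "\<And>x. {x} \<notin> E"
  shows "chromatic_number W E = clique_number W E"
proof -
  define \<omega> where "\<omega> = clique_number W E"
  have finA: "finite A" using A fin finite_subset by blast
  obtain a where a: "bij_betw a A {..<card A}"
    using ex_bij_betw_finite_nat[OF finA] atLeast0LessThan by metis
  have aA: "a x < card A" if "x \<in> A" for x using a that by (auto simp: bij_betw_def)
  have A\<omega>: "card A \<le> \<omega>" unfolding \<omega>_def using card_clique_le[OF fin A] .
  define N where "N x = {c. c < \<omega> \<and> (\<forall>y\<in>A. a y = c \<longrightarrow> {x, y} \<notin> E)}" for x
  \<comment> \<open>Different classes of \<open>g\<close> span no edges, so each class is matched on
    its own and colours may be reused between classes. Colours in \<open>N x\<close> are those that
    no neighbour of \<open>x\<close> in \<open>A\<close> bears.\<close>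
  have "\<forall>i. \<exists>f. inj_on f {x \<in> W - A. g x = i} \<and> (\<forall>x\<in>{x \<in> W - A. g x = i}. f x \<in> N x)"
  proof (rule allI, rule hall_marriage)
    fix i
    show "finite {x \<in> W - A. g x = i}" using fin by simp
    show "finite (N x)" for x unfolding N_def by simp
    fix S assume S: "S \<subseteq> {x \<in> W - A. g x = i}"
    show "card S \<le> card (\<Union>x\<in>S. N x)"
    proof -
      define Z where "Z = {y \<in> A. \<forall>x\<in>S. {x, y} \<in> E}"
      have "S \<subseteq> W" using S by blast
      then have finS: "finite S" using fin finite_subset by blast
      have "clique (S \<union> Z) E"
      proof (rule clique_Un)
        show "clique S E" using S g unfolding clique_def by blast
        show "clique Z E" using A(2) unfolding Z_def clique_def by blast
        show "\<forall>v\<in>S. \<forall>w\<in>Z. v \<noteq> w \<longrightarrow> {v, w} \<in> E" unfolding Z_def by blast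
      qed
      then have "card (S \<union> Z) \<le> \<omega>"
        unfolding \<omega>_def using S A(1) by (intro card_clique_le fin) (auto simp: Z_def)
      moreover have "S \<inter> Z = {}" "finite Z" using S finA unfolding Z_def by auto
      ultimately have SZ: "card S + card Z \<le> \<omega>" using finS by (simp add: card_Un_disjoint)
      have "a ` Z \<subseteq> {..<\<omega>}" using aA A\<omega> unfolding Z_def by fastforce
      have "card (a ` Z) = card Z"
        using a unfolding Z_def by (intro card_image) (auto simp: bij_betw_def inj_on_def)
      have "{..<\<omega>} - a ` Z \<subseteq> (\<Union>x\<in>S. N x)" if "S \<noteq> {}"
      proof
        fix c assume c: "c \<in> {..<\<omega>} - a ` Z"
        show "c \<in> (\<Union>x\<in>S. N x)"
        proof (cases "c < card A")
          case True
          then have "c \<in> a ` A" using a by (simp add: bij_betw_def)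
          then obtain y where y: "y \<in> A" "a y = c" by blast
          then have "y \<notin> Z" using c by auto
          then obtain x where x: "x \<in> S" "{x, y} \<notin> E" using y unfolding Z_def by auto
          have "y' = y" if "y' \<in> A" "a y' = c" for y'
            using a y that by (auto simp: bij_betw_def inj_on_def)
          then have "c \<in> N x" using x c unfolding N_def by auto
          then show ?thesis using x by blast
        next
          case False
          then have "c \<in> N x" for x using c aA unfolding N_def by auto
          then show ?thesis using \<open>S \<noteq> {}\<close> by blast
        qed
      qed
      moreover have "finite (\<Union>x\<in>S. N x)" using finS unfolding N_def by auto
      ultimately have "S \<noteq> {} \<Longrightarrow> card ({..<\<omega>} - a ` Z) \<le> card (\<Union>x\<in>S. N x)"
        by (intro card_mono) auto
      moreover have "card ({..<\<omega>} - a ` Z) = \<omega> - card Z"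
        using \<open>a ` Z \<subseteq> {..<\<omega>}\<close> \<open>card (a ` Z) = card Z\<close> \<open>finite Z\<close> by (simp add: card_Diff_subset)
      ultimately show ?thesis using SZ by (cases "S = {}") auto
    qed
  qed
  from choice[OF this] obtain f where f0:
    "\<forall>i. inj_on (f i) {x \<in> W - A. g x = i} \<and> (\<forall>x\<in>{x \<in> W - A. g x = i}. f i x \<in> N x)" ..
  then have f: "inj_on (f i) {x \<in> W - A. g x = i}" "x \<in> W - A \<Longrightarrow> g x = i \<Longrightarrow> f i x \<in> N x" for i x
    by simp_all
  define col where "col x = (if x \<in> A then a x else f (g x) x)" for x
  have "proper_colouring W E \<omega> col"
    unfolding proper_colouring_def
  proof (intro conjI ballI impI)
    show "col ` W \<subseteq> {..<\<omega>}"
    proof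
      fix c assume "c \<in> col ` W"
      then obtain x where x: "x \<in> W" "c = col x" by blast
      show "c \<in> {..<\<omega>}"
        using aA[of x] A\<omega> f(2)[of x "g x"] x unfolding col_def N_def by auto
    qed
    fix x y assume xy: "x \<in> W" "y \<in> W" "{x, y} \<in> E"
    then have "x \<noteq> y" using irrefl by auto
    have cross: "a y \<noteq> f (g x) x" if "x \<in> W - A" "y \<in> A" "{x, y} \<in> E" for x y
      using f(2)[of x "g x"] that unfolding N_def by auto
    consider "x \<in> A" "y \<in> A" | "x \<in> A" "y \<notin> A" | "x \<notin> A" "y \<in> A" | "x \<notin> A" "y \<notin> A" by blast
    then show "col x \<noteq> col y"
    proof cases
      case 1
      then show ?thesis using a \<open>x \<noteq> y\<close> unfolding col_def by (auto simp: bij_betw_def inj_on_def)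
    next
      case 2
      then show ?thesis using cross[of y x] xy unfolding col_def by (simp add: insert_commute)
    next
      case 3
      then show ?thesis using cross[of x y] xy unfolding col_def by auto
    next
      case 4
      then have "g x = g y" using g[of x y] xy \<open>x \<noteq> y\<close> by blast
      then show ?thesis using f(1)[of "g x"] 4 xy \<open>x \<noteq> y\<close> unfolding col_def by (auto simp: inj_on_def)
    qed
  qed
  then show ?thesis unfolding \<omega>_def by (rule chromatic_eq_clique_numberI[OF fin])
qed

text \<open>Outside \<open>A\<close> the graph is complete multipartite, and each class receives one
  colour. A vertex of \<open>A\<close> without neighbours in some class borrows its colour, which is
  harmless inside the independent set \<open>A\<close>. The remaining vertices of \<open>A\<close>
  share one extra colour; if there are any, such a vertex and one neighbour from each class form a
  clique that pays for it.\<close>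

lemma chromatic_eq_clique_number_multipartite:
  fixes g :: "'a \<Rightarrow> 'b"
  assumes fin: "finite W" and A: "A \<subseteq> W" "indep A E"
    and g: "\<And>x y. x \<in> W - A \<Longrightarrow> y \<in> W - A \<Longrightarrow> x \<noteq> y \<Longrightarrow> {x, y} \<in> E \<longleftrightarrow> g x \<noteq> g y"
    and irrefl: "\<And>x. {x} \<notin> E"
  shows "chromatic_number W E = clique_number W E"
proof -
  define I where "I = g ` (W - A)"
  have finI: "finite I" unfolding I_def using fin by simp
  obtain b where b: "bij_betw b I {..<card I}"
    using ex_bij_betw_finite_nat[OF finI] atLeast0LessThan by metis
  have bI: "b i < card I" if "i \<in> I" for i using b that by (auto simp: bij_betw_def)
  have binj: "b i = b j \<longleftrightarrow> i = j" if "i \<in> I" "j \<in> I" for i j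
    using b that by (auto simp: bij_betw_def inj_on_def)
  define \<omega> where "\<omega> = clique_number W E"
  have transversal: "card I \<le> card (r ` I) \<and> clique (r ` I) E" if r: "\<And>i. i \<in> I \<Longrightarrow> r i \<in> W - A \<and> g (r i) = i" for r
  proof -
    have "inj_on r I" using r by (metis inj_onI)
    moreover have "clique (r ` I) E" unfolding clique_def using r g by auto
    ultimately show ?thesis by (simp add: card_image)
  qed
  define miss where "miss x i \<longleftrightarrow> i \<in> I \<and> (\<forall>y\<in>W - A. g y = i \<longrightarrow> {x, y} \<notin> E)" for x i
  define col where "col x = (if x \<in> A then (if \<exists>i. miss x i then b (SOME i. miss x i) else card I) else b (g x))" for x
  define full where "full \<longleftrightarrow> (\<exists>x\<in>A. \<forall>i. \<not> miss x i)"
  have \<omega>: "card I + (if full then 1 else 0) \<le> \<omega>"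
  proof (cases full)
    case True
    then obtain x where x: "x \<in> A" "\<forall>i. \<not> miss x i" unfolding full_def by blast
    then have "\<exists>y. y \<in> W - A \<and> g y = i \<and> {x, y} \<in> E" if "i \<in> I" for i
      using that unfolding miss_def by blast
    then obtain r where r: "\<And>i. i \<in> I \<Longrightarrow> r i \<in> W - A \<and> g (r i) = i \<and> {x, r i} \<in> E" by metis
    have rI: "card I \<le> card (r ` I)" "clique (r ` I) E" using transversal[of r] r by blast+
    have "clique (insert x (r ` I)) E"
      using rI(2) r unfolding clique_def by (auto simp: insert_commute)
    then have "card (insert x (r ` I)) \<le> \<omega>"
      unfolding \<omega>_def using x A r by (intro card_clique_le fin) auto
    moreover have "x \<notin> r ` I" using x r by auto
    ultimately show ?thesis using rI finI True by simp
  next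
    case False
    have "\<exists>y. y \<in> W - A \<and> g y = i" if "i \<in> I" for i using that unfolding I_def by blast
    then obtain r where r: "\<And>i. i \<in> I \<Longrightarrow> r i \<in> W - A \<and> g (r i) = i" by metis
    have "card (r ` I) \<le> \<omega>"
      unfolding \<omega>_def using transversal[of r] r by (intro card_clique_le fin) auto
    then show ?thesis using transversal[of r] r False by fastforce
  qed
  have some: "miss x (SOME i. miss x i)" if "\<exists>i. miss x i" for x using that by (rule someI_ex)
  have gI: "g x \<in> I" if "x \<in> W - A" for x using that unfolding I_def by blast
  have colA: "col x = b (g y) \<Longrightarrow> {x, y} \<notin> E" if "x \<in> A" "y \<in> W - A" for x y
  proof (cases "\<exists>i. miss x i")
    case True
    assume "col x = b (g y)"
    then have "b (SOME i. miss x i) = b (g y)" using True that unfolding col_def by simp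
    then have "(SOME i. miss x i) = g y"
      using some[OF True] gI[OF that(2)] binj unfolding miss_def by blast
    then show ?thesis using some[OF True] that unfolding miss_def by auto
  next
    case False
    assume "col x = b (g y)"
    then have "card I = b (g y)" using False that unfolding col_def by simp
    then show ?thesis using bI[OF gI[OF that(2)]] by simp
  qed
  have "proper_colouring W E \<omega> col"
    unfolding proper_colouring_def
  proof (intro conjI ballI impI)
    show "col ` W \<subseteq> {..<\<omega>}"
    proof
      fix c assume "c \<in> col ` W"
      then obtain x where x: "x \<in> W" "c = col x" by blast
      show "c \<in> {..<\<omega>}"
      proof (cases "x \<in> A")
        case True
        show ?thesis
        proof (cases "\<exists>i. miss x i")
          case ex: True
          then have "(SOME i. miss x i) \<in> I" using some unfolding miss_def by blast
          then have "b (SOME i. miss x i) < card I" by (rule bI)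
          then show ?thesis using True ex x \<omega> unfolding col_def by simp
        next
          case False
          then have full using True unfolding full_def by blast
          moreover have "col x = card I" unfolding col_def using True False by auto
          ultimately show ?thesis using x \<omega> by simp
        qed
      next
        case False
        then show ?thesis using x bI[OF gI, of x] \<omega> unfolding col_def by simp
      qed
    qed
    fix x y assume xy: "x \<in> W" "y \<in> W" "{x, y} \<in> E"
    then have "x \<noteq> y" using irrefl by auto
    consider "x \<in> A" "y \<in> A" | "x \<in> A" "y \<notin> A" | "x \<notin> A" "y \<in> A" | "x \<notin> A" "y \<notin> A" by blast
    then show "col x \<noteq> col y"
    proof cases
      case 1
      then show ?thesis using A(2) xy \<open>x \<noteq> y\<close> unfolding indep_def by blast
    next
      case 2
      then show ?thesis using colA[of x y] xy unfolding col_def[of y] by auto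
    next
      case 3
      then show ?thesis using colA[of y x] xy unfolding col_def[of x] by (auto simp: insert_commute)
    next
      case 4
      then have "g x \<noteq> g y" using g[of x y] xy \<open>x \<noteq> y\<close> by blast
      then show ?thesis using 4 xy binj gI unfolding col_def by auto
    qed
  qed
  then show ?thesis unfolding \<omega>_def by (rule chromatic_eq_clique_numberI[OF fin])
qed

text \<open>Replacing the numbered parts by a clique and a labelling gives a form that restricts to
  induced subgraphs without renumbering parts that become empty.\<close>

lemma generalised_clique_partitionE:
  assumes "admits_generalised_clique_partition V E"
  obtains A and g :: "'a \<Rightarrow> nat" where "A \<subseteq> V" "clique A E"
    "\<And>x y. x \<in> V - A \<Longrightarrow> y \<in> V - A \<Longrightarrow> x \<noteq> y \<Longrightarrow> {x, y} \<in> E \<longleftrightarrow> g x = g y"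
proof -
  obtain k P where "generalised_clique_partition V E k P"
    using assms unfolding admits_generalised_clique_partition_def by blast
  then have P: "(\<Union>i\<in>{1..k}. P i) = V" "\<And>i. i \<in> {1..k} \<Longrightarrow> clique (P i) E"
    and noE: "\<And>i j x y. i \<in> {1..k} \<Longrightarrow> j \<in> {1..k} \<Longrightarrow> i > j \<Longrightarrow> j > 1 \<Longrightarrow> x \<in> P i \<Longrightarrow> y \<in> P j \<Longrightarrow> {x, y} \<notin> E"
    unfolding generalised_clique_partition_def by blast+
  \<comment> \<open>For \<open>k = 0\<close> the vertex set is empty and \<open>P 1\<close> is
    unconstrained.\<close>
  define A where "A = (if k \<ge> 1 then P 1 else {})"
  have "\<exists>i. i \<in> {2..k} \<and> x \<in> P i" if x: "x \<in> V - A" for x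
  proof -
    obtain i where i: "i \<in> {1..k}" "x \<in> P i" using x P(1) by blast
    then have "i \<noteq> 1" using x unfolding A_def by auto
    then show ?thesis using i by (intro exI[of _ i]) auto
  qed
  then obtain g where g: "\<And>x. x \<in> V - A \<Longrightarrow> g x \<in> {2..k} \<and> x \<in> P (g x)" by metis
  show thesis
  proof (rule that)
    show "A \<subseteq> V" "clique A E" using P unfolding A_def by (auto simp: clique_def)
    fix x y assume xy: "x \<in> V - A" "y \<in> V - A" "x \<noteq> y"
    note gx = g[OF xy(1)] and gy = g[OF xy(2)]
    have "{x, y} \<in> E" if "g x = g y"
      using P(2)[of "g x"] gx gy xy(3) that unfolding clique_def by auto
    moreover have "{x, y} \<notin> E" if "g x > g y"
      using noE[of "g x" "g y" x y] gx gy that by auto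
    moreover have "{x, y} \<notin> E" if "g y > g x"
      using noE[of "g y" "g x" y x] gx gy that by (auto simp: insert_commute)
    ultimately show "{x, y} \<in> E \<longleftrightarrow> g x = g y" by (meson nat_neq_iff)
  qed
qed

text \<open>Both forms restrict to any \<open>W\<close> by intersecting \<open>A\<close> with it. A
  partition of the complement makes \<open>A\<close> independent and the rest complete multipartite,
  so it is coloured by the second of the two lemmas above.\<close>

lemma generalised_split_graph_perfect:
  assumes fin: "finite V" and E: "E \<subseteq> [V]\<^bsup>2\<^esup>" and split: "generalised_split_graph V E"
  shows "perfect_graph V E"
  unfolding perfect_graph_def
proof (intro allI impI)
  fix W assume W: "W \<subseteq> V"
  have finW: "finite W" using W fin finite_subset by blast
  have irrefl: "{x} \<notin> induced_edges W E" for x using E unfolding induced_edges_def nsets_def by auto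
  have ind: "{x, y} \<in> induced_edges W E \<longleftrightarrow> {x, y} \<in> E" if "x \<in> W" "y \<in> W" for x y
    using that unfolding induced_edges_def by auto
  have compl: "{x, y} \<in> complement_edges V E \<longleftrightarrow> {x, y} \<notin> E" if "x \<in> V" "y \<in> V" "x \<noteq> y" for x y
    using that unfolding complement_edges_def by auto
  show "chromatic_number W (induced_edges W E) = clique_number W (induced_edges W E)"
    using split unfolding generalised_split_graph_def
  proof
    assume "admits_generalised_clique_partition V E"
    then obtain A and g :: "'a \<Rightarrow> nat" where A: "A \<subseteq> V" "clique A E"
      "\<And>x y. x \<in> V - A \<Longrightarrow> y \<in> V - A \<Longrightarrow> x \<noteq> y \<Longrightarrow> {x, y} \<in> E \<longleftrightarrow> g x = g y"
      by (rule generalised_clique_partitionE) blast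
    show ?thesis
    proof (rule chromatic_eq_clique_number_clique_partition[where A = "A \<inter> W" and g = g])
      show "clique (A \<inter> W) (induced_edges W E)" using A(2) ind unfolding clique_def by auto
      fix x y assume xy: "x \<in> W - A \<inter> W" "y \<in> W - A \<inter> W" "x \<noteq> y"
      then show "{x, y} \<in> induced_edges W E \<longleftrightarrow> g x = g y" using A(3)[of x y] ind[of x y] W by auto
    qed (use finW irrefl in auto)
  next
    assume "admits_generalised_clique_partition V (complement_edges V E)"
    then obtain A and g :: "'a \<Rightarrow> nat" where A: "A \<subseteq> V" "clique A (complement_edges V E)"
      "\<And>x y. x \<in> V - A \<Longrightarrow> y \<in> V - A \<Longrightarrow> x \<noteq> y \<Longrightarrow> {x, y} \<in> complement_edges V E \<longleftrightarrow> g x = g y"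
      by (rule generalised_clique_partitionE) blast
    show ?thesis
    proof (rule chromatic_eq_clique_number_multipartite[where A = "A \<inter> W" and g = g])
      show "indep (A \<inter> W) (induced_edges W E)"
        unfolding indep_def
      proof (intro ballI impI)
        fix x y assume xy: "x \<in> A \<inter> W" "y \<in> A \<inter> W" "x \<noteq> y"
        then have "{x, y} \<in> complement_edges V E" using A(2) unfolding clique_def by auto
        then show "{x, y} \<notin> induced_edges W E"
          unfolding complement_edges_def induced_edges_def by auto
      qed
      fix x y assume xy: "x \<in> W - A \<inter> W" "y \<in> W - A \<inter> W" "x \<noteq> y"
      then show "{x, y} \<in> induced_edges W E \<longleftrightarrow> g x \<noteq> g y"
        using A(3)[of x y] ind[of x y] compl[of x y] W by auto
    qed (use finW irrefl in auto)
  qed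
qed

subsection \<open>Perfect graphs contain no induced five-cycle\<close>

text \<open>The five-cycle has no triangle, but as an odd cycle it has no proper colouring with two
  colours.\<close>

lemma perfect_graph_C5_free:
  assumes fin: "finite V" and E: "E \<subseteq> [V]\<^bsup>2\<^esup>" and perfect: "perfect_graph V E"
  shows "\<not> contains_induced C5_vertices C5_edges V E"
proof
  assume "contains_induced C5_vertices C5_edges V E"
  then obtain f where f: "inj_on f C5_vertices" "f ` C5_vertices \<subseteq> V"
    "\<And>x y. x \<in> C5_vertices \<Longrightarrow> y \<in> C5_vertices \<Longrightarrow> {f x, f y} \<in> E \<longleftrightarrow> {x, y} \<in> C5_edges"
    unfolding contains_induced_def by blast
  define W where "W = f ` C5_vertices"
  define F where "F = induced_edges W E"
  have finW: "finite W" unfolding W_def C5_vertices_def by simp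
  have F: "{f x, f y} \<in> F \<longleftrightarrow> {x, y} \<in> C5_edges" if "x \<in> C5_vertices" "y \<in> C5_vertices" for x y
    using f(3) that unfolding F_def induced_edges_def W_def by auto
  have \<omega>: "clique_number W F \<le> 2"
  proof -
    obtain K where K: "K \<subseteq> W" "clique K F" "card K = clique_number W F"
      using clique_number_attained[OF finW] .
    obtain L where L: "L \<subseteq> C5_vertices" "K = f ` L" using K(1) unfolding W_def by (meson subset_imageE)
    have cL: "card K = card L" using L f(1) by (metis card_image inj_on_subset)
    have LE: "{x, y} \<in> C5_edges" if "x \<in> L" "y \<in> L" "x \<noteq> y" for x y
    proof -
      have "f x \<noteq> f y" using f(1) L that by (meson inj_on_def subsetD)
      then show ?thesis using K(2) F[of x y] L that unfolding clique_def by blast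
    qed
    have nonedges: "\<not> (0 \<in> L \<and> 2 \<in> L)" "\<not> (1 \<in> L \<and> 3 \<in> L)" "\<not> (2 \<in> L \<and> 4 \<in> L)"
      "\<not> (3 \<in> L \<and> 0 \<in> L)" "\<not> (4 \<in> L \<and> 1 \<in> L)"
      using LE[of 0 2] LE[of 1 3] LE[of 2 4] LE[of 3 0] LE[of 4 1]
      by (auto simp: C5_edges_eq doubleton_eq_iff)
    have "L \<in> Pow {0, 1, 2, 3, 4}" using L(1) unfolding C5_vertices_eq by simp
    then have "card L \<le> 2" using nonedges by (auto simp: Pow_insert)
    then show ?thesis using K(3) cL by simp
  qed
  have "\<exists>h. proper_colouring W F (chromatic_number W F) h"
  proof -
    obtain b where b: "inj_on b W" "b ` W = {0..<card W}"
      using ex_bij_betw_finite_nat[OF finW] by (auto simp: bij_betw_def)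
    have "proper_colouring W F (card W) b"
      unfolding proper_colouring_def
    proof (intro conjI ballI impI)
      fix x y assume xy: "x \<in> W" "y \<in> W" "{x, y} \<in> F"
      then have "x \<noteq> y" using E unfolding F_def induced_edges_def nsets_def by auto
      then show "b x \<noteq> b y" using b xy by (auto simp: inj_on_def)
    qed (use b in auto)
    then show ?thesis
      unfolding chromatic_number_def using LeastI_ex[of "\<lambda>k. \<exists>f. proper_colouring W F k f"] by blast
  qed
  then obtain h where h0: "proper_colouring W F (chromatic_number W F) h" ..
  have "chromatic_number W F = clique_number W F"
    using perfect f(2) unfolding perfect_graph_def W_def F_def by blast
  then have "{..<chromatic_number W F} \<subseteq> {..<2}" using \<omega> by simp
  then have h: "h ` W \<subseteq> {..<2}" "\<And>x y. x \<in> W \<Longrightarrow> y \<in> W \<Longrightarrow> {x, y} \<in> F \<Longrightarrow> h x \<noteq> h y"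
    using h0 unfolding proper_colouring_def by (meson order_trans, blast)
  have two: "h (f i) = 0 \<or> h (f i) = 1" if "i \<in> C5_vertices" for i
  proof -
    have "h (f i) \<in> {..<2}" using h(1) that unfolding W_def by blast
    then show ?thesis by auto
  qed
  have ne: "h (f i) \<noteq> h (f j)" if "i \<in> C5_vertices" "j \<in> C5_vertices" "{i, j} \<in> C5_edges" for i j
    using h(2) F that unfolding W_def by blast
  have "h (f 0) \<noteq> h (f 1)" "h (f 1) \<noteq> h (f 2)" "h (f 2) \<noteq> h (f 3)" "h (f 3) \<noteq> h (f 4)" "h (f 4) \<noteq> h (f 0)"
    by (intro ne; simp add: C5_vertices_eq C5_edges_eq)+
  moreover have "h (f 0) = 0 \<or> h (f 0) = 1" "h (f 1) = 0 \<or> h (f 1) = 1" "h (f 2) = 0 \<or> h (f 2) = 1"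
    "h (f 3) = 0 \<or> h (f 3) = 1" "h (f 4) = 0 \<or> h (f 4) = 1"
    by (intro two; simp add: C5_vertices_eq)+
  ultimately show False by metis
qed

subsection \<open>Asymptotics of edge counts\<close>

lemma real_choose_two: "real (n choose 2) = real n * (real n - 1) / 2"
proof -
  have "even (n * (n - 1))" by (cases n) auto
  then have "real (n choose 2) = real (n * (n - 1)) / 2"
    unfolding choose_two by (simp add: real_of_nat_div)
  then show ?thesis by (cases n) (auto simp: algebra_simps)
qed

lemma tendsto_choose_two_ratio:
  assumes "(\<lambda>n. real (x n) / real n) \<longlonglongrightarrow> \<beta>"
  shows "(\<lambda>n. real (x n choose 2) / real (n choose 2)) \<longlonglongrightarrow> \<beta>\<^sup>2"
proof -
  have 1: "(\<lambda>n. real n / (real n - 1)) \<longlonglongrightarrow> 1" and 2: "(\<lambda>n. 1 / real n) \<longlonglongrightarrow> 0" by real_asymp+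
  have "(\<lambda>n. (real (x n) / real n) * (real (x n) / real n - 1 / real n) * (real n / (real n - 1)))
      \<longlonglongrightarrow> \<beta> * (\<beta> - 0) * 1"
    by (intro tendsto_intros assms 1 2)
  moreover have "\<forall>\<^sub>F n in sequentially.
      (real (x n) / real n) * (real (x n) / real n - 1 / real n) * (real n / (real n - 1))
      = real (x n choose 2) / real (n choose 2)"
    using eventually_gt_at_top[of 1]
    by eventually_elim (simp add: real_choose_two field_simps)
  ultimately show ?thesis by (simp add: tendsto_cong power2_eq_square)
qed

lemma edge_count_rounding_tendsto:
  assumes "edge_count_rounding c m"
  shows "(\<lambda>n. real (m n) / real (n choose 2)) \<longlonglongrightarrow> c"
proof -
  have lim: "(\<lambda>n. 1 / real (n choose 2)) \<longlonglongrightarrow> 0" unfolding real_choose_two by real_asymp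
  have "\<bar>real (m n) - c * real (n choose 2)\<bar> \<le> 1" for n
  proof -
    have "int (m n) = \<lfloor>c * real (n choose 2)\<rfloor> \<or> int (m n) = \<lceil>c * real (n choose 2)\<rceil>"
      using assms unfolding edge_count_rounding_def by blast
    then show ?thesis by linarith
  qed
  then have "\<forall>\<^sub>F n in sequentially. norm (real (m n) / real (n choose 2) - c) \<le> 1 / real (n choose 2)"
  proof (intro eventually_sequentiallyI[of 2])
    fix n :: nat assume "2 \<le> n"
    then have pos: "real (n choose 2) > 0" by (simp add: zero_less_binomial)
    then have "real (m n) / real (n choose 2) - c = (real (m n) - c * real (n choose 2)) / real (n choose 2)"
      by (simp add: diff_divide_distrib)
    then have "\<bar>real (m n) / real (n choose 2) - c\<bar> = \<bar>real (m n) - c * real (n choose 2)\<bar> / real (n choose 2)"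
      using pos by simp
    also assume "\<And>n. \<bar>real (m n) - c * real (n choose 2)\<bar> \<le> 1"
    then have "\<bar>real (m n) - c * real (n choose 2)\<bar> / real (n choose 2) \<le> 1 / real (n choose 2)"
      using pos by (intro divide_right_mono) auto
    finally show "norm (real (m n) / real (n choose 2) - c) \<le> 1 / real (n choose 2)" by simp
  qed
  from Lim_null_comparison[OF this lim] show ?thesis by (rule LIM_zero_cancel)
qed

lemma edge_count_rounding_le:
  assumes "edge_count_rounding c m" "c < 1"
  shows "m n \<le> n choose 2"
proof -
  have "int (m n) = \<lfloor>c * real (n choose 2)\<rfloor> \<or> int (m n) = \<lceil>c * real (n choose 2)\<rceil>"
    using assms(1) unfolding edge_count_rounding_def by blast
  moreover have "c * real (n choose 2) \<le> 1 * real (n choose 2)"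
    using assms(2) by (intro mult_right_mono) auto
  then have "\<lceil>c * real (n choose 2)\<rceil> \<le> int (n choose 2)" by (simp add: ceiling_le_iff)
  moreover have "\<lfloor>c * real (n choose 2)\<rfloor> \<le> \<lceil>c * real (n choose 2)\<rceil>" by linarith
  ultimately show ?thesis by linarith
qed

subsection \<open>The upper bound\<close>

lemma finite_induced_C5_free_graphs: "finite (induced_C5_free_graphs n m)"
  by (rule finite_subset[of _ "Pow ([{1..n}]\<^bsup>2\<^esup>)"])
     (auto simp: induced_C5_free_graphs_def graphs_with_edges_def finite_imp_finite_nsets)

text \<open>All graphs with \<open>m\<close> edges have the same weight, so the left-hand side is
  the mass of a subfamily of the graphs without an induced five-cycle.\<close>

lemma card_induced_C5_free_le_mass:
  assumes "0 < p" "p < 1"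
  shows "real (card (induced_C5_free_graphs n m)) * (p ^ m * (1 - p) ^ ((n choose 2) - m))
    \<le> bernoulli_mass p ([{1..n}]\<^bsup>2\<^esup>) (C5_free_graphs {1..n})"
proof -
  let ?D = "[{1..n}]\<^bsup>2\<^esup>"
  have fin: "finite ?D" by (simp add: finite_imp_finite_nsets)
  have "bernoulli_weight p ?D E = p ^ m * (1 - p) ^ ((n choose 2) - m)"
    if "E \<in> induced_C5_free_graphs n m" for E
    using that bernoulli_weight_card[OF fin, of E p]
    unfolding induced_C5_free_graphs_def graphs_with_edges_def by auto
  then have "real (card (induced_C5_free_graphs n m)) * (p ^ m * (1 - p) ^ ((n choose 2) - m))
      = bernoulli_mass p ?D (induced_C5_free_graphs n m)"
    unfolding bernoulli_mass_def by simp
  also have "\<dots> \<le> bernoulli_mass p ?D (C5_free_graphs {1..n})"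
    using assms finite_C5_free_graphs[of "{1..n}"]
    by (intro bernoulli_mass_mono)
       (auto simp: induced_C5_free_graphs_def graphs_with_edges_def C5_free_graphs_def)
  finally show ?thesis .
qed

text \<open>The expression is the exponent, per pair of vertices, of the mass bound divided by the
  weight of one graph. While \<open>p \<le> 1/2\<close> it equals
  \<open>- c * log 2 p - (1/2 - c) * log 2 (1 - p)\<close>, which is minimal at
  \<open>p = 2 * c\<close> if \<open>c < 1/4\<close>; by symmetry the minimum is at
  \<open>2 * c - 1\<close> if \<open>c > 3/4\<close>. In between, the minimum sits at the kink
  \<open>p = 1/2\<close>.\<close>

lemma entropy_density_tilt:
  assumes "0 < c" "c < 1"
  obtains p where "0 < p" "p < 1"
    "log 2 (max p (1 - p)) / 2 - c * log 2 p - (1 - c) * log 2 (1 - p) = entropy_density c"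
proof -
  consider "c < 1/4" | "1/4 \<le> c" "c \<le> 3/4" | "c > 3/4" by linarith
  then show thesis
  proof cases
    case 1
    then have "max (2 * c) (1 - 2 * c) = 1 - 2 * c" by simp
    then show thesis using 1 assms
      by (intro that[of "2 * c"]) (auto simp: entropy_density_def binary_entropy_def algebra_simps diff_divide_distrib)
  next
    case 2
    have "log 2 (1 / 2) = (-1 :: real)" by (simp add: log_divide)
    then show thesis using 2
      by (intro that[of "1/2"]) (auto simp: entropy_density_def algebra_simps)
  next
    case 3
    then have "max (2 * c - 1) (1 - (2 * c - 1)) = 2 * c - 1" by simp
    then show thesis using 3 assms
      by (intro that[of "2 * c - 1"]) (auto simp: entropy_density_def binary_entropy_def algebra_simps diff_divide_distrib add_divide_distrib)
  qed
qed

lemma eventually_log_card_C5_free_less: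
  assumes c: "0 < c" "c < 1" and m: "edge_count_rounding c m" and a: "entropy_density c < a"
  shows "\<forall>\<^sub>F n in sequentially. 0 < card (induced_C5_free_graphs n (m n)) \<longrightarrow>
    log 2 (real (card (induced_C5_free_graphs n (m n)))) / real (n choose 2) < a"
proof -
  obtain p where p: "0 < p" "p < 1" and
    tilt: "log 2 (max p (1 - p)) / 2 - c * log 2 p - (1 - c) * log 2 (1 - p) = entropy_density c"
    using entropy_density_tilt[OF c] .
  define q where "q = max p (1 - p)"
  have q: "q > 0" using p unfolding q_def by simp
  define \<epsilon> where "\<epsilon> = (a - entropy_density c) / 2"
  have \<epsilon>: "\<epsilon> > 0" using a unfolding \<epsilon>_def by simp
  \<comment> \<open>Since \<open>n\<^sup>2\<close> is asymptotically twice the number of pairs, this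
    base contributes \<open>log 2 q / 2 + \<epsilon>\<close> to the exponent: half of the slack
    \<open>a - entropy_density c\<close> is spent here.\<close>
  define \<eta> where "\<eta> = (q * 2 powr (2 * \<epsilon>)) powr (1 / 4)"
  have \<eta>0: "\<eta> > 0" unfolding \<eta>_def using q by simp
  have "\<eta> ^ 4 = \<eta> powr 4" using \<eta>0 by (simp add: powr_numeral)
  also have "\<dots> = q * 2 powr (2 * \<epsilon>)" unfolding \<eta>_def powr_powr using q by simp
  also have "\<dots> > q * 1" using q \<epsilon> by (intro mult_strict_left_mono) auto
  finally have "max p (1 - p) < \<eta> ^ 4" unfolding q_def by simp
  from C5_free_mass_le[OF p this \<eta>0, where 'a = nat] obtain C where C: "C > 0"
    "\<And>n. bernoulli_mass p ([{1..n}]\<^bsup>2\<^esup>) (C5_free_graphs {1..n}) \<le> C * \<eta> ^ (n\<^sup>2)"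
    by (metis card_atLeastAtMost diff_Suc_1 finite_atLeastAtMost)
  have log\<eta>: "2 * log 2 \<eta> = log 2 q / 2 + \<epsilon>"
    unfolding \<eta>_def using q by (simp add: log_powr log_mult)
  define N where "N n = real (n choose 2)" for n :: nat
  define f where "f n = log 2 C * (1 / N n) + log 2 \<eta> * ((real n)\<^sup>2 / N n)
      - log 2 p * (real (m n) / N n) - log 2 (1 - p) * (1 - real (m n) / N n)" for n
  have "f \<longlonglongrightarrow> log 2 C * 0 + log 2 \<eta> * 2 - log 2 p * c - log 2 (1 - p) * (1 - c)"
    unfolding f_def
  proof (intro tendsto_intros)
    show "(\<lambda>n. 1 / N n) \<longlonglongrightarrow> 0" "(\<lambda>n. (real n)\<^sup>2 / N n) \<longlonglongrightarrow> 2"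
      unfolding N_def real_choose_two by real_asymp+
    show "(\<lambda>n. real (m n) / N n) \<longlonglongrightarrow> c" "(\<lambda>n. real (m n) / N n) \<longlonglongrightarrow> c"
      unfolding N_def by (rule edge_count_rounding_tendsto[OF m])+
  qed
  also have "log 2 C * 0 + log 2 \<eta> * 2 - log 2 p * c - log 2 (1 - p) * (1 - c) = entropy_density c + \<epsilon>"
    using log\<eta> tilt unfolding q_def by (simp add: algebra_simps)
  finally have "f \<longlonglongrightarrow> entropy_density c + \<epsilon>" .
  moreover have "entropy_density c + \<epsilon> < a" using a unfolding \<epsilon>_def by (simp add: field_simps)
  ultimately have "\<forall>\<^sub>F n in sequentially. f n < a" by (rule order_tendstoD(2))
  then show ?thesis
    using eventually_ge_at_top[of 2]
  proof eventually_elim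
    case (elim n)
    have N: "N n > 0" unfolding N_def using elim(2) by (simp add: zero_less_binomial)
    have mN: "m n \<le> n choose 2" using edge_count_rounding_le[OF m c(2)] .
    let ?k = "real (card (induced_C5_free_graphs n (m n)))"
    show ?case
    proof
      assume "0 < card (induced_C5_free_graphs n (m n))"
      then have k: "?k > 0" by simp
      have "?k * (p ^ m n * (1 - p) ^ ((n choose 2) - m n)) \<le> C * \<eta> ^ (n\<^sup>2)"
        using card_induced_C5_free_le_mass[OF p, of n "m n"] C(2)[of n] by linarith
      then have "log 2 (?k * (p ^ m n * (1 - p) ^ ((n choose 2) - m n))) \<le> log 2 (C * \<eta> ^ (n\<^sup>2))"
        using k p C \<eta>0 by (subst log_le_cancel_iff) auto
      then have "log 2 ?k + (real (m n) * log 2 p + (N n - real (m n)) * log 2 (1 - p))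
          \<le> log 2 C + (real n)\<^sup>2 * log 2 \<eta>"
        using k p C \<eta>0 mN by (simp add: log_mult log_nat_power of_nat_diff N_def)
      moreover have "f n * N n = log 2 C + (real n)\<^sup>2 * log 2 \<eta>
          - real (m n) * log 2 p - (N n - real (m n)) * log 2 (1 - p)"
        unfolding f_def using N by (simp add: field_simps)
      ultimately have "log 2 ?k \<le> f n * N n" by linarith
      then have "log 2 ?k / N n \<le> f n" using N by (simp add: divide_le_eq)
      then show "log 2 ?k / real (n choose 2) < a" using elim(1) unfolding N_def by linarith
    qed
  qed
qed

subsection \<open>Binomial coefficients and entropy\<close>

text \<open>\<open>T\<close> is the binomial distribution with success probability
  \<open>k / M\<close>, multiplied by \<open>M ^ M\<close>. Comparing the quotients of consecutive
  terms shows that it increases up to \<open>k\<close> and decreases afterwards.\<close>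

lemma binomial_mode_step:
  fixes M k j :: nat
  assumes k: "0 < k" "k < M"
  defines "T \<equiv> \<lambda>j. real (M choose j) * real k ^ j * real (M - k) ^ (M - j)"
  shows "j < k \<Longrightarrow> T j \<le> T (Suc j)" and "k \<le> j \<Longrightarrow> j < M \<Longrightarrow> T (Suc j) \<le> T j"
proof -
  have step: "T (Suc j) * (real (Suc j) * real (M - k)) = T j * (real (M - j) * real k)" if "j < M"
  proof -
    have "Suc j * (M choose Suc j) = (M choose j) * (M - j)"
      using binomial_absorb_comp[of M j] binomial_absorption[of j M]
      by (metis Suc_times_binomial_eq binomial_absorption mult.commute times_binomial_minus1_eq diff_Suc_1)
    then have b: "real (Suc j) * real (M choose Suc j) = real (M choose j) * real (M - j)"
      by (metis of_nat_mult)
    have "M - j = Suc (M - Suc j)" using that by simp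
    then have e: "real (M - k) ^ (M - j) = real (M - k) ^ (M - Suc j) * real (M - k)"
      by (metis power_Suc2)
    have "T (Suc j) * (real (Suc j) * real (M - k))
        = (real (Suc j) * real (M choose Suc j)) * (real k * real k ^ j) * (real (M - k) ^ (M - Suc j) * real (M - k))"
      unfolding T_def by (simp only: power_Suc ac_simps)
    also have "\<dots> = T j * (real (M - j) * real k)"
      unfolding b T_def e by (simp only: ac_simps)
    finally show ?thesis .
  qed
  have T0: "T i \<ge> 0" for i unfolding T_def by simp
  have pos: "real (Suc j) * real (M - k) > 0" using k by simp
  have Mk: "real (M - k) = real M - real k" using k by simp
  show "T j \<le> T (Suc j)" if "j < k"
  proof -
    \<comment> \<open>The difference of the two factors compared next is this quantity plus
      \<open>k\<close>.\<close>
    have "real M * (real k - real j - 1) \<ge> 0" using that by simp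
    then have "real (Suc j) * real (M - k) \<le> real (M - j) * real k"
      using that k by (simp add: Mk of_nat_diff algebra_simps)
    then have "T j * (real (Suc j) * real (M - k)) \<le> T (Suc j) * (real (Suc j) * real (M - k))"
      using step that k T0 by (simp only: less_trans) (intro mult_left_mono, auto)
    then show ?thesis using pos by (rule mult_right_le_imp_le)
  qed
  show "T (Suc j) \<le> T j" if "k \<le> j" "j < M"
  proof -
    have "real M * real k \<le> real M * real j" using that by (intro mult_left_mono) auto
    moreover have "real (M - j) * real k = real M * real k - real j * real k"
      using that by (simp add: of_nat_diff algebra_simps)
    moreover have "real (Suc j) * real (M - k) = real M * real j - real j * real k + (real M - real k)"
      by (simp add: Mk algebra_simps)
    moreover have "real k \<le> real M" using k by simp
    ultimately have "real (M - j) * real k \<le> real (Suc j) * real (M - k)" by linarith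
    then have "T (Suc j) * (real (Suc j) * real (M - k)) \<le> T j * (real (Suc j) * real (M - k))"
      using step that T0 by (simp only:) (intro mult_left_mono, auto)
    then show ?thesis using pos by (rule mult_right_le_imp_le)
  qed
qed

text \<open>The \<open>M + 1\<close> terms sum to \<open>M ^ M\<close> and the one at
  \<open>k\<close> is the largest, so it is at least the average. Taking logarithms turns this into
  the entropy bound with an error of only \<open>log 2 (M + 1)\<close>.\<close>

lemma binomial_ge_entropy:
  fixes M k :: nat
  assumes k: "0 < k" "k < M"
  shows "real M * binary_entropy (real k / real M) - log 2 (real M + 1) \<le> log 2 (real (M choose k))"
proof -
  define T where "T j = real (M choose j) * real k ^ j * real (M - k) ^ (M - j)" for j
  have up: "T j \<le> T k" if "j \<le> k" for j
    using that
  proof (induction j rule: inc_induct)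
    case (step j)
    then show ?case using binomial_mode_step(1)[OF k, of j] unfolding T_def by linarith
  qed simp
  have down: "j \<le> M \<longrightarrow> T j \<le> T k" if "k \<le> j" for j
    using that
  proof (induction j rule: dec_induct)
    case (step j)
    then show ?case using binomial_mode_step(2)[OF k, of j] unfolding T_def by auto
  qed simp
  have "real M ^ M = (real k + real (M - k)) ^ M" using k by simp
  also have "\<dots> = (\<Sum>j\<le>M. T j)" unfolding binomial_ring T_def by simp
  also have "\<dots> \<le> (\<Sum>j\<le>M. T k)" using up down by (intro sum_mono) (metis atMost_iff nat_le_linear)
  also have "\<dots> = (real M + 1) * T k" by (simp add: algebra_simps)
  finally have "log 2 (real M ^ M) \<le> log 2 ((real M + 1) * T k)"
    using k by (subst log_le_cancel_iff) (auto simp: T_def)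
  moreover have "log 2 ((real M + 1) * T k)
      = log 2 (real M + 1) + log 2 (real (M choose k)) + real k * log 2 (real k) + real (M - k) * log 2 (real (M - k))"
    unfolding T_def using k by (simp add: log_mult log_nat_power)
  moreover have "real M * binary_entropy (real k / real M)
      = real M * log 2 (real M) - real k * log 2 (real k) - real (M - k) * log 2 (real (M - k))"
  proof -
    have "1 - real k / real M = real (M - k) / real M" using k by (simp add: field_simps)
    then have "binary_entropy (real k / real M)
        = - (real k / real M) * (log 2 (real k) - log 2 (real M))
          - (real (M - k) / real M) * (log 2 (real (M - k)) - log 2 (real M))"
      unfolding binary_entropy_def using k by (simp add: log_divide)
    then have "real M * binary_entropy (real k / real M)
        = - real k * (log 2 (real k) - log 2 (real M)) - real (M - k) * (log 2 (real (M - k)) - log 2 (real M))"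
      using k by (simp add: right_diff_distrib)
    then show ?thesis using k by (simp add: algebra_simps)
  qed
  ultimately show ?thesis using k by (simp add: log_nat_power)
qed

section \<open>Continuity and symmetry of the entropy function\<close>

lemma tendsto_binary_entropy:
  assumes "(f \<longlongrightarrow> x) F" "0 < x" "x < 1"
  shows "((\<lambda>n. binary_entropy (f n)) \<longlongrightarrow> binary_entropy x) F"
  unfolding binary_entropy_def log_def using assms by (intro tendsto_intros) auto

lemma entropy_density_sym: "0 < c \<Longrightarrow> c < 1 \<Longrightarrow> entropy_density (1 - c) = entropy_density c"
proof -
  have sym: "binary_entropy (1 - x) = binary_entropy x" for x
    unfolding binary_entropy_def by (simp add: algebra_simps)
  have "2 * (1 - c) = 1 - (2 * c - 1)" "2 * (1 - c) - 1 = 1 - 2 * c" by auto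
  then have "binary_entropy (2 * (1 - c)) = binary_entropy (2 * c - 1)"
    "binary_entropy (2 * (1 - c) - 1) = binary_entropy (2 * c)"
    by (simp_all only: sym)
  then show ?thesis unfolding entropy_density_def by auto
qed

text \<open>Treats the increasing range and the plateau at once: \<open>min c (1/4)\<close> is the
  density that the cross edges of the construction will carry.\<close>

lemma entropy_density_min:
  assumes "c \<le> 1/2"
  shows "entropy_density c = binary_entropy (2 * min c (1/4)) / 2"
proof -
  have "log 2 (1 / 2) = (-1 :: real)" by (simp add: log_divide)
  then have "binary_entropy (1 / 2) = 1" by (simp add: binary_entropy_def)
  then show ?thesis
    using assms by (cases "c < 1/4") (simp_all add: entropy_density_def)
qed

subsection \<open>Many generalised split graphs\<close>

text \<open>The classes of \<open>g\<close> are numbered from 2 on, the number 1 being reserved for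
  the special part \<open>A\<close>.\<close>

lemma generalised_clique_partitionI:
  fixes g :: "'a \<Rightarrow> 'b"
  assumes fin: "finite V" and A: "A \<subseteq> V" "A \<noteq> {}" "clique A E"
    and g: "\<And>x y. x \<in> V - A \<Longrightarrow> y \<in> V - A \<Longrightarrow> x \<noteq> y \<Longrightarrow> {x, y} \<in> E \<longleftrightarrow> g x = g y"
  shows "admits_generalised_clique_partition V E"
proof -
  define I where "I = g ` (V - A)"
  have "finite I" unfolding I_def using fin by simp
  then obtain b where b: "bij_betw b I {2..<card I + 2}"
    by (metis add_diff_cancel_right' card_atLeastLessThan finite_atLeastLessThan finite_same_card_bij)
  have bI: "b (g x) \<in> {2..<card I + 2}" if "x \<in> V - A" for x
    using b that unfolding I_def by (auto simp: bij_betw_def)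
  have binj: "b (g x) = b (g y) \<longleftrightarrow> g x = g y" if "x \<in> V - A" "y \<in> V - A" for x y
    using b that unfolding I_def by (auto simp: bij_betw_def inj_on_def)
  define P where "P i = (if i = 1 then A else {x \<in> V - A. b (g x) = i})" for i :: nat
  have "generalised_clique_partition V E (card I + 1) P"
    unfolding generalised_clique_partition_def
  proof (intro conjI ballI impI)
    show "(\<Union>i\<in>{1..card I + 1}. P i) = V"
    proof
      show "(\<Union>i\<in>{1..card I + 1}. P i) \<subseteq> V" using A unfolding P_def by auto
      show "V \<subseteq> (\<Union>i\<in>{1..card I + 1}. P i)"
      proof
        fix x assume x: "x \<in> V"
        show "x \<in> (\<Union>i\<in>{1..card I + 1}. P i)"
        proof (cases "x \<in> A")
          case True
          then show ?thesis unfolding P_def by (intro UN_I[of 1]) auto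
        next
          case False
          then show ?thesis using bI[of x] x unfolding P_def by (intro UN_I[of "b (g x)"]) auto
        qed
      qed
    qed
    show "disjoint_family_on P {1..card I + 1}"
      unfolding disjoint_family_on_def P_def by auto
    fix i assume i: "i \<in> {1..card I + 1}"
    show "P i \<noteq> {}"
    proof (cases "i = 1")
      case True
      then show ?thesis using A unfolding P_def by simp
    next
      case False
      then have "i \<in> b ` I" using i b by (auto simp: bij_betw_def)
      then show ?thesis using False unfolding P_def I_def by auto
    qed
    show "clique (P i) E"
      using A(3) g binj unfolding P_def clique_def by auto
    fix j x y assume "j \<in> {1..card I + 1}" "i > j \<and> j > 1" "x \<in> P i" "y \<in> P j"
    then have xy: "x \<in> V - A" "y \<in> V - A" "b (g x) \<noteq> b (g y)" unfolding P_def by (auto split: if_splits)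
    then show "{x, y} \<notin> E" using g[of x y] by metis
  qed
  then show ?thesis unfolding admits_generalised_clique_partition_def by blast
qed

text \<open>The first \<open>h\<close> vertices are independent; on the others all pairs are edges
  except those inside a set of \<open>b\<close> vertices. In the complement the first set is a
  clique and the others form one clique with isolated vertices, whatever the cross edges are. The
  inner edges number \<open>e\<close>, so \<open>m - e\<close> cross edges can be chosen
  freely.\<close>

lemma card_generalised_split_graphs_ge:
  assumes h: "1 \<le> h" "h + b \<le> n" and m: "e \<le> m"
    and e: "e = ((n - h) choose 2) - (b choose 2)"
  shows "(h * (n - h)) choose (m - e) \<le> card (generalised_split_graphs n m)"
proof -
  define A where "A = {1..h}"
  define B where "B = {h+1..n}"
  define D where "D = {h+1..h+b}"
  define E0 where "E0 = [B]\<^bsup>2\<^esup> - [D]\<^bsup>2\<^esup>"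
  define X where "X = (\<lambda>(x, y). {x, y}) ` (A \<times> B)"
  have V: "{1..n} = A \<union> B" "A \<inter> B = {}" using h unfolding A_def B_def by auto
  have DB: "D \<subseteq> B" using h unfolding B_def D_def by auto
  have fin: "finite A" "finite B" "finite D" unfolding A_def B_def D_def by auto
  have fin2: "finite ([B]\<^bsup>2\<^esup>)" "finite ([D]\<^bsup>2\<^esup>)" using fin by (auto simp: finite_imp_finite_nsets)
  have cE0: "card E0 = e"
    unfolding E0_def e using nsets_mono[OF DB, of 2] fin2
    by (subst card_Diff_subset) (auto simp: B_def D_def)
  have "inj_on (\<lambda>(x, y). {x, y}) (A \<times> B)"
    using V(2) by (auto simp: inj_on_def doubleton_eq_iff)
  then have cX: "card X = h * (n - h)"
    unfolding X_def by (subst card_image) (auto simp: A_def B_def card_cartesian_product)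
  have finX: "finite X" unfolding X_def using fin by auto
  have EX: "E0 \<inter> X = {}" unfolding E0_def X_def using V(2) by auto
  have finE0: "finite E0" unfolding E0_def using fin2 by auto
  have "{F. F \<subseteq> X \<and> card F = m - e} = nsets X (m - e)"
    using finX finite_subset unfolding nsets_def by auto
  then have "(h * (n - h)) choose (m - e) = card {F. F \<subseteq> X \<and> card F = m - e}"
    using cX by simp
  also have "\<dots> = card ((\<lambda>F. E0 \<union> F) ` {F. F \<subseteq> X \<and> card F = m - e})"
    using EX by (subst card_image) (auto simp: inj_on_def)
  also have "\<dots> \<le> card (generalised_split_graphs n m)"
  proof (rule card_mono)
    show "finite (generalised_split_graphs n m)"
      by (rule finite_subset[of _ "Pow ([{1..n}]\<^bsup>2\<^esup>)"])
         (auto simp: generalised_split_graphs_def graphs_with_edges_def finite_imp_finite_nsets)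
    show "(\<lambda>F. E0 \<union> F) ` {F. F \<subseteq> X \<and> card F = m - e} \<subseteq> generalised_split_graphs n m"
    proof
      fix E assume "E \<in> (\<lambda>F. E0 \<union> F) ` {F. F \<subseteq> X \<and> card F = m - e}"
      then obtain F where F: "E = E0 \<union> F" "F \<subseteq> X" "card F = m - e" by blast
      have "E0 \<subseteq> [{1..n}]\<^bsup>2\<^esup>" unfolding E0_def using nsets_mono[of B "{1..n}" 2] V by auto
      moreover have "X \<subseteq> [{1..n}]\<^bsup>2\<^esup>" unfolding X_def V using V(2) by auto
      ultimately have E: "E \<subseteq> [{1..n}]\<^bsup>2\<^esup>" using F by auto
      have "card E = card E0 + card F"
        unfolding F(1) using EX F(2) finE0 finX finite_subset by (intro card_Un_disjoint) auto
      then have "card E = m" using cE0 F(3) m by simp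
      have "admits_generalised_clique_partition {1..n} (complement_edges {1..n} E)"
      \<comment> \<open>Vertices outside \<open>D\<close> form singleton classes; the label 0 of
        \<open>D\<close> is not a vertex, so no class merges with it.\<close>
      proof (rule generalised_clique_partitionI[where A = A and g = "\<lambda>x. if x \<in> D then 0 else x"])
        show "A \<subseteq> {1..n}" "A \<noteq> {}" using h unfolding A_def by auto
        have "{x, y} \<notin> E0" "{x, y} \<notin> X" if "x \<in> A" "y \<in> A" for x y
          using that V(2) unfolding E0_def X_def by (auto simp: doubleton_eq_iff)
        then show "clique A (complement_edges {1..n} E)"
          using F V unfolding clique_def complement_edges_def by auto
        fix x y assume xy: "x \<in> {1..n} - A" "y \<in> {1..n} - A" "x \<noteq> y"
        then have B: "x \<in> B" "y \<in> B" using V by auto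
        then have "{x, y} \<notin> X" using V(2) unfolding X_def by (auto simp: doubleton_eq_iff)
        then have "{x, y} \<notin> F" using F(2) by auto
        then have "{x, y} \<in> complement_edges {1..n} E \<longleftrightarrow> x \<in> D \<and> y \<in> D"
          using xy B unfolding complement_edges_def F(1) E0_def by auto
        then show "{x, y} \<in> complement_edges {1..n} E \<longleftrightarrow> (if x \<in> D then 0 else x) = (if y \<in> D then 0 else y)"
          using xy by auto
      qed simp
      then show "E \<in> generalised_split_graphs n m"
        using E \<open>card E = m\<close>
        unfolding generalised_split_graphs_def graphs_with_edges_def generalised_split_graph_def by simp
    qed
  qed
  finally show ?thesis .
qed

lemma card_generalised_split_graphs_complement:
  assumes "m \<le> n choose 2"
  shows "card (generalised_split_graphs n m) = card (generalised_split_graphs n ((n choose 2) - m))"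
proof (rule bij_betw_same_card)
  let ?D = "[{1..n}]\<^bsup>2\<^esup>"
  have cc: "complement_edges {1..n} (complement_edges {1..n} E) = E" if "E \<subseteq> ?D" for E
    using that unfolding complement_edges_def by auto
  have fin: "finite ?D" by (simp add: finite_imp_finite_nsets)
  have mem: "complement_edges {1..n} E \<in> generalised_split_graphs n ((n choose 2) - k)"
    if "E \<in> generalised_split_graphs n k" for E k
  proof -
    have E: "E \<subseteq> ?D" "card E = k" "generalised_split_graph {1..n} E"
      using that unfolding generalised_split_graphs_def graphs_with_edges_def by auto
    have "card (complement_edges {1..n} E) = (n choose 2) - k"
      unfolding complement_edges_def using E fin finite_subset by (subst card_Diff_subset) auto
    moreover have "generalised_split_graph {1..n} (complement_edges {1..n} E)"
      using E(3) unfolding generalised_split_graph_def cc[OF E(1)] by blast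
    ultimately show ?thesis
      unfolding generalised_split_graphs_def graphs_with_edges_def complement_edges_def by auto
  qed
  show "bij_betw (complement_edges {1..n}) (generalised_split_graphs n m)
      (generalised_split_graphs n ((n choose 2) - m))"
  proof (rule bij_betw_byWitness[where f' = "complement_edges {1..n}"])
    show "complement_edges {1..n} ` generalised_split_graphs n m
        \<subseteq> generalised_split_graphs n ((n choose 2) - m)"
      using mem[of _ m] by blast
    show "complement_edges {1..n} ` generalised_split_graphs n ((n choose 2) - m)
        \<subseteq> generalised_split_graphs n m"
      using mem[of _ "(n choose 2) - m"] assms by auto
  qed (use cc in \<open>auto simp only: generalised_split_graphs_def graphs_with_edges_def mem_Collect_eq\<close>)
qed

section \<open>Parameters of the lower bound\<close>

text \<open>About half of all pairs are cross pairs, and the number of choices is largest when half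
  of these are used, a density of 1/4. So the cross edges carry density
  \<open>d = min c (1/4)\<close> and the dense half absorbs the surplus \<open>c - d\<close>. It can
  hold density at most 1/4, which limits \<open>c\<close> to 1/2.\<close>

lemma split_graphs_lower_bound_le_half:
  assumes c: "0 < c" "c \<le> 1/2"
    and m: "(\<lambda>n. real (m n) / real (n choose 2)) \<longlonglongrightarrow> c"
  shows "\<exists>f. f \<longlonglongrightarrow> entropy_density c \<and> (\<forall>\<^sub>F n in sequentially.
    0 < card (generalised_split_graphs n (m n)) \<and>
    f n \<le> log 2 (real (card (generalised_split_graphs n (m n)))) / real (n choose 2))"
proof -
  define N where "N n = real (n choose 2)" for n :: nat
  define d where "d = min c (1/4)"
  \<comment> \<open>Solves \<open>1/4 - \<beta>\<^sup>2 = c - d\<close>, the density of edges in a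
    half of the vertices after deleting a clique on \<open>\<beta> * n\<close> of them. For
    \<open>c \<le> 1/4\<close> this gives \<open>\<beta> = 1/2\<close>, and that half is essentially
    edgeless.\<close>
  define \<beta> where "\<beta> = sqrt (1/4 - (c - d))"
  have d: "0 < d" "2 * d < 1" "c - d \<le> 1/4" "0 \<le> c - d" using c unfolding d_def by auto
  have \<beta>: "0 \<le> \<beta>" "\<beta> \<le> 1/2" "\<beta>\<^sup>2 = 1/4 - (c - d)"
    using d real_sqrt_le_mono[of "1/4 - (c - d)" "1/4"] unfolding \<beta>_def by (auto simp: real_sqrt_divide)
  define h where "h n = n div 2" for n :: nat
  define b where "b n = nat \<lfloor>\<beta> * real n\<rfloor>" for n
  define e where "e n = ((n - h n) choose 2) - (b n choose 2)" for n
  define M where "M n = h n * (n - h n)" for n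
  define k where "k n = m n - e n" for n
  have hn: "\<bar>real (h n) - real n / 2\<bar> \<le> 1/2" "h n \<le> n" for n unfolding h_def by linarith+
  have bn: "real (b n) \<le> \<beta> * real n" "\<beta> * real n - 1 \<le> real (b n)" for n
  proof -
    have "0 \<le> \<beta> * real n" using \<beta> by simp
    then show "real (b n) \<le> \<beta> * real n" "\<beta> * real n - 1 \<le> real (b n)" unfolding b_def by linarith+
  qed
  have bh: "h n + b n \<le> n" for n
  proof -
    have "real (b n) \<le> real n / 2" using bn(1)[of n] mult_right_mono[OF \<beta>(2), of "real n"] by simp
    then show ?thesis unfolding h_def by linarith
  qed
  have inv: "(\<lambda>n. 1 / real n) \<longlonglongrightarrow> 0" by real_asymp
  have hlim: "(\<lambda>n. real (h n) / real n) \<longlonglongrightarrow> 1/2"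
  proof (rule LIM_zero_cancel, rule Lim_null_comparison[OF _ inv], rule eventually_sequentiallyI[of 1])
    fix n :: nat assume n: "1 \<le> n"
    then have "real (h n) / real n - 1/2 = (real (h n) - real n / 2) / real n" by (simp add: field_simps)
    then have "norm (real (h n) / real n - 1/2) = \<bar>real (h n) - real n / 2\<bar> / real n" using n by simp
    also have "\<dots> \<le> 1 / real n" using hn(1)[of n] by (intro divide_right_mono) auto
    finally show "norm (real (h n) / real n - 1/2) \<le> 1 / real n" .
  qed
  have blim: "(\<lambda>n. real (b n) / real n) \<longlonglongrightarrow> \<beta>"
  proof (rule LIM_zero_cancel, rule Lim_null_comparison[OF _ inv], rule eventually_sequentiallyI[of 1])
    fix n :: nat assume n: "1 \<le> n"
    then have "real (b n) / real n - \<beta> = (real (b n) - \<beta> * real n) / real n" by (simp add: field_simps)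
    then have "norm (real (b n) / real n - \<beta>) = \<bar>real (b n) - \<beta> * real n\<bar> / real n" using n by simp
    also have "\<dots> \<le> 1 / real n" using bn[of n] by (intro divide_right_mono) auto
    finally show "norm (real (b n) / real n - \<beta>) \<le> 1 / real n" .
  qed
  have hlim': "(\<lambda>n. real (n - h n) / real n) \<longlonglongrightarrow> 1/2"
  proof -
    have "(\<lambda>n. 1 - real (h n) / real n) \<longlonglongrightarrow> 1 - 1/2" by (intro tendsto_intros hlim)
    moreover have "\<forall>\<^sub>F n in sequentially. 1 - real (h n) / real n = real (n - h n) / real n"
      using eventually_gt_at_top[of 0] by eventually_elim (use hn(2) in \<open>simp add: of_nat_diff diff_divide_distrib\<close>)
    ultimately show ?thesis by (simp add: tendsto_cong)
  qed
  have elim: "(\<lambda>n. real (e n) / N n) \<longlonglongrightarrow> c - d"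
  proof -
    have "(\<lambda>n. real ((n - h n) choose 2) / N n - real (b n choose 2) / N n) \<longlonglongrightarrow> (1/2)\<^sup>2 - \<beta>\<^sup>2"
      unfolding N_def by (intro tendsto_intros tendsto_choose_two_ratio hlim' blim)
    moreover have "real (e n) / N n = real ((n - h n) choose 2) / N n - real (b n choose 2) / N n" for n
    proof -
      have "b n \<le> n - h n" using bh[of n] by linarith
      then have "b n choose 2 \<le> (n - h n) choose 2" by (rule binomial_right_mono)
      then show ?thesis unfolding e_def by (simp add: of_nat_diff diff_divide_distrib)
    qed
    ultimately show ?thesis unfolding \<beta>(3) by (simp add: power2_eq_square)
  qed
  have "(\<lambda>n. real (m n) / N n - real (e n) / N n) \<longlonglongrightarrow> c - (c - d)"
    using m unfolding N_def[symmetric] by (intro tendsto_intros elim)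
  then have diff: "(\<lambda>n. real (m n) / N n - real (e n) / N n) \<longlonglongrightarrow> d" by simp
  have "\<forall>\<^sub>F n in sequentially. 0 < real (m n) / N n - real (e n) / N n"
    using order_tendstoD(1)[OF diff d(1)] .
  then have em: "\<forall>\<^sub>F n in sequentially. e n < m n"
    using eventually_ge_at_top[of 2]
  proof eventually_elim
    case (elim n)
    then have "N n > 0" unfolding N_def by (simp add: zero_less_binomial)
    then show ?case using elim(1) by (simp add: divide_less_cancel)
  qed
  have klim: "(\<lambda>n. real (k n) / N n) \<longlonglongrightarrow> d"
  proof (rule Lim_transform_eventually[OF diff])
    show "\<forall>\<^sub>F n in sequentially. real (m n) / N n - real (e n) / N n = real (k n) / N n"
      using em by eventually_elim (simp add: k_def of_nat_diff diff_divide_distrib)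
  qed
  have Mlim: "(\<lambda>n. real (M n) / N n) \<longlonglongrightarrow> 1/2"
  proof -
    have "(\<lambda>n. (real n)\<^sup>2 / N n) \<longlonglongrightarrow> 2" unfolding N_def real_choose_two by real_asymp
    then have "(\<lambda>n. (real (h n) / real n) * (real (n - h n) / real n) * ((real n)\<^sup>2 / N n)) \<longlonglongrightarrow> (1/2) * (1/2) * 2"
      by (intro tendsto_intros hlim hlim')
    moreover have "\<forall>\<^sub>F n in sequentially.
        (real (h n) / real n) * (real (n - h n) / real n) * ((real n)\<^sup>2 / N n) = real (M n) / N n"
      using eventually_gt_at_top[of 0] by eventually_elim (simp add: M_def power2_eq_square)
    ultimately show ?thesis by (simp add: tendsto_cong)
  qed
  have kMlim: "(\<lambda>n. real (k n) / real (M n)) \<longlonglongrightarrow> 2 * d"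
  proof -
    have "(\<lambda>n. (real (k n) / N n) / (real (M n) / N n)) \<longlonglongrightarrow> d / (1/2)"
      by (intro tendsto_intros klim Mlim) auto
    moreover have "\<forall>\<^sub>F n in sequentially. (real (k n) / N n) / (real (M n) / N n) = real (k n) / real (M n)"
      using eventually_ge_at_top[of 2] by eventually_elim (simp add: N_def)
    ultimately have "(\<lambda>n. real (k n) / real (M n)) \<longlonglongrightarrow> d / (1/2)"
      by (rule Lim_transform_eventually)
    then show ?thesis by (simp add: mult.commute)
  qed
  have loglim: "(\<lambda>n. log 2 (real (M n) + 1) / N n) \<longlonglongrightarrow> 0"
  proof (rule Lim_null_comparison)
    show "(\<lambda>n. log 2 ((real n)\<^sup>2 + 1) / N n) \<longlonglongrightarrow> 0"
      unfolding N_def real_choose_two log_def by real_asymp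
    have "norm (log 2 (real (M n) + 1) / N n) \<le> log 2 ((real n)\<^sup>2 + 1) / N n" for n
    proof -
      have "M n \<le> n * n" unfolding M_def using hn(2)[of n] by (intro mult_le_mono) auto
      then have "real (M n) \<le> (real n)\<^sup>2" by (metis of_nat_le_iff of_nat_mult power2_eq_square)
      then have "log 2 (real (M n) + 1) \<le> log 2 ((real n)\<^sup>2 + 1)" by (subst log_le_cancel_iff) (auto simp: add_nonneg_pos)
      moreover have "0 \<le> log 2 (real (M n) + 1)" by simp
      moreover have "0 \<le> N n" unfolding N_def by simp
      ultimately show ?thesis by (simp add: divide_right_mono)
    qed
    then show "\<forall>\<^sub>F n in sequentially. norm (log 2 (real (M n) + 1) / N n) \<le> log 2 ((real n)\<^sup>2 + 1) / N n"
      by simp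
  qed
  define f where "f n = (real (M n) / N n) * binary_entropy (real (k n) / real (M n)) - log 2 (real (M n) + 1) / N n" for n
  have "f \<longlonglongrightarrow> (1/2) * binary_entropy (2 * d) - 0"
    unfolding f_def using d by (intro tendsto_intros Mlim loglim tendsto_binary_entropy kMlim) auto
  then have flim: "f \<longlonglongrightarrow> entropy_density c"
    unfolding entropy_density_min[OF c(2)] d_def by simp
  have "\<forall>\<^sub>F n in sequentially. real (k n) / real (M n) < 1"
    using order_tendstoD(2)[OF kMlim d(2)] .
  then have "\<forall>\<^sub>F n in sequentially. 0 < card (generalised_split_graphs n (m n)) \<and>
    f n \<le> log 2 (real (card (generalised_split_graphs n (m n)))) / real (n choose 2)"
    using em eventually_ge_at_top[of 2]
  proof eventually_elim
    case (elim n)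
    have N: "N n > 0" unfolding N_def using elim(3) by (simp add: zero_less_binomial)
    have h1: "1 \<le> h n" "h n < n" using elim(3) unfolding h_def by auto
    then have "0 < M n" unfolding M_def by simp
    then have kM: "0 < k n" "k n < M n" using elim(1,2) unfolding k_def by auto
    have le: "M n choose k n \<le> card (generalised_split_graphs n (m n))"
      unfolding M_def k_def using h1 bh elim(2) e_def by (intro card_generalised_split_graphs_ge) auto
    have pos: "0 < M n choose k n" using kM by (simp add: zero_less_binomial)
    have cpos: "0 < card (generalised_split_graphs n (m n))" using less_le_trans[OF pos le] .
    have "log 2 (real (M n choose k n)) \<le> log 2 (real (card (generalised_split_graphs n (m n))))"
      using le pos cpos by simp
    moreover have "f n * N n \<le> log 2 (real (M n choose k n))"
      using binomial_ge_entropy[OF kM] N unfolding f_def by (simp add: left_diff_distrib)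
    ultimately have "f n \<le> log 2 (real (card (generalised_split_graphs n (m n)))) / N n"
      using N by (simp add: le_divide_eq)
    then show ?case using cpos unfolding N_def by blast
  qed
  then show ?thesis using flim by blast
qed

lemma split_graphs_lower_bound:
  assumes c: "0 < c" "c < 1" and m: "edge_count_rounding c m"
  shows "\<exists>f. f \<longlonglongrightarrow> entropy_density c \<and> (\<forall>\<^sub>F n in sequentially.
    0 < card (generalised_split_graphs n (m n)) \<and>
    f n \<le> log 2 (real (card (generalised_split_graphs n (m n)))) / real (n choose 2))"
proof (cases "c \<le> 1/2")
  case True
  then show ?thesis
    using split_graphs_lower_bound_le_half[OF c(1)] edge_count_rounding_tendsto[OF m] by blast
next
  case False
  have le: "m n \<le> n choose 2" for n using edge_count_rounding_le[OF m c(2)] .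
  have "(\<lambda>n. 1 - real (m n) / real (n choose 2)) \<longlonglongrightarrow> 1 - c"
    by (intro tendsto_intros edge_count_rounding_tendsto m)
  moreover have "\<forall>\<^sub>F n in sequentially.
      1 - real (m n) / real (n choose 2) = real ((n choose 2) - m n) / real (n choose 2)"
    using eventually_ge_at_top[of 2]
  proof eventually_elim
    case (elim n)
    then have "real (n choose 2) > 0" by (simp add: zero_less_binomial)
    then show ?case using le[of n] by (simp add: of_nat_diff diff_divide_distrib)
  qed
  ultimately have "(\<lambda>n. real ((n choose 2) - m n) / real (n choose 2)) \<longlonglongrightarrow> 1 - c"
    by (rule Lim_transform_eventually)
  from split_graphs_lower_bound_le_half[OF _ _ this] False c show ?thesis
    by (simp add: card_generalised_split_graphs_complement[OF le, symmetric] entropy_density_sym[OF c])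
qed

section \<open>The three limits by sandwiching\<close>

theorem theorem1p2:
  fixes c :: real and m :: "nat \<Rightarrow> nat"
  assumes "0 < c" and "c < 1"
    and "edge_count_rounding c m"
  shows "((\<lambda>n. log 2 (real (card (induced_C5_free_graphs n (m n)))) / real (n choose 2))
            \<longlonglongrightarrow> entropy_density c) \<and>
         ((\<lambda>n. log 2 (real (card (perfect_graphs n (m n)))) / real (n choose 2))
            \<longlonglongrightarrow> entropy_density c) \<and>
         ((\<lambda>n. log 2 (real (card (generalised_split_graphs n (m n)))) / real (n choose 2))
            \<longlonglongrightarrow> entropy_density c)"
proof -
  define S where "S n = generalised_split_graphs n (m n)" for n
  define C where "C n = induced_C5_free_graphs n (m n)" for n
  define L where "L X = log 2 (real (card X))" for X :: "nat set set set"
  have finC: "finite (C n)" for n unfolding C_def by (rule finite_induced_C5_free_graphs)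
  obtain f where f: "f \<longlonglongrightarrow> entropy_density c"
    and fS: "\<forall>\<^sub>F n in sequentially. 0 < card (S n) \<and> f n \<le> L (S n) / real (n choose 2)"
    using split_graphs_lower_bound[OF assms] unfolding S_def L_def by blast
  have sandwich: "(\<lambda>n. L (X n) / real (n choose 2)) \<longlonglongrightarrow> entropy_density c"
    if SX: "\<And>n. S n \<subseteq> X n" and XC: "\<And>n. X n \<subseteq> C n" for X
  proof (rule order_tendstoI)
    have finX: "finite (X n)" for n using XC finC finite_subset by blast
    \<comment> \<open>The comparison of logarithms requires a non-empty smaller family; the lower
      bound for split graphs supplies this for all large \<open>n\<close>.\<close>
    have mono: "L A / real (n choose 2) \<le> L B / real (n choose 2)"
      if "A \<subseteq> B" "finite B" "0 < card A" for A B n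
    proof -
      have "card A \<le> card B" using that by (intro card_mono)
      then have "L A \<le> L B" unfolding L_def using that(3) by (subst log_le_cancel_iff) auto
      then show ?thesis by (intro divide_right_mono) auto
    qed
    show "\<forall>\<^sub>F n in sequentially. a < L (X n) / real (n choose 2)" if "a < entropy_density c" for a
      using order_tendstoD(1)[OF f that] fS
    proof eventually_elim
      case (elim n)
      then show ?case using mono[OF SX finX, of n n] by linarith
    qed
    show "\<forall>\<^sub>F n in sequentially. L (X n) / real (n choose 2) < a" if "entropy_density c < a" for a
      using eventually_log_card_C5_free_less[OF assms that] fS
    proof eventually_elim
      case (elim n)
      have "card (S n) \<le> card (X n)" "card (X n) \<le> card (C n)"
        by (intro card_mono finX finC SX XC)+
      then have pos: "0 < card (X n)" "0 < card (C n)" using elim(2) by linarith+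
      then show ?case
        using mono[OF XC finC pos(1), of n] elim(1) unfolding C_def L_def by fastforce
    qed
  qed
  define P where "P n = perfect_graphs n (m n)" for n
  have SP: "S n \<subseteq> P n" for n
    using generalised_split_graph_perfect[of "{1..n}"]
    unfolding S_def P_def generalised_split_graphs_def perfect_graphs_def graphs_with_edges_def by auto
  have PC: "P n \<subseteq> C n" for n
    using perfect_graph_C5_free[of "{1..n}"]
    unfolding C_def P_def induced_C5_free_graphs_def perfect_graphs_def graphs_with_edges_def by auto
  have SC: "S n \<subseteq> C n" for n using SP PC by blast
  show ?thesis
    using sandwich[of C, OF SC order_refl] sandwich[of P, OF SP PC] sandwich[of S, OF order_refl SC]
    unfolding C_def P_def S_def L_def by blast
qed

end
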